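(* Let $\mathcal G$ denote the simple complex of groups formed by the seven subgroups $G_\alpha=\bigcap_{v\in\alpha}G_v$, $\varnothing\ne\alpha\subseteq\{p,d,q\}$, of $(\mathrm{SU}(3)\times\mathrm{SU}(3))/Z$, where $G_p,G_d,G_q$ and $Z$ are as defined in the context. Up to isomorphism, there is exactly one homogeneous compact geometry $(G,\Delta)$ of type $\mathsf C_3$ belonging to this complex of groups $\mathcal G$.
   Context: The complex of groups. In $\mathrm{SU}(3)\times\mathrm{SU}(3)$ let $K_p=\{(\bar X,X):X\in \mathrm{SU}(3)\}$, $K_q=\{(Y_1,\mathrm{diag}(Y_2,y)): Y_1\in\mathrm{SU}(3),\,Y_2\in \mathrm U(2),\ y=\overline{\det Y_2}\}$, $K_d=\{(\mathrm{diag}(\bar z,Z_2),\mathrm{diag}(z,Z_1)):z\in\mathrm U(1),\,Z_1,Z_2\in\mathrm U(2)\}\cap(\mathrm{SU}(3)\times\mathrm{SU}(3))$ (block diagonal matrices), let $Z\cong\mathbb Z/3$ be the intersection of $K_p\cap K_d\cap K_q$ with the center of $\mathrm{SU}(3)\times\mathrm{SU}(3)$, and put $G_p=K_p/Z$, $G_d=K_d/Z$, $G_q=K_q/Z$, subgroups of $(\mathrm{SU}(3)\times\mathrm{SU}(3))/Z$. $\mathcal G$ consists of the groups $G_\alpha=\bigcap_{v\in\alpha}G_v$ with the inclusions $G_\beta\hookrightarrow G_\alpha$ for $\alpha\subseteq\beta$. The type $\mathsf C_3$ is taken over the index set $\{p,d,q\}$ with $M_{q,d}=3$, $M_{d,p}=4$,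 $M_{p,q}=2$. Geometries. A simplicial complex $\Delta$ with nonempty vertex set $V$ is a collection of finite subsets of $V$ (simplices), closed under passing to subsets, with union $V$; it is a flag complex if every finite set of pairwise adjacent vertices is a simplex. The link of $\alpha\in\Delta$ is $\mathrm{lk}(\alpha)=\{\beta\in\Delta:\alpha\cap\beta=\varnothing,\ \alpha\cup\beta\in\Delta\}$. $\Delta$ is pure of rank $n$ if every simplex lies in a maximal one and all maximal simplices (the chambers) have $n$ vertices; the corank of $\alpha$ is $n-|\alpha|$. A chamber complex is a pure complex in which any two chambers can be joined by a gallery (a finite sequence of chambers, consecutive ones intersecting in corank at most $1$). The link of a corank $1$ simplex is called a panel; $\Delta$ is thick if every corank $1$ simplex lies in at least $3$ chambers. A geometry over a finite set $I$ with $n$ elements is a thick chamber complex of rank $n$ with a type function $t:V\to I$ that is injective on simplices, such that $\Delta$ is a flag complex and the link of every nonmaximal simplex is a chamber complex. The type of $\alpha$ is $t(\alpha)$, its cotype is $I\setminus t(\alpha)$. Automorphisms and maps between geometries are type-preserving simplicial maps. A generalized $k$-gon ($k\ge2$) is a rank $2$ geometry (a bipartite graph) of girth $2k$ and diameter $k$. For a Coxeter matrix $M$ over $I$, a geometry is of type $M$ if the link of every corank $2$ simplex of cotype $\{i,j\}$ is a generalized $M_{i,j}$-gon. Homogeneous compact geometries. A homogeneous compact geometry is a pair $(G,\Delta)$ with $G$ a locally compact group acting transitively (by type-preserving automorphisms) on the chambers of a geometry $\Delta$ of type $M$, all simplex stabilizers being closed and cocompact; then the vertex set and the sets of simplices of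 a given type carry the compact topologies of the corresponding coset spaces. It has connected panels if all panels are connected in this topology. We consider homogeneous compact geometries with connected panels in which $G$ is compact and acts faithfully. Such a geometry $(G,\Delta)$ belongs to $\mathcal G$ if there are a chamber $\gamma$ of $\Delta$ and a (type-compatible, continuous) isomorphism between $\mathcal G$ and the simple complex of groups formed by the stabilizers $G_\alpha$, $\varnothing\neq\alpha\subseteq\gamma$, and their inclusions. Isomorphisms are equivariant isomorphisms with continuous group isomorphisms. *)

theory Defs
  imports "HOL-Analysis.Analysis" "HOL-Algebra.Group_Action" "HOL-Library.Extended_Nat"
begin

text \<open>A complex is identified with its set of simplices; its vertex set is the union
  \<open>\<Union>\<Delta>\<close>, and the empty set is one of its simplices.\<close>

definition simplicial_complex :: "'v set set \<Rightarrow> bool" where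
  "simplicial_complex \<Delta> \<longleftrightarrow>
     \<Union>\<Delta> \<noteq> {} \<and> (\<forall>\<alpha>\<in>\<Delta>. finite \<alpha> \<and> (\<forall>\<beta>. \<beta> \<subseteq> \<alpha> \<longrightarrow> \<beta> \<in> \<Delta>))"

definition flag_complex :: "'v set set \<Rightarrow> bool" where
  "flag_complex \<Delta> \<longleftrightarrow>
     (\<forall>\<alpha>. finite \<alpha> \<and> \<alpha> \<subseteq> \<Union>\<Delta> \<and> (\<forall>x\<in>\<alpha>. \<forall>y\<in>\<alpha>. x \<noteq> y \<longrightarrow> {x, y} \<in> \<Delta>) \<longrightarrow> \<alpha> \<in> \<Delta>)"

definition link :: "'v set set \<Rightarrow> 'v set \<Rightarrow> 'v set set" where
  "link \<Delta> \<alpha> = {\<beta> \<in> \<Delta>. \<alpha> \<inter> \<beta> = {} \<and> \<alpha> \<union> \<beta> \<in> \<Delta>}"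

definition chambers :: "'v set set \<Rightarrow> 'v set set" where
  "chambers \<Delta> = {\<gamma> \<in> \<Delta>. \<forall>\<beta>\<in>\<Delta>. \<gamma> \<subseteq> \<beta> \<longrightarrow> \<beta> = \<gamma>}"

definition pure_of_rank :: "nat \<Rightarrow> 'v set set \<Rightarrow> bool" where
  "pure_of_rank n \<Delta> \<longleftrightarrow>
     (\<forall>\<alpha>\<in>\<Delta>. \<exists>\<gamma>\<in>chambers \<Delta>. \<alpha> \<subseteq> \<gamma>) \<and> (\<forall>\<gamma>\<in>chambers \<Delta>. card \<gamma> = n)"

text \<open>Consecutive chambers of a gallery meet in corank at most 1, i.e. in a simplex with
  at least \<open>n - 1\<close> vertices.\<close>

definition gallery :: "nat \<Rightarrow> 'v set set \<Rightarrow> 'v set list \<Rightarrow> bool" where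
  "gallery n \<Delta> cs \<longleftrightarrow>
     cs \<noteq> [] \<and> set cs \<subseteq> chambers \<Delta> \<and> successively (\<lambda>c d. n \<le> card (c \<inter> d) + 1) cs"

definition chamber_complex :: "nat \<Rightarrow> 'v set set \<Rightarrow> bool" where
  "chamber_complex n \<Delta> \<longleftrightarrow>
     simplicial_complex \<Delta> \<and> pure_of_rank n \<Delta> \<and>
     (\<forall>c\<in>chambers \<Delta>. \<forall>d\<in>chambers \<Delta>. \<exists>cs. gallery n \<Delta> cs \<and> hd cs = c \<and> last cs = d)"

text \<open>The existence of a three-element set of chambers avoids \<open>card\<close>, which is 0 on
  infinite sets.\<close>

definition thick :: "nat \<Rightarrow> 'v set set \<Rightarrow> bool" where
  "thick n \<Delta> \<longleftrightarrow>
     (\<forall>\<alpha>\<in>\<Delta>. card \<alpha> + 1 = n \<longrightarrow> (\<exists>S \<subseteq> {\<gamma> \<in> chambers \<Delta>. \<alpha> \<subseteq> \<gamma>}. card S = 3))"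

definition geometry :: "'i set \<Rightarrow> 'v set set \<Rightarrow> ('v \<Rightarrow> 'i) \<Rightarrow> bool" where
  "geometry I \<Delta> t \<longleftrightarrow>
     finite I \<and> chamber_complex (card I) \<Delta> \<and> thick (card I) \<Delta> \<and>
     t \<in> \<Union>\<Delta> \<rightarrow> I \<and> (\<forall>\<alpha>\<in>\<Delta>. inj_on t \<alpha>) \<and>
     flag_complex \<Delta> \<and>
     (\<forall>\<alpha> \<in> \<Delta> - chambers \<Delta>. \<exists>m. chamber_complex m (link \<Delta> \<alpha>))"

definition adj :: "'v set set \<Rightarrow> 'v \<Rightarrow> 'v \<Rightarrow> bool" where
  "adj \<Delta> x y \<longleftrightarrow> x \<noteq> y \<and> {x, y} \<in> \<Delta>"

definition is_cycle :: "'v set set \<Rightarrow> 'v list \<Rightarrow> bool" where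
  "is_cycle \<Delta> xs \<longleftrightarrow>
     3 \<le> length xs \<and> distinct xs \<and> successively (adj \<Delta>) xs \<and> adj \<Delta> (last xs) (hd xs)"

definition girth :: "'v set set \<Rightarrow> enat" where
  "girth \<Delta> = (INF xs \<in> {xs. is_cycle \<Delta> xs}. enat (length xs))"

definition graph_dist :: "'v set set \<Rightarrow> 'v \<Rightarrow> 'v \<Rightarrow> enat" where
  "graph_dist \<Delta> x y =
     (INF xs \<in> {xs. xs \<noteq> [] \<and> successively (adj \<Delta>) xs \<and> hd xs = x \<and> last xs = y}.
        enat (length xs - 1))"

definition graph_diameter :: "'v set set \<Rightarrow> enat" where
  "graph_diameter \<Delta> = (SUP x \<in> \<Union>\<Delta>. SUP y \<in> \<Union>\<Delta>. graph_dist \<Delta> x y)"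

definition generalized_polygon ::
    "nat \<Rightarrow> 'i set \<Rightarrow> 'v set set \<Rightarrow> ('v \<Rightarrow> 'i) \<Rightarrow> bool" where
  "generalized_polygon k I \<Delta> t \<longleftrightarrow>
     2 \<le> k \<and> card I = 2 \<and> geometry I \<Delta> t \<and>
     girth \<Delta> = enat (2 * k) \<and> graph_diameter \<Delta> = enat k"

definition geometry_of_type ::
    "'i set \<Rightarrow> ('i \<Rightarrow> 'i \<Rightarrow> nat) \<Rightarrow> 'v set set \<Rightarrow> ('v \<Rightarrow> 'i) \<Rightarrow> bool" where
  "geometry_of_type I M \<Delta> t \<longleftrightarrow>
     geometry I \<Delta> t \<and>
     (\<forall>\<alpha>\<in>\<Delta>. \<forall>i\<in>I. \<forall>j\<in>I. i \<noteq> j \<and> I - t ` \<alpha> = {i, j} \<longrightarrow>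
        generalized_polygon (M i j) {i, j} (link \<Delta> \<alpha>) t)"

definition quotient_topology :: "'a topology \<Rightarrow> ('a \<Rightarrow> 'b) \<Rightarrow> 'b topology" where
  "quotient_topology X f =
     topology (\<lambda>U. U \<subseteq> f ` topspace X \<and> openin X {x \<in> topspace X. f x \<in> U})"

lemma openin_quotient_topology:
  "openin (quotient_topology X f) U \<longleftrightarrow>
     U \<subseteq> f ` topspace X \<and> openin X {x \<in> topspace X. f x \<in> U}"
proof -
  have "istopology (\<lambda>U. U \<subseteq> f ` topspace X \<and> openin X {x \<in> topspace X. f x \<in> U})"
    unfolding istopology_def
  proof (intro conjI allI impI)
    fix S T
    assume "S \<subseteq> f ` topspace X \<and> openin X {x \<in> topspace X. f x \<in> S}"
      and "T \<subseteq> f ` topspace X \<and> openin X {x \<in> topspace X. f x \<in> T}"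
    moreover have "{x \<in> topspace X. f x \<in> S \<inter> T} =
        {x \<in> topspace X. f x \<in> S} \<inter> {x \<in> topspace X. f x \<in> T}" by auto
    ultimately show "S \<inter> T \<subseteq> f ` topspace X" "openin X {x \<in> topspace X. f x \<in> S \<inter> T}"
      by auto
  next
    fix \<K>
    assume "\<forall>K\<in>\<K>. K \<subseteq> f ` topspace X \<and> openin X {x \<in> topspace X. f x \<in> K}"
    moreover have "{x \<in> topspace X. f x \<in> \<Union>\<K>} = (\<Union>K\<in>\<K>. {x \<in> topspace X. f x \<in> K})"
      by auto
    ultimately show "\<Union>\<K> \<subseteq> f ` topspace X" "openin X {x \<in> topspace X. f x \<in> \<Union>\<K>}"
      by auto
  qed
  then show ?thesis
    by (simp add: quotient_topology_def)
qed

definition topological_group :: "'g monoid \<Rightarrow> 'g topology \<Rightarrow> bool" where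
  "topological_group G T \<longleftrightarrow>
     group G \<and> topspace T = carrier G \<and>
     continuous_map (prod_topology T T) T (\<lambda>(x, y). x \<otimes>\<^bsub>G\<^esub> y) \<and>
     continuous_map T T (\<lambda>x. inv\<^bsub>G\<^esub> x)"

text \<open>As usual for locally compact groups, the Hausdorff property is part of the notion.\<close>

definition locally_compact_group :: "'g monoid \<Rightarrow> 'g topology \<Rightarrow> bool" where
  "locally_compact_group G T \<longleftrightarrow>
     topological_group G T \<and> Hausdorff_space T \<and> locally_compact_space T"

text \<open>A pair $(G,\Delta)$ with all its structure: the group, its topology, the complex, the
  type function and the action on the vertices. Actions are those of
  \<^locale>\<open>group_action\<close>, hence extended by \<^const>\<open>undefined\<close> off the vertex set.\<close>

record ('g, 'v, 'i) group_geometry =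
  grp :: "'g monoid"
  top_grp :: "'g topology"
  cplx :: "'v set set"
  type_fun :: "'v \<Rightarrow> 'i"
  act :: "'g \<Rightarrow> 'v \<Rightarrow> 'v"

definition simplex_stabilizer :: "('g, 'v, 'i) group_geometry \<Rightarrow> 'v set \<Rightarrow> 'g set" where
  "simplex_stabilizer X \<alpha> = stabilizer (grp X) (\<lambda>g \<beta>. act X g ` \<beta>) \<alpha>"

definition acts_by_automorphisms :: "('g, 'v, 'i) group_geometry \<Rightarrow> bool" where
  "acts_by_automorphisms X \<longleftrightarrow>
     group_action (grp X) (\<Union>(cplx X)) (act X) \<and>
     (\<forall>g\<in>carrier (grp X).
        (\<forall>\<alpha>\<in>cplx X. act X g ` \<alpha> \<in> cplx X) \<and>
        (\<forall>v\<in>\<Union>(cplx X). type_fun X (act X g v) = type_fun X v))"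

definition cocompact :: "'g monoid \<Rightarrow> 'g topology \<Rightarrow> 'g set \<Rightarrow> bool" where
  "cocompact G T H \<longleftrightarrow> compact_space (quotient_topology T (\<lambda>g. g <#\<^bsub>G\<^esub> H))"

definition homogeneous_compact_geometry ::
    "'i set \<Rightarrow> ('i \<Rightarrow> 'i \<Rightarrow> nat) \<Rightarrow> ('g, 'v, 'i) group_geometry \<Rightarrow> bool" where
  "homogeneous_compact_geometry I M X \<longleftrightarrow>
     locally_compact_group (grp X) (top_grp X) \<and>
     geometry_of_type I M (cplx X) (type_fun X) \<and>
     acts_by_automorphisms X \<and>
     (\<forall>c\<in>chambers (cplx X). \<forall>d\<in>chambers (cplx X).
        \<exists>g\<in>carrier (grp X). act X g ` c = d) \<and>
     (\<forall>\<alpha>\<in>cplx X.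
        closedin (top_grp X) (simplex_stabilizer X \<alpha>) \<and>
        cocompact (grp X) (top_grp X) (simplex_stabilizer X \<alpha>))"

text \<open>The vertices of one type form one orbit, topologized as a coset space of the group,
  i.e. by the final topology of the orbit map; the vertex set is the topological sum of these
  finitely many orbits.\<close>

definition vertex_topology :: "('g, 'v, 'i) group_geometry \<Rightarrow> 'v topology" where
  "vertex_topology X =
     topology (\<lambda>U. U \<subseteq> \<Union>(cplx X) \<and>
       (\<forall>v\<in>\<Union>(cplx X). openin (top_grp X) {g \<in> topspace (top_grp X). act X g v \<in> U}))"

lemma openin_vertex_topology:
  "openin (vertex_topology X) U \<longleftrightarrow>
     U \<subseteq> \<Union>(cplx X) \<and>
     (\<forall>v\<in>\<Union>(cplx X). openin (top_grp X) {g \<in> topspace (top_grp X). act X g v \<in> U})"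
proof -
  have "istopology (\<lambda>U. U \<subseteq> \<Union>(cplx X) \<and>
     (\<forall>v\<in>\<Union>(cplx X). openin (top_grp X) {g \<in> topspace (top_grp X). act X g v \<in> U}))"
    (is "istopology ?P")
    unfolding istopology_def
  proof (intro conjI allI impI ballI)
    fix S T assume S: "?P S" and T: "?P T"
    then show "S \<inter> T \<subseteq> \<Union>(cplx X)" by blast
    fix v assume v: "v \<in> \<Union>(cplx X)"
    have "{g \<in> topspace (top_grp X). act X g v \<in> S \<inter> T} =
        {g \<in> topspace (top_grp X). act X g v \<in> S} \<inter>
        {g \<in> topspace (top_grp X). act X g v \<in> T}" by auto
    with S T v show "openin (top_grp X) {g \<in> topspace (top_grp X). act X g v \<in> S \<inter> T}"
      by (simp only: openin_Int)
  next
    fix \<K> assume K: "\<forall>K\<in>\<K>. ?P K"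
    then show "\<Union>\<K> \<subseteq> \<Union>(cplx X)" by blast
    fix v assume v: "v \<in> \<Union>(cplx X)"
    have "{g \<in> topspace (top_grp X). act X g v \<in> \<Union>\<K>} =
        (\<Union>K\<in>\<K>. {g \<in> topspace (top_grp X). act X g v \<in> K})" by auto
    moreover have "openin (top_grp X) \<dots>"
      using K v by (intro openin_Union) blast
    ultimately show "openin (top_grp X) {g \<in> topspace (top_grp X). act X g v \<in> \<Union>\<K>}"
      by simp
  qed
  then show ?thesis
    by (simp add: vertex_topology_def)
qed

text \<open>A panel, the link of a corank 1 simplex, has only the empty simplex and singletons;
  it is viewed as the set of its vertices.\<close>

definition connected_panels :: "'i set \<Rightarrow> ('g, 'v, 'i) group_geometry \<Rightarrow> bool" where
  "connected_panels I X \<longleftrightarrow>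
     (\<forall>\<alpha>\<in>cplx X. card \<alpha> + 1 = card I \<longrightarrow>
        connectedin (vertex_topology X) (\<Union>(link (cplx X) \<alpha>)))"

definition compact_group_geometry ::
    "'i set \<Rightarrow> ('i \<Rightarrow> 'i \<Rightarrow> nat) \<Rightarrow> ('g, 'v, 'i) group_geometry \<Rightarrow> bool" where
  "compact_group_geometry I M X \<longleftrightarrow>
     homogeneous_compact_geometry I M X \<and> connected_panels I X \<and>
     compact_space (top_grp X) \<and>
     faithful_action (grp X) (\<Union>(cplx X)) (act X)"

text \<open>Equivariant isomorphisms. A continuous group isomorphism between compact Hausdorff
  groups is a homeomorphism, so on the geometries above this relation is symmetric.\<close>

definition isomorphic_geometries ::
    "('g, 'v, 'i) group_geometry \<Rightarrow> ('h, 'w, 'i) group_geometry \<Rightarrow> bool" where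
  "isomorphic_geometries X Y \<longleftrightarrow>
     (\<exists>h f. h \<in> iso (grp X) (grp Y) \<and> continuous_map (top_grp X) (top_grp Y) h \<and>
        bij_betw f (\<Union>(cplx X)) (\<Union>(cplx Y)) \<and>
        (\<forall>\<alpha>. \<alpha> \<subseteq> \<Union>(cplx X) \<longrightarrow> (\<alpha> \<in> cplx X \<longleftrightarrow> f ` \<alpha> \<in> cplx Y)) \<and>
        (\<forall>v\<in>\<Union>(cplx X). type_fun Y (f v) = type_fun X v) \<and>
        (\<forall>g\<in>carrier (grp X). \<forall>v\<in>\<Union>(cplx X). f (act X g v) = act Y (h g) (f v)))"

text \<open>All complexes of groups below consist of subgroups of one topological group, indexed by
  the nonempty subsets of the index set, with the inclusions as homomorphisms. The value of the
  index function at the empty set is irrelevant.\<close>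

record ('g, 'i) subgroup_complex =
  ambient :: "'g monoid"
  top_amb :: "'g topology"
  member :: "'i set \<Rightarrow> 'g set"

definition continuous_complex_iso ::
    "'i set \<Rightarrow> ('g, 'i) subgroup_complex \<Rightarrow> ('h, 'i) subgroup_complex \<Rightarrow>
     ('i set \<Rightarrow> 'g \<Rightarrow> 'h) \<Rightarrow> bool" where
  "continuous_complex_iso I C D h \<longleftrightarrow>
     (\<forall>J. J \<noteq> {} \<and> J \<subseteq> I \<longrightarrow>
        h J \<in> iso ((ambient C)\<lparr>carrier := member C J\<rparr>) ((ambient D)\<lparr>carrier := member D J\<rparr>) \<and>
        continuous_map (subtopology (top_amb C) (member C J))
                       (subtopology (top_amb D) (member D J)) (h J)) \<and>
     (\<forall>J J'. J \<noteq> {} \<and> J \<subseteq> J' \<and> J' \<subseteq> I \<longrightarrow> (\<forall>x\<in>member C J'. h J x = h J' x))"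

text \<open>The faces of a chamber are indexed by their types.\<close>

definition stabilizer_complex ::
    "('g, 'v, 'i) group_geometry \<Rightarrow> 'v set \<Rightarrow> ('g, 'i) subgroup_complex" where
  "stabilizer_complex X \<gamma> =
     \<lparr>ambient = grp X, top_amb = top_grp X,
      member = (\<lambda>J. simplex_stabilizer X {v \<in> \<gamma>. type_fun X v \<in> J})\<rparr>"

definition belongs_to ::
    "'i set \<Rightarrow> ('g, 'v, 'i) group_geometry \<Rightarrow> ('h, 'i) subgroup_complex \<Rightarrow> bool" where
  "belongs_to I X C \<longleftrightarrow>
     (\<exists>\<gamma>\<in>chambers (cplx X). \<exists>h. continuous_complex_iso I C (stabilizer_complex X \<gamma>) h)"

datatype pdq = Tp | Td | Tq

fun C3_matrix :: "pdq \<Rightarrow> pdq \<Rightarrow> nat" where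
  "C3_matrix Tq Td = 3" | "C3_matrix Td Tq = 3"
| "C3_matrix Td Tp = 4" | "C3_matrix Tp Td = 4"
| "C3_matrix Tp Tq = 2" | "C3_matrix Tq Tp = 2"
| "C3_matrix Tp Tp = 1" | "C3_matrix Td Td = 1" | "C3_matrix Tq Tq = 1"

definition mat_cnj :: "complex^'n^'m \<Rightarrow> complex^'n^'m" where
  "mat_cnj A = (\<chi> i j. cnj (A $ i $ j))"

definition unitary_matrix :: "complex^'n^'n \<Rightarrow> bool" where
  "unitary_matrix A \<longleftrightarrow> A ** transpose (mat_cnj A) = mat 1 \<and> transpose (mat_cnj A) ** A = mat 1"

definition U_mats :: "(complex^'n^'n) set" where
  "U_mats = {A. unitary_matrix A}"

definition SU_mats :: "(complex^'n^'n) set" where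
  "SU_mats = {A. unitary_matrix A \<and> det A = 1}"

definition diag21 :: "complex^2^2 \<Rightarrow> complex \<Rightarrow> complex^3^3" where
  "diag21 Y y = vector [vector [Y $ 1 $ 1, Y $ 1 $ 2, 0],
                        vector [Y $ 2 $ 1, Y $ 2 $ 2, 0],
                        vector [0, 0, y]]"

definition diag12 :: "complex \<Rightarrow> complex^2^2 \<Rightarrow> complex^3^3" where
  "diag12 z Y = vector [vector [z, 0, 0],
                        vector [0, Y $ 1 $ 1, Y $ 1 $ 2],
                        vector [0, Y $ 2 $ 1, Y $ 2 $ 2]]"

type_synonym mat_pair = "(complex^3^3) \<times> (complex^3^3)"

definition SU3_group :: "(complex^3^3) monoid" where
  "SU3_group = \<lparr>carrier = SU_mats, mult = (**), one = mat 1\<rparr>"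

definition SU3xSU3 :: "mat_pair monoid" where
  "SU3xSU3 = SU3_group \<times>\<times> SU3_group"

fun K_group :: "pdq \<Rightarrow> mat_pair set" where
  "K_group Tp = {(mat_cnj X, X) | X. X \<in> SU_mats}"
| "K_group Tq = {(Y1, diag21 Y2 y) | Y1 Y2 y. Y1 \<in> SU_mats \<and> Y2 \<in> U_mats \<and> y = cnj (det Y2)}"
| "K_group Td = {(diag12 (cnj z) Z2, diag12 z Z1) | z Z1 Z2.
                   norm z = 1 \<and> Z1 \<in> U_mats \<and> Z2 \<in> U_mats} \<inter> SU_mats \<times> SU_mats"

definition Z_group :: "mat_pair set" where
  "Z_group = K_group Tp \<inter> K_group Td \<inter> K_group Tq \<inter>
     {c \<in> carrier SU3xSU3. \<forall>x\<in>carrier SU3xSU3. c \<otimes>\<^bsub>SU3xSU3\<^esub> x = x \<otimes>\<^bsub>SU3xSU3\<^esub> c}"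

definition proj_Z :: "mat_pair \<Rightarrow> mat_pair set" where
  "proj_Z x = Z_group #>\<^bsub>SU3xSU3\<^esub> x"

definition G_vertex :: "pdq \<Rightarrow> mat_pair set set" where
  "G_vertex v = proj_Z ` K_group v"

definition complex_G :: "(mat_pair set, pdq) subgroup_complex" where
  "complex_G =
     \<lparr>ambient = SU3xSU3 Mod Z_group,
      top_amb = quotient_topology (top_of_set (carrier SU3xSU3)) proj_Z,
      member = (\<lambda>J. \<Inter>v\<in>J. G_vertex v)\<rparr>"

end

theory Submission
  imports Defs "HOL-Computational_Algebra.Fundamental_Theorem_Algebra"
begin

text \<open>
  The geometry is an explicit one. Let \<open>(A, B)\<close> act on \<open>3 \<times> 3\<close> matrices by
  \<open>M \<mapsto> A M B\<^sup>T\<close>. Planes are the elements of SU(3), lines are the partial isometries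
  \<open>u v\<^sup>*\<close> of rank one, and points are the rays of \<open>\<complex>\<^sup>3\<close>, moved by the conjugate of \<open>B\<close>. The
  plane \<open>M\<close> contains the line \<open>u v\<^sup>*\<close> if \<open>M v = u\<close>, the line contains the point \<open>w\<close> if \<open>v\<close> is
  orthogonal to \<open>w\<close>, and every point lies in every plane. The stabilizers of the plane \<open>1\<close>, of
  the line \<open>e\<^sub>1 e\<^sub>1\<^sup>*\<close> and of the point \<open>e\<^sub>3\<close> are the given groups \<open>K\<^sub>p\<close>, \<open>K\<^sub>d\<close> and \<open>K\<^sub>q\<close>
  (\<open>K_group_stabilizer\<close>). The residue of a plane is the complex projective plane, that of a line
  is complete bipartite, and that of a point is the quadrangle of totally isotropic subspaces of
  a hermitian space of signature \<open>(2, 3)\<close> (\<open>residue_polygon\<close>). The kernel of the action is the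
  group \<open>Z\<close>, and panels are connected because they are orbits of groups conjugate to SU(2).

  For the uniqueness, let \<open>H\<close> be the group of a geometry that belongs to the complex. Two
  consecutive chambers of a gallery share two vertices, one of which is a plane or a point;
  hence \<open>H\<close> is generated by the images of \<open>K\<^sub>p\<close> and \<open>K\<^sub>q\<close> (\<open>Phi_surj\<close>). So \<open>H\<close>
  comes with two homomorphisms from SU(3): \<open>p\<close>, the image of the matrices \<open>(X, conj X)\<close>, and
  \<open>n\<close>, the image of the first factor. The relation
  \<open>p X \<cdot> n Y \<cdot> (p X)\<^sup>-\<^sup>1 = n (X Y X\<^sup>-\<^sup>1)\<close> is known only if \<open>X\<close> preserves the ray of \<open>e\<^sub>3\<close>, and, by means
  of the line stabilizer, if \<open>X\<close> preserves the ray of \<open>e\<^sub>1\<close> and \<open>Y\<close> fixes \<open>e\<^sub>1\<close>. The heart of the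
  proof is that it then holds always (\<open>su3_amalgam.rel\<close>), a purely algebraic form of the
  simple connectedness of the geometry.

  To see this, conjugate \<open>n\<close> by the \<open>p\<close>-images of the cyclic rotations of the coordinates. The
  three resulting homomorphisms agree pairwise on the stabilizers \<open>S\<^sub>1\<close>, \<open>S\<^sub>2\<close>, \<open>S\<^sub>3\<close> of the three
  coordinate vectors, each of which is a copy of SU(2). These three subgroups form an amalgam of
  affine type: its completions are in general central extensions of loop groups, and what
  prevents the homomorphisms from being equal is the defect \<open>\<kappa> s = n\<^sub>0 s \<cdot> (n\<^sub>1 s)\<^sup>-\<^sup>1\<close> on \<open>S\<^sub>1\<close>. For
  \<open>s\<close> in the torus, \<open>\<kappa> s\<close> is the product of the images of three torus elements with product
  \<open>1\<close>, so it centralizes the images of all \<open>S\<^sub>i\<close>. Conjugation by \<open>p\<close> and products extend this to all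
  \<open>s \<in> S\<^sub>1\<close>, as far as the images of \<open>S\<^sub>1\<close> are concerned. Then \<open>\<kappa>\<close> is a homomorphism on \<open>S\<^sub>1\<close> with commutative image; as SU(2) is perfect, \<open>\<kappa>\<close> is
  trivial, the three homomorphisms coincide, and the relation follows.

  The relation turns \<open>n\<close> and \<open>p\<close> into a continuous epimorphism \<open>Phi\<close> from SU(3) x SU(3) to \<open>H\<close>. Its
  kernel is \<open>Z\<close>: every matrix in SU(3) has an eigenvector, so every pair is conjugate into
  \<open>K\<^sub>q\<close>, where the kernel is known (\<open>Phi_kernel\<close>). Since the geometry is recovered
  from \<open>H\<close> and the three vertex stabilizers as a coset geometry, any two such geometries are
  isomorphic.
\<close>

section \<open>The group SU(3) and its action on unit vectors\<close>

text \<open>The adjoint, which is the inverse on unitary matrices.\<close>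

definition ct :: "complex^'n^'m \<Rightarrow> complex^'m^'n" where
  "ct A = transpose (mat_cnj A)"

text \<open>The hermitian form, linear in the first argument.\<close>

definition herm :: "complex^'n \<Rightarrow> complex^'n \<Rightarrow> complex" where
  "herm x y = (\<Sum>i\<in>UNIV. x $ i * cnj (y $ i))"

abbreviation SU :: "(complex^3^3) set" where "SU \<equiv> SU_mats"
abbreviation e :: "3 \<Rightarrow> complex^3" where "e i \<equiv> axis i 1"

lemma ct_nth [simp]: "ct A $ i $ j = cnj (A $ j $ i)"
  by (simp add: ct_def transpose_def mat_cnj_def)

lemma mat_cnj_nth [simp]: "mat_cnj A $ i $ j = cnj (A $ i $ j)"
  by (simp add: mat_cnj_def)

lemma ct_ct [simp]: "ct (ct A) = A"
  by (simp add: vec_eq_iff)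

lemma mat_cnj_cnj [simp]: "mat_cnj (mat_cnj A) = A"
  by (simp add: vec_eq_iff)

lemma ct_mult: "ct (A ** B) = ct B ** ct A"
  by (simp add: vec_eq_iff matrix_matrix_mult_def mult.commute)

lemma mat_cnj_mult: "mat_cnj (A ** B) = mat_cnj A ** mat_cnj B"
  by (simp add: vec_eq_iff matrix_matrix_mult_def)

lemma ct_mat_1 [simp]: "ct (mat 1) = mat 1"
  by (simp add: vec_eq_iff mat_def)

lemma mat_cnj_1 [simp]: "mat_cnj (mat 1) = mat 1"
  by (simp add: vec_eq_iff mat_def)

lemma ct_cnj: "ct (mat_cnj A) = transpose A"
  by (simp add: vec_eq_iff transpose_def)

lemma mat_cnj_ct: "mat_cnj (ct A) = transpose A"
  by (simp add: vec_eq_iff transpose_def)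

lemma herm_3: "herm x y = x $ 1 * cnj (y $ 1) + x $ 2 * cnj (y $ 2) + x $ 3 * cnj (y $ (3::3))"
  by (simp add: herm_def sum_3)

lemma herm_commute: "herm y x = cnj (herm x y)"
  by (simp add: herm_def mult.commute)

lemma herm_zero_commute: "herm y x = 0 \<longleftrightarrow> herm x y = 0"
  by (metis herm_commute complex_cnj_zero_iff)

lemma herm_add: "herm (x + y) z = herm x z + herm y z"
  "herm z (x + y) = herm z x + herm z y"
  by (simp_all add: herm_def algebra_simps sum.distrib)

lemma herm_diff: "herm (x - y) z = herm x z - herm y z"
  "herm z (x - y) = herm z x - herm z y"
  by (simp_all add: herm_def algebra_simps sum_subtractf)

lemma herm_scale: "herm (c *s x) y = c * herm x y" "herm x (c *s y) = cnj c * herm x y"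
  by (simp_all add: herm_def sum_distrib_left mult_ac)

lemma herm_zero [simp]: "herm 0 x = 0" "herm x 0 = 0"
  by (simp_all add: herm_def)

lemma herm_self: "herm x x = of_real ((norm x)\<^sup>2)"
proof -
  have "(norm x)\<^sup>2 = (\<Sum>i\<in>UNIV. (cmod (x $ i))\<^sup>2)"
    by (simp add: norm_vec_def L2_set_def sum_nonneg)
  then show ?thesis
    by (simp add: herm_def flip: complex_norm_square)
qed

lemma herm_self_1: "herm x x = 1 \<longleftrightarrow> norm x = 1"
proof -
  have "herm x x = 1 \<longleftrightarrow> (norm x)\<^sup>2 = 1"
    unfolding herm_self by (metis of_real_1 of_real_eq_iff)
  then show ?thesis
    by (simp add: power2_eq_1_iff) (smt (verit) norm_ge_zero)
qed

lemma herm_self_0: "herm x x = 0 \<longleftrightarrow> x = 0"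
  by (simp add: herm_self)

lemma herm_ct: "herm (A *v x) y = herm x (ct A *v y)"
proof -
  have "herm (A *v x) y = (\<Sum>i\<in>UNIV. \<Sum>j\<in>UNIV. A $ i $ j * x $ j * cnj (y $ i))"
    by (simp add: herm_def matrix_vector_mult_def sum_distrib_right)
  also have "\<dots> = (\<Sum>j\<in>UNIV. \<Sum>i\<in>UNIV. A $ i $ j * x $ j * cnj (y $ i))"
    by (rule sum.swap)
  also have "\<dots> = herm x (ct A *v y)"
    by (simp add: herm_def matrix_vector_mult_def sum_distrib_left mult_ac)
  finally show ?thesis .
qed

lemma mv_scale: "A *v (c *s x) = c *s (A *v (x::complex^'n))"
  by (simp add: vec_eq_iff matrix_vector_mult_def sum_distrib_left mult_ac)

lemma mv_axis: "(A *v axis j 1) = (\<chi> i. (A::complex^'n^'m) $ i $ j)"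
  by (simp add: vec_eq_iff matrix_vector_mult_def axis_def if_distrib cong: if_cong)

lemma mv_assoc: "(A ** B) *v x = A *v (B *v (x::complex^'n))"
  by (simp add: matrix_vector_mul_assoc)

subsection \<open>Unitary matrices\<close>

lemma SU_ct_right: "A \<in> SU_mats \<Longrightarrow> A ** ct A = mat 1"
  and SU_ct_left: "A \<in> SU_mats \<Longrightarrow> ct A ** A = mat 1"
  and SU_det: "A \<in> SU_mats \<Longrightarrow> det A = 1"
  by (simp_all add: SU_mats_def unitary_matrix_def ct_def)

lemma mat_inverse_unique: "A ** B = mat 1 \<Longrightarrow> B ** A = mat 1" for A B :: "complex^'n^'n"
  by (rule matrix_left_right_inverse[THEN iffD1])

lemma SU_I: "ct A ** A = mat 1 \<Longrightarrow> det A = 1 \<Longrightarrow> A \<in> SU_mats"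
  by (simp add: SU_mats_def unitary_matrix_def flip: ct_def) (rule mat_inverse_unique)

lemma det_mat_cnj: "det (mat_cnj (A::complex^3^3)) = cnj (det A)"
  by (simp add: det_3)

lemma det_ct: "det (ct (A::complex^3^3)) = cnj (det A)"
  by (simp add: ct_def det_transpose det_mat_cnj)

lemma one_SU [simp]: "mat 1 \<in> SU"
  by (rule SU_I) auto

lemma mult_SU [simp]:
  assumes "A \<in> SU" "B \<in> SU" shows "A ** B \<in> SU"
proof (rule SU_I)
  have "ct (A ** B) ** (A ** B) = ct B ** (ct A ** A) ** B"
    by (simp only: ct_mult matrix_mul_assoc)
  then show "ct (A ** B) ** (A ** B) = mat 1"
    using assms by (simp add: SU_ct_left)
qed (use assms in \<open>simp add: det_mul SU_det\<close>)

lemma ct_SU [simp]: "A \<in> SU \<Longrightarrow> ct A \<in> SU"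
  by (rule SU_I) (simp_all add: SU_ct_right det_ct SU_det)

lemma mat_cnj_SU [simp]: "A \<in> SU \<Longrightarrow> mat_cnj A \<in> SU"
proof (rule SU_I)
  assume A: "A \<in> SU"
  have "ct (mat_cnj A) ** mat_cnj A = mat_cnj (ct A ** A)"
    by (simp add: vec_eq_iff matrix_matrix_mult_def)
  then show "ct (mat_cnj A) ** mat_cnj A = mat 1"
    by (simp add: SU_ct_left[OF A])
qed (simp add: det_mat_cnj SU_det)

lemma SU_ct_simps [simp]:
  assumes "A \<in> SU"
  shows "A ** ct A = mat 1" "ct A ** A = mat 1" "A ** (ct A ** B) = B" "ct A ** (A ** B) = B"
    "(B ** A) ** ct A = B" "(B ** ct A) ** A = B"
    "A *v (ct A *v x) = x" "ct A *v (A *v x) = x"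
  using assms
  by (simp_all add: SU_ct_right SU_ct_left matrix_mul_assoc flip: mv_assoc)
     (simp_all add: SU_ct_right SU_ct_left flip: matrix_mul_assoc)

lemma SU_herm [simp]: "A \<in> SU \<Longrightarrow> herm (A *v x) (A *v y) = herm x y"
  by (simp add: herm_ct)

lemma herm_e_right: "herm x (e i) = x $ i"
  by (simp add: herm_def axis_def if_distrib cong: if_cong)

lemma herm_e [simp]: "herm (e i) (e j) = (if i = j then 1 else 0)"
  by (simp add: herm_e_right) (simp add: axis_def)

text \<open>The conjugate of the cross product completes an orthonormal pair to a frame of
  determinant one.\<close>

definition cross_cnj :: "complex^3 \<Rightarrow> complex^3 \<Rightarrow> complex^3" where
  "cross_cnj a b = vector [cnj (a$2 * b$3 - a$3 * b$2), cnj (a$3 * b$1 - a$1 * b$3),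
     cnj (a$1 * b$2 - a$2 * b$1)]"

text \<open>The third column is the conjugate cross product of the first two; by the identity of
  Lagrange it is a unit vector, and the same expression is the determinant.\<close>

lemma SU_frame:
  assumes "herm a a = 1" "herm b b = 1" "herm a b = 0"
  obtains X where "X \<in> SU" "X *v e 1 = a" "X *v e 2 = b"
proof -
  define c where "c = cross_cnj a b"
  define X :: "complex^3^3" where "X = (\<chi> i j. if j = 1 then a $ i else if j = 2 then b $ i else (c $ i))"
  have ca: "herm c a = 0" "herm c b = 0"
    by (simp_all add: herm_3 c_def cross_cnj_def vector_3) algebra+
  have ab: "a$1 * cnj (a$1) + a$2 * cnj (a$2) + a$3 * cnj (a$3) = 1"
    "b$1 * cnj (b$1) + b$2 * cnj (b$2) + b$3 * cnj (b$3) = 1"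
    "a$1 * cnj (b$1) + a$2 * cnj (b$2) + a$3 * cnj (b$3) = 0"
    using assms by (simp_all add: herm_3)
  have cc: "herm c c = 1"
  proof -
    have "herm c c = herm a a * herm b b - herm a b * herm b a"
      by (simp add: herm_3 c_def cross_cnj_def vector_3) algebra
    then show ?thesis using assms by simp
  qed
  have d: "det X = herm c c"
    by (simp add: det_3 herm_3 X_def c_def cross_cnj_def vector_3 algebra_simps)
  have ent: "(ct X ** X) $ i $ j = herm (X *v e j) (X *v e i)" for i j
    by (simp add: matrix_matrix_mult_def herm_def mv_axis mult.commute)
  have cols: "X *v e 1 = a" "X *v e 2 = b" "X *v e 3 = c"
    by (simp_all add: mv_axis X_def vec_eq_iff)
  have "herm b a = 0" "herm a c = 0" "herm b c = 0"
    using assms ca by (simp_all add: herm_zero_commute)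
  then have "ct X ** X = mat 1"
    using assms ca cc cols
    by (simp only: vec_eq_iff[of "ct X ** X"] vec_eq_iff[of "(ct X ** X) $ i" for i] forall_3 ent)
       (simp add: mat_def)
  then have "X \<in> SU" using d cc by (intro SU_I) auto
  with cols show ?thesis using that by blast
qed

text \<open>As a real space, the complex span of two vectors has dimension at most 4, and
  \<open>\<complex>\<^sup>3\<close> has dimension 6.\<close>

lemma unit_perp_exists:
  obtains x :: "complex^3" where "herm x x = 1" "herm x a = 0" "herm x b = 0"
proof -
  let ?S = "{a, \<i> *s a, b, \<i> *s b}"
  have "dim ?S \<le> card ?S" by (rule dim_le_card') simp
  also have "\<dots> \<le> 4" using card_length[of "[a, \<i> *s a, b, \<i> *s b]"] by simp
  also have "4 < DIM(complex^3)" by simp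
  finally obtain x where x: "x \<noteq> 0" "\<And>y. y \<in> span ?S \<Longrightarrow> orthogonal x y"
    using orthogonal_to_subspace_exists by blast
  have h0: "herm x y = 0" if "x \<bullet> y = 0" "x \<bullet> (\<i> *s y) = 0" for y
  proof -
    have "Re (herm x y) = x \<bullet> y" "Im (herm x y) = x \<bullet> (\<i> *s y)"
      by (simp_all add: herm_def inner_vec_def inner_complex_def mult_ac)
    then show ?thesis using that by (simp add: complex_eq_iff)
  qed
  have "herm x a = 0" "herm x b = 0"
    using x(2)[of a] x(2)[of "\<i> *s a"] x(2)[of b] x(2)[of "\<i> *s b"]
    by (auto intro!: h0 simp: orthogonal_def span_base)
  moreover have "herm (of_real (inverse (norm x)) *s x) (of_real (inverse (norm x)) *s x) = 1"
    using x(1) by (subst herm_scale(1), subst herm_scale(2), subst herm_self) (simp add: power2_eq_square field_simps)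
  ultimately show ?thesis
    by (intro that[of "of_real (inverse (norm x)) *s x"]) (simp_all add: herm_scale(1))
qed

section \<open>Stabilizers of the coordinate vectors\<close>

text \<open>\<open>Sg i\<close> fixes a coordinate vector and is a copy of SU(2); \<open>Ug
  i\<close> preserves its ray and is a copy of U(2).\<close>

definition Sg :: "3 \<Rightarrow> (complex^3^3) set" where
  "Sg i = {X \<in> SU. X *v e i = e i}"

definition Ug :: "3 \<Rightarrow> (complex^3^3) set" where
  "Ug i = {X \<in> SU. \<exists>c. X *v e i = c *s e i}"

lemma Sg_SU: "X \<in> Sg i \<Longrightarrow> X \<in> SU" and Ug_SU: "X \<in> Ug i \<Longrightarrow> X \<in> SU"
  by (auto simp: Sg_def Ug_def)

lemma Sg_Ug: "X \<in> Sg i \<Longrightarrow> X \<in> Ug i"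
  unfolding Sg_def Ug_def by (auto intro!: exI[of _ 1])

lemma Ug_phase:
  assumes "X \<in> Ug i"
  obtains c where "X *v e i = c *s e i" "cnj c * c = 1" "ct X *v e i = cnj c *s e i"
proof -
  from assms obtain c where X: "X \<in> SU" and c: "X *v e i = c *s e i" by (auto simp: Ug_def)
  have "herm (X *v e i) (X *v e i) = 1" using X by simp
  then have u: "cnj c * c = 1" by (simp add: c herm_scale mult.commute)
  have "ct X *v (X *v e i) = c *s (ct X *v e i)" by (simp add: c mv_scale)
  then have "cnj c *s e i = cnj c *s (c *s (ct X *v e i))" using X by simp
  then have "ct X *v e i = cnj c *s e i" using u by (simp add: vector_smult_assoc)
  with c u show ?thesis using that by blast
qed

lemma Sg_mult: "X \<in> Sg i \<Longrightarrow> Y \<in> Sg i \<Longrightarrow> X ** Y \<in> Sg i"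
  by (simp add: Sg_def mv_assoc)

lemma Sg_ct: "X \<in> Sg i \<Longrightarrow> ct X \<in> Sg i"
  by (metis (mono_tags, lifting) SU_ct_simps(8) Sg_def ct_SU mem_Collect_eq)

lemma Ug_ct: "X \<in> Ug i \<Longrightarrow> ct X \<in> Ug i"
  using Ug_phase[of X i] Ug_SU[of X i] by (auto simp: Ug_def)

text \<open>\<open>Sg i\<close> is normal in \<open>Ug i\<close>.\<close>

lemma Ug_conj_Sg: assumes "X \<in> Ug i" "Y \<in> Sg i" shows "X ** Y ** ct X \<in> Sg i"
proof -
  obtain c where c: "X *v e i = c *s e i" "cnj c * c = 1" "ct X *v e i = cnj c *s e i"
    using Ug_phase assms(1) by blast
  have Y: "Y *v e i = e i" and SU: "Y \<in> SU" "X \<in> SU" using assms by (auto simp: Sg_def Ug_def)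
  have "(X ** Y ** ct X) *v e i = e i"
    by (simp add: mv_assoc c Y mv_scale vector_smult_assoc)
  then show ?thesis using SU by (simp add: Sg_def)
qed

definition mat3 :: "complex \<Rightarrow> complex \<Rightarrow> complex \<Rightarrow> complex \<Rightarrow> complex \<Rightarrow> complex \<Rightarrow> complex \<Rightarrow> complex \<Rightarrow> complex \<Rightarrow> complex^3^3" where
  "mat3 a b c d f g h i j = vector [vector [a, b, c], vector [d, f, g], vector [h, i, j]]"

lemma mat3_nth [simp]:
  "mat3 a b c d f g h i j $ 1 $ 1 = a" "mat3 a b c d f g h i j $ 1 $ 2 = b" "mat3 a b c d f g h i j $ 1 $ 3 = c"
  "mat3 a b c d f g h i j $ 2 $ 1 = d" "mat3 a b c d f g h i j $ 2 $ 2 = f" "mat3 a b c d f g h i j $ 2 $ 3 = g"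
  "mat3 a b c d f g h i j $ 3 $ 1 = h" "mat3 a b c d f g h i j $ 3 $ 2 = i" "mat3 a b c d f g h i j $ 3 $ 3 = j"
  by (simp_all add: mat3_def vector_3)

lemma mat3_eta: "A = mat3 (A$1$1) (A$1$2) (A$1$3) (A$2$1) (A$2$2) (A$2$3) (A$3$1) (A$3$2) (A$3$3)"
  by (simp add: vec_eq_iff forall_3)

lemma mat3_eq_iff: "mat3 a b c d f g h i j = mat3 a' b' c' d' f' g' h' i' j' \<longleftrightarrow>
   a = a' \<and> b = b' \<and> c = c' \<and> d = d' \<and> f = f' \<and> g = g' \<and> h = h' \<and> i = i' \<and> j = j'"
  by (simp add: vec_eq_iff forall_3)

lemma mat3_mult: "mat3 a b c d f g h i j ** mat3 a' b' c' d' f' g' h' i' j' =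
  mat3 (a*a'+b*d'+c*h') (a*b'+b*f'+c*i') (a*c'+b*g'+c*j')
       (d*a'+f*d'+g*h') (d*b'+f*f'+g*i') (d*c'+f*g'+g*j')
       (h*a'+i*d'+j*h') (h*b'+i*f'+j*i') (h*c'+i*g'+j*j')"
  by (simp add: vec_eq_iff forall_3 matrix_matrix_mult_def sum_3)

lemma mat3_ct: "ct (mat3 a b c d f g h i j) =
  mat3 (cnj a) (cnj d) (cnj h) (cnj b) (cnj f) (cnj i) (cnj c) (cnj g) (cnj j)"
  by (simp add: vec_eq_iff forall_3)

lemma mat3_1: "mat 1 = mat3 1 0 0 0 1 0 0 0 1"
  by (simp add: vec_eq_iff forall_3 mat_def)

lemma mat3_det: "det (mat3 a b c d f g h i j) =
   a*f*j + b*g*h + c*d*i - a*g*i - b*d*j - c*f*h"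
  by (simp add: det_3)

lemma mat3_mv: "mat3 a b c d f g h i j *v vector [x, y, z] =
    vector [a*x + b*y + c*z, d*x + f*y + g*z, h*x + i*y + j*z]"
  by (simp add: matrix_vector_mult_def vec_eq_iff forall_3 vector_3 sum_3)

lemma e_vector: "e 1 = vector [1, 0, 0]" "e 2 = vector [0, 1, 0]" "e 3 = vector [0, 0, 1]"
  by (simp_all add: vec_eq_iff forall_3 vector_3 axis_def)

lemma vector3_eq_iff: "(vector [a, b, c] :: complex^3) = vector [a', b', c'] \<longleftrightarrow> a = a' \<and> b = b' \<and> c = c'"
  by (simp add: vec_eq_iff forall_3 vector_3)

lemma vector3_eta: "(x :: complex^3) = vector [x $ 1, x $ 2, x $ 3]"
  by (simp add: vec_eq_iff forall_3 vector_3)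

lemma vector3_scale: "c *s (vector [x, y, z] :: complex^3) = vector [c * x, c * y, c * z]"
  by (simp add: vec_eq_iff forall_3 vector_3)

lemmas mat3_simps = mat3_mult mat3_ct mat3_1 mat3_det mat3_mv e_vector mat3_eq_iff vector3_eq_iff vector3_scale

text \<open>The cyclic rotation of the coordinates permutes the three subgroups \<open>Sg
  i\<close>; it reduces statements about them to one of them.\<close>

definition rot :: "complex^3^3" where "rot = mat3 0 0 1 1 0 0 0 1 0"

lemma rot_SU [simp]: "rot \<in> SU"
  by (rule SU_I) (simp_all add: rot_def mat3_simps)

lemma rot_e: "rot *v e 1 = e 2" "rot *v e 2 = e 3" "rot *v e 3 = e 1"
  by (simp_all add: rot_def mat3_simps)

lemma rot_ct: "ct rot = rot ** rot" "ct (rot ** rot) = rot" "rot ** (rot ** rot) = mat 1"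
  by (simp_all add: rot_def mat3_simps)

lemma Sg_rot: "Y \<in> Sg 2 \<Longrightarrow> ct rot ** Y ** rot \<in> Sg 1"
  "Y \<in> Sg 3 \<Longrightarrow> ct rot ** Y ** rot \<in> Sg 2" "Y \<in> Sg 1 \<Longrightarrow> ct rot ** Y ** rot \<in> Sg 3"
  by (auto simp: Sg_def mv_assoc rot_e)
    (metis rot_e SU_ct_simps(8) rot_SU)+

text \<open>The elements of \<open>Sg 1\<close> and \<open>Sg 3\<close>, given by their first
  nontrivial column.\<close>

definition b1 :: "complex \<Rightarrow> complex \<Rightarrow> complex^3^3" where
  "b1 a b = mat3 1 0 0 0 a (- cnj b) 0 b (cnj a)"

definition b3 :: "complex \<Rightarrow> complex \<Rightarrow> complex^3^3" where
  "b3 a b = mat3 a (- cnj b) 0 b (cnj a) 0 0 0 1"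

text \<open>Diagonal elements of \<open>Sg 1\<close>, \<open>Sg 2\<close>, \<open>Sg 3\<close>
  whose product is the identity.\<close>

definition d1 where "d1 l = mat3 1 0 0 0 l 0 0 0 (cnj l)"
definition d2 where "d2 l = mat3 (cnj l) 0 0 0 1 0 0 0 l"
definition d3 where "d3 l = mat3 l 0 0 0 (cnj l) 0 0 0 1"

lemma b1_Sg: "a * cnj a + b * cnj b = 1 \<Longrightarrow> b1 a b \<in> Sg 1"
  unfolding Sg_def b1_def
  by (auto simp: mat3_simps mult.commute add.commute intro!: SU_I)

lemma b3_Sg: "a * cnj a + b * cnj b = 1 \<Longrightarrow> b3 a b \<in> Sg 3"
  unfolding Sg_def b3_def
  by (auto simp: mat3_simps mult.commute add.commute intro!: SU_I)

lemma d_Sg: assumes "l * cnj l = 1" shows "d1 l \<in> Sg 1" "d2 l \<in> Sg 2" "d3 l \<in> Sg 3"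
  using assms unfolding Sg_def d1_def d2_def d3_def
  by (auto simp: mat3_simps mult.commute intro!: SU_I)

lemma d_Ug: assumes "l * cnj l = 1" shows "d1 l \<in> Ug i" "d2 l \<in> Ug i" "d3 l \<in> Ug i"
proof -
  have "\<exists>c. d1 l *v e i = c *s e i" "\<exists>c. d2 l *v e i = c *s e i" "\<exists>c. d3 l *v e i = c *s e i"
    using exhaust_3[of i]
    by (auto simp: d1_def d2_def d3_def mat3_simps)
  then show "d1 l \<in> Ug i" "d2 l \<in> Ug i" "d3 l \<in> Ug i"
    using d_Sg[OF assms] by (auto simp: Ug_def Sg_def)
qed

lemma Sg1_form:
  assumes "X \<in> Sg 1" obtains a b where "X = b1 a b" "a * cnj a + b * cnj b = 1"
proof -
  have X: "X \<in> SU" "X *v e 1 = e 1" "ct X *v e 1 = e 1"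
    using assms Sg_ct by (auto simp: Sg_def)
  obtain a b c d where m: "X = mat3 1 0 0 0 a b 0 c d"
  proof -
    have "X $ 1 $ 1 = 1 \<and> X $ 2 $ 1 = 0 \<and> X $ 3 $ 1 = 0 \<and> X $ 1 $ 2 = 0 \<and> X $ 1 $ 3 = 0"
      using X(2,3) unfolding mv_axis vec_eq_iff forall_3 by (simp add: axis_def)
    then show ?thesis using mat3_eta[of X] that by metis
  qed
  have "X ** ct X = mat 1" "ct X ** X = mat 1" "det X = 1" using X by (auto simp: SU_det)
  then have eqs: "a * cnj a + c * cnj c = 1" "a * d - b * c = 1" "a * cnj c + b * cnj d = 0"
    "c * cnj a + d * cnj b = 0" "a * cnj a + b * cnj b = 1" "c * cnj c + d * cnj d = 1"
    by (auto simp: m mat3_simps mult.commute)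
  have "d = cnj a" using eqs by algebra
  moreover have "b = - cnj c" using eqs by algebra
  ultimately show ?thesis using that[of a c] eqs by (simp add: m b1_def)
qed

text \<open>Two rotations suffice to move the first basis vector to a given unit vector.\<close>

lemma SU_generated:
  assumes Q1: "\<And>X. X \<in> Sg 1 \<Longrightarrow> Q X" and Q3: "\<And>X. X \<in> Sg 3 \<Longrightarrow> Q X"
    and Qm: "\<And>X Y. X \<in> SU \<Longrightarrow> Y \<in> SU \<Longrightarrow> Q X \<Longrightarrow> Q Y \<Longrightarrow> Q (X ** Y)" and X: "X \<in> SU"
  shows "Q X"
proof -
  define a where "a = X *v e 1"
  have "herm a a = 1" using X by (simp add: a_def)
  then have a: "a$1 * cnj (a$1) + (a$2 * cnj (a$2) + a$3 * cnj (a$3)) = 1"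
    by (simp add: herm_3 add.assoc)
  have "\<exists>s t. s \<in> Sg 1 \<and> t \<in> Sg 3 \<and> (s ** t) *v e 1 = a"
  proof -
    define \<rho> where "\<rho> = sqrt ((cmod (a$2))\<^sup>2 + (cmod (a$3))\<^sup>2)"
    have \<rho>2: "complex_of_real \<rho> * complex_of_real \<rho> = a$2 * cnj (a$2) + a$3 * cnj (a$3)"
    proof -
      have "complex_of_real \<rho> * complex_of_real \<rho> = of_real ((cmod (a$2))\<^sup>2 + (cmod (a$3))\<^sup>2)"
        unfolding \<rho>_def by (simp only: of_real_mult[symmetric] real_sqrt_mult_self) simp
      then show ?thesis by (simp only: of_real_add complex_norm_square)
    qed
    obtain u v :: complex where uv: "u * cnj u + v * cnj v = 1" "\<rho> * u = a$2" "\<rho> * v = a$3"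
    proof (cases "\<rho> = 0")
      case True
      then have "a$2 = 0" "a$3 = 0" unfolding \<rho>_def by (auto simp: add_nonneg_eq_0_iff)
      with True show ?thesis using that[of 1 0] by simp
    next
      case False
      then have "complex_of_real \<rho> * complex_of_real \<rho> \<noteq> 0" by simp
      then have "(a$2 * cnj (a$2) + a$3 * cnj (a$3)) / (\<rho> * \<rho>) = 1" by (simp flip: \<rho>2)
      then have "(a$2 / \<rho>) * cnj (a$2 / \<rho>) + (a$3 / \<rho>) * cnj (a$3 / \<rho>) = 1"
        by (simp add: add_divide_distrib)
      then show ?thesis using False by (intro that[of "a$2 / \<rho>" "a$3 / \<rho>"]) simp_all
    qed
    have "b1 u v \<in> Sg 1" "b3 (a$1) \<rho> \<in> Sg 3"
      using uv a \<rho>2 by (auto intro!: b1_Sg b3_Sg)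
    moreover have "(b1 u v ** b3 (a$1) \<rho>) *v e 1 = a"
      using uv by (subst vector3_eta[of a]) (simp add: b1_def b3_def mat3_simps mult.commute)
    ultimately show ?thesis by blast
  qed
  then obtain s t where st: "s \<in> Sg 1" "t \<in> Sg 3" "(s ** t) *v e 1 = a" by blast
  then have SU: "s \<in> SU" "t \<in> SU" "s ** t \<in> SU" by (auto simp: Sg_def)
  have "ct (s ** t) ** X \<in> Sg 1"
    using st(3) SU X SU_ct_simps(8)[of "s ** t" "e 1"]
    by (simp add: Sg_def mv_assoc[of "ct (s ** t)"] a_def)
  then have "Q ((s ** t) ** (ct (s ** t) ** X))"
    using st SU X by (intro Qm Q1 Q3 mult_SU ct_SU) auto
  then show ?thesis using SU by simp
qed

text \<open>Every element of SU(2) is a real rotation between two diagonal matrices, and the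
  real rotations are conjugate to diagonal matrices by one fixed element. This avoids the
  spectral theorem when a property known for the diagonal torus is extended to SU(2).\<close>

lemma Euler_angles:
  assumes "X \<in> Sg 1"
  obtains \<alpha> \<beta> l where "\<alpha> * cnj \<alpha> = 1" "\<beta> * cnj \<beta> = 1" "l * cnj l = 1"
    "X = d1 \<alpha> ** (b1 (1 / sqrt 2) (\<i> / sqrt 2) ** d1 l ** ct (b1 (1 / sqrt 2) (\<i> / sqrt 2))) ** d1 \<beta>"
proof -
  obtain a b where X: "X = b1 a b" "a * cnj a + b * cnj b = 1" using Sg1_form assms by blast
  have "complex_of_real ((cmod a)\<^sup>2 + (cmod b)\<^sup>2) = of_real 1"
    using X(2) by (simp only: of_real_add complex_norm_square of_real_1)
  then have ab: "(cmod a)\<^sup>2 + (cmod b)\<^sup>2 = 1"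
    by (simp only: of_real_eq_iff)
  obtain \<theta> where \<theta>: "cmod a = cos \<theta>" "cmod b = sin \<theta>"
    using sincos_total_pi_half[OF norm_ge_zero norm_ge_zero ab] by blast
  obtain A B where AB: "a = cmod a * cis A" "b = cmod b * cis B"
    using rcis_cmod_Arg[of a] rcis_cmod_Arg[of b] unfolding rcis_def by metis
  let ?\<alpha> = "cis ((A - B) / 2)" and ?\<beta> = "cis ((A + B) / 2)"
  have p: "?\<alpha> * ?\<beta> = cis A" "cnj ?\<alpha> * ?\<beta> = cis B"
    by (simp_all add: cis_mult cis_cnj field_simps)
  have s2: "complex_of_real (sqrt 2) * complex_of_real (sqrt 2) = 2"
    by (simp only: of_real_mult[symmetric]) simp
  have "b1 (1 / sqrt 2) (\<i> / sqrt 2) ** d1 (cis (- \<theta>)) ** ct (b1 (1 / sqrt 2) (\<i> / sqrt 2)) =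
      mat3 1 0 0 0 (cos \<theta>) (- sin \<theta>) 0 (sin \<theta>) (cos \<theta>)"
    by (simp add: b1_def d1_def mat3_simps s2 field_simps) (simp add: complex_eq_iff)
  moreover have "X = d1 ?\<alpha> ** mat3 1 0 0 0 (cos \<theta>) (- sin \<theta>) 0 (sin \<theta>) (cos \<theta>) ** d1 ?\<beta>"
  proof -
    have "cnj a = cos \<theta> * cnj (cis A)" "cnj b = sin \<theta> * cnj (cis B)"
      using AB \<theta> by (metis complex_cnj_complex_of_real complex_cnj_mult)+
    then show ?thesis using AB \<theta>
      unfolding X(1) b1_def d1_def mat3_simps p[symmetric] by (simp add: mult_ac)
  qed
  ultimately show ?thesis
    using that[of ?\<alpha> ?\<beta> "cis (- \<theta>)"] by (simp add: cis_cnj cis_mult)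
qed

section \<open>Amalgams of two copies of SU(3)\<close>

text \<open>Conjugation; commutation of two elements takes the form of a fixed point.\<close>

definition (in group) cj :: "'a \<Rightarrow> 'a \<Rightarrow> 'a" where
  "cj g h = g \<otimes> h \<otimes> inv g"

context group begin

lemma cj_closed [simp]: "g \<in> carrier G \<Longrightarrow> h \<in> carrier G \<Longrightarrow> cj g h \<in> carrier G"
  by (simp add: cj_def)

lemma cj_mult_left: "g \<in> carrier G \<Longrightarrow> g' \<in> carrier G \<Longrightarrow> h \<in> carrier G \<Longrightarrow> cj (g \<otimes> g') h = cj g (cj g' h)"
  by (simp add: cj_def m_assoc inv_mult_group)

lemma inv_cancel [simp]: "g \<in> carrier G \<Longrightarrow> x \<in> carrier G \<Longrightarrow> inv g \<otimes> (g \<otimes> x) = x"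
  "g \<in> carrier G \<Longrightarrow> x \<in> carrier G \<Longrightarrow> g \<otimes> (inv g \<otimes> x) = x"
  by (simp_all flip: m_assoc)

lemma cj_mult_right: "g \<in> carrier G \<Longrightarrow> h \<in> carrier G \<Longrightarrow> h' \<in> carrier G \<Longrightarrow> cj g (h \<otimes> h') = cj g h \<otimes> cj g h'"
  by (simp add: cj_def m_assoc)

lemma cj_inv_right: "g \<in> carrier G \<Longrightarrow> h \<in> carrier G \<Longrightarrow> cj g (inv h) = inv (cj g h)"
  by (simp add: cj_def m_assoc inv_mult_group)

lemma cj_one_right [simp]: "g \<in> carrier G \<Longrightarrow> cj g \<one> = \<one>"
  by (simp add: cj_def)

lemma cj_one_left [simp]: "h \<in> carrier G \<Longrightarrow> cj \<one> h = h"
  by (simp add: cj_def)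

lemma cj_inv_left [simp]: "g \<in> carrier G \<Longrightarrow> h \<in> carrier G \<Longrightarrow> cj (inv g) (cj g h) = h"
  "g \<in> carrier G \<Longrightarrow> h \<in> carrier G \<Longrightarrow> cj g (cj (inv g) h) = h"
  by (simp_all flip: cj_mult_left)

lemma cj_cj: "g \<in> carrier G \<Longrightarrow> h \<in> carrier G \<Longrightarrow> x \<in> carrier G \<Longrightarrow> cj (cj g h) x = cj g (cj h (cj (inv g) x))"
  by (simp add: cj_def m_assoc inv_mult_group)

lemma cj_fix: "g \<in> carrier G \<Longrightarrow> h \<in> carrier G \<Longrightarrow> cj g h = h \<longleftrightarrow> g \<otimes> h = h \<otimes> g"
  by (metis cj_def inv_solve_right' m_closed)

end

lemma group_SU3: "group SU3_group"
proof (rule groupI)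
  fix x assume "x \<in> carrier SU3_group"
  then show "\<exists>y\<in>carrier SU3_group. y \<otimes>\<^bsub>SU3_group\<^esub> x = \<one>\<^bsub>SU3_group\<^esub>"
    by (intro bexI[of _ "ct x"]) (auto simp: SU3_group_def)
qed (auto simp: SU3_group_def matrix_mul_assoc)

lemma SU3_simps [simp]: "carrier SU3_group = SU" "x \<otimes>\<^bsub>SU3_group\<^esub> y = x ** y"
  "\<one>\<^bsub>SU3_group\<^esub> = mat 1"
  by (simp_all add: SU3_group_def)

lemma SU3_inv [simp]: "x \<in> SU \<Longrightarrow> inv\<^bsub>SU3_group\<^esub> x = ct x"
  using group.inv_equality[OF group_SU3, of "ct x" x] by simp

lemma hom_SU:
  assumes "group H" "n \<in> hom SU3_group H"
  shows "A \<in> SU \<Longrightarrow> n A \<in> carrier H" "A \<in> SU \<Longrightarrow> B \<in> SU \<Longrightarrow> n (A ** B) = n A \<otimes>\<^bsub>H\<^esub> n B"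
    "n (mat 1) = \<one>\<^bsub>H\<^esub>" "A \<in> SU \<Longrightarrow> n (ct A) = inv\<^bsub>H\<^esub> (n A)"
proof -
  interpret group_hom SU3_group H n
    using assms group_SU3 by (simp add: group_hom_def group_hom_axioms_def)
  show "A \<in> SU \<Longrightarrow> n A \<in> carrier H" "A \<in> SU \<Longrightarrow> B \<in> SU \<Longrightarrow> n (A ** B) = n A \<otimes>\<^bsub>H\<^esub> n B"
    "n (mat 1) = \<one>\<^bsub>H\<^esub>" "A \<in> SU \<Longrightarrow> n (ct A) = inv\<^bsub>H\<^esub> (n A)"
    using hom_closed[of A] hom_mult[of A B] hom_one hom_inv[of A] by simp_all
qed

lemma (in group) hom_SU_cj:
  assumes "n \<in> hom SU3_group G" "A \<in> SU" "B \<in> SU"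
  shows "cj (n A) (n B) = n (A ** B ** ct A)"
  using assms by (simp add: cj_def hom_SU[OF is_group assms(1)])

text \<open>Three homomorphisms that agree pairwise on the stabilizers of the three coordinate
  vectors: an amalgam of affine type. Its torus may fail to have determinant one; the
  defect is central in the group generated by the three stabilizers.\<close>

locale three_homs = group G for G (structure) +
  fixes n0 n1 n2 :: "complex^3^3 \<Rightarrow> 'a"
  assumes hom0: "n0 \<in> hom SU3_group G" and hom1: "n1 \<in> hom SU3_group G"
    and hom2: "n2 \<in> hom SU3_group G"
    and agree1: "Y \<in> Sg 1 \<Longrightarrow> n2 Y = n0 Y"
    and agree2: "Y \<in> Sg 2 \<Longrightarrow> n1 Y = n0 Y"
    and agree3: "Y \<in> Sg 3 \<Longrightarrow> n2 Y = n1 Y"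
begin

definition \<kappa> where "\<kappa> s = n0 s \<otimes> inv (n1 s)"

lemmas h0 = hom_SU[OF is_group hom0] and h1 = hom_SU[OF is_group hom1] and h2 = hom_SU[OF is_group hom2]

lemma \<kappa>_closed [simp]: "s \<in> SU \<Longrightarrow> \<kappa> s \<in> carrier G"
  by (simp add: \<kappa>_def h0 h1)

text \<open>In \<open>\<kappa> (d1 l) = n0 (d1 l) \<cdot> n0 (d2 l) \<cdot> n2 (d3 l)\<close>
  each factor can be rewritten by an agreeing homomorphism, so that it acts on the image of each
  stabilizer as conjugation by a diagonal matrix; the product of the three matrices is the
  identity.\<close>

lemma torus_cj:
  assumes l: "l * cnj l = 1"
  shows "s \<in> Sg 1 \<Longrightarrow> cj (\<kappa> (d1 l)) (n0 s) = n0 s"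
    "s \<in> Sg 2 \<Longrightarrow> cj (\<kappa> (d1 l)) (n0 s) = n0 s"
    "s \<in> Sg 3 \<Longrightarrow> cj (\<kappa> (d1 l)) (n1 s) = n1 s"
proof -
  note U = d_Ug[OF l] and S = d_Sg[OF l]
  have SU: "d1 l \<in> SU" "d2 l \<in> SU" "d3 l \<in> SU" using S by (auto simp: Sg_def)
  have d23: "ct (d1 l) = d2 l ** d3 l" using l by (simp add: d1_def d2_def d3_def mat3_simps mult.commute)
  have prod: "d1 l ** (d2 l ** (d3 l ** X ** ct (d3 l)) ** ct (d2 l)) ** ct (d1 l) = X" for X
  proof -
    have "d1 l ** (d2 l ** (d3 l ** X ** ct (d3 l)) ** ct (d2 l)) ** ct (d1 l) =
        (d1 l ** (d2 l ** d3 l)) ** X ** ct (d1 l ** (d2 l ** d3 l))"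
      by (simp only: ct_mult matrix_mul_assoc)
    then show ?thesis using SU by (simp flip: d23)
  qed
  have k: "\<kappa> (d1 l) = n0 (d1 l) \<otimes> (n0 (d2 l) \<otimes> n2 (d3 l))"
    unfolding \<kappa>_def using SU S by (simp add: d23 agree2 agree3 h1 flip: h1(4))
  have c: "cj (\<kappa> (d1 l)) x = cj (n0 (d1 l)) (cj (n0 (d2 l)) (cj (n2 (d3 l)) x))" if "x \<in> carrier G" for x
    using SU that by (simp add: k cj_mult_left h0 h2)
  note cjs = hom_SU_cj[OF hom0] hom_SU_cj[OF hom1] hom_SU_cj[OF hom2]
  show "cj (\<kappa> (d1 l)) (n0 s) = n0 s" if s: "s \<in> Sg 1"
  proof -
    have m: "d3 l ** s ** ct (d3 l) \<in> Sg 1" using s U Ug_conj_Sg by blast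
    have "cj (n2 (d3 l)) (n0 s) = n0 (d3 l ** s ** ct (d3 l))"
      using s m SU by (simp add: agree1[symmetric] cjs Sg_SU)
    then show ?thesis
      using SU s m by (simp add: c h0(1) cjs Sg_SU prod)
  qed
  show "cj (\<kappa> (d1 l)) (n0 s) = n0 s" if s: "s \<in> Sg 2"
  proof -
    have m: "d3 l ** s ** ct (d3 l) \<in> Sg 2" using s U Ug_conj_Sg by blast
    have "cj (n2 (d3 l)) (n0 s) = n0 (d3 l ** s ** ct (d3 l))"
      using s m SU S by (simp add: agree2[symmetric] agree3 cjs Sg_SU)
    then show ?thesis
      using SU s m by (simp add: c h0(1) cjs Sg_SU prod)
  qed
  show "cj (\<kappa> (d1 l)) (n1 s) = n1 s" if s: "s \<in> Sg 3"
  proof -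
    have m: "d3 l ** s ** ct (d3 l) \<in> Sg 3" using s U Ug_conj_Sg by blast
    have m': "d2 l ** (d3 l ** s ** ct (d3 l)) ** ct (d2 l) \<in> Sg 3" using m U Ug_conj_Sg by blast
    have "cj (n2 (d3 l)) (n1 s) = n1 (d3 l ** s ** ct (d3 l))"
      using s SU S by (simp add: agree3 cjs Sg_SU)
    moreover have "cj (n0 (d2 l)) (n1 (d3 l ** s ** ct (d3 l))) =
        n1 (d2 l ** (d3 l ** s ** ct (d3 l)) ** ct (d2 l))"
      using SU S m by (simp add: agree2[symmetric] cjs Sg_SU)
    moreover have "cj (n0 (d1 l)) (n1 (d2 l ** (d3 l ** s ** ct (d3 l)) ** ct (d2 l))) = n1 s"
      using SU S m' s by (simp add: agree1[symmetric] agree3[symmetric] cjs Sg_SU prod)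
    ultimately show ?thesis
      using SU s m by (simp add: c h1(1) Sg_SU)
  qed
qed

text \<open>The first stabilizer is conjugate to the second one by an element of the third.\<close>

lemma torus_cj_n1:
  assumes l: "l * cnj l = 1" and s: "s \<in> Sg 1"
  shows "cj (\<kappa> (d1 l)) (n1 s) = n1 s"
proof -
  define w where "w = b3 0 1"
  have w: "w \<in> Sg 3" unfolding w_def by (rule b3_Sg) simp
  have we: "w *v e 1 = e 2" "w *v e 2 = - e 1" by (simp_all add: w_def b3_def mat3_simps) (simp add: vec_eq_iff forall_3)
  have s': "w ** s ** ct w \<in> Sg 2"
  proof -
    have "ct w *v e 2 = e 1" using we w by (metis SU_ct_simps(8) Sg_SU)
    then show ?thesis using s w by (simp add: Sg_def mv_assoc we)
  qed
  have SU: "w \<in> SU" "s \<in> SU" "d1 l \<in> SU" using w s d_Sg[OF l] by (auto simp: Sg_def)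
  have eq: "n1 s = n1 (ct w) \<otimes> (n1 (w ** s ** ct w) \<otimes> n1 w)"
    using SU by (simp flip: h1(2) matrix_mul_assoc)
  show ?thesis
    unfolding eq using SU torus_cj(2)[OF l s'] torus_cj(3)[OF l w] torus_cj(3)[OF l Sg_ct[OF w]] s'
    by (simp add: cj_mult_right h1 h0(1) agree2)
qed

text \<open>This set turns out to be all of \<open>Sg 1\<close>, which makes
  \<open>\<kappa>\<close> a homomorphism with commutative image.\<close>

definition good where
  "good = {s \<in> Sg 1. \<forall>x\<in>Sg 1. cj (\<kappa> s) (n0 x) = n0 x \<and> cj (\<kappa> s) (n1 x) = n1 x}"

lemma d1_good: "l * cnj l = 1 \<Longrightarrow> d1 l \<in> good"
  using torus_cj(1) torus_cj_n1 d_Sg by (simp add: good_def)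

text \<open>Here the centralizing property makes the defect multiplicative.\<close>

lemma \<kappa>_mult:
  assumes s: "s \<in> good" and t: "t \<in> Sg 1"
  shows "\<kappa> (t ** s) = \<kappa> t \<otimes> \<kappa> s"
proof -
  have SU: "s \<in> SU" "t \<in> SU" using s t by (auto simp: good_def Sg_def)
  have "cj (\<kappa> s) (n1 (ct t)) = n1 (ct t)" using s t Sg_ct by (auto simp: good_def)
  then have "\<kappa> s \<otimes> inv (n1 t) = inv (n1 t) \<otimes> \<kappa> s"
    using SU by (simp add: cj_fix h1)
  moreover have "\<kappa> (t ** s) = n0 t \<otimes> (\<kappa> s \<otimes> inv (n1 t))"
    using SU by (simp add: \<kappa>_def h0 h1 inv_mult_group m_assoc)
  ultimately show ?thesis using SU by (simp add: \<kappa>_def h0 h1 m_assoc)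
qed

lemma good_mult: assumes "s \<in> good" "t \<in> good" shows "t ** s \<in> good"
proof -
  have t: "t \<in> Sg 1" "s \<in> Sg 1" and SU: "s \<in> SU" "t \<in> SU" using assms by (auto simp: good_def Sg_def)
  then show ?thesis
    using assms by (auto simp: good_def \<kappa>_mult[OF assms(1) t(1)] Sg_mult cj_mult_left h0 h1 Sg_SU)
qed

lemma n0_\<kappa>: "s \<in> SU \<Longrightarrow> n0 s = \<kappa> s \<otimes> n1 s"
  by (simp add: \<kappa>_def h0 h1 m_assoc)

text \<open>Central factors cancel in commutators.\<close>

lemma \<kappa>_commutator:
  assumes s: "s \<in> good" and t: "t \<in> good"
  shows "n0 (t ** s ** ct t ** ct s) = n1 (t ** s ** ct t ** ct s)"
proof -
  have SU: "s \<in> SU" "t \<in> SU" using s t by (auto simp: good_def Sg_def)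
  have "n0 (t ** s) = \<kappa> t \<otimes> \<kappa> s \<otimes> n1 (t ** s)"
    using \<kappa>_mult[OF s, of t] t SU n0_\<kappa>[of "t ** s"] by (simp add: good_def)
  moreover have "n0 (s ** t) = \<kappa> s \<otimes> \<kappa> t \<otimes> n1 (s ** t)"
    using \<kappa>_mult[OF t, of s] s SU n0_\<kappa>[of "s ** t"] by (simp add: good_def)
  moreover have "\<kappa> s \<otimes> \<kappa> t = \<kappa> t \<otimes> \<kappa> s"
  proof -
    have "cj (\<kappa> s) (\<kappa> t) = \<kappa> t"
      using s t SU unfolding \<kappa>_def[of t]
      by (simp add: cj_mult_right cj_inv_right h0 h1 good_def)
    then show ?thesis using SU by (simp add: cj_fix)
  qed
  ultimately have "n0 (t ** s) \<otimes> inv (n0 (s ** t)) =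
      (\<kappa> t \<otimes> \<kappa> s) \<otimes> (n1 (t ** s) \<otimes> inv (n1 (s ** t))) \<otimes> inv (\<kappa> t \<otimes> \<kappa> s)"
    using SU h1(1)[of "t ** s"] h1(1)[of "s ** t"]
    by (simp add: m_assoc inv_mult_group del: h1)
  also have "\<dots> = cj (\<kappa> t \<otimes> \<kappa> s) (n1 (t ** s ** ct (s ** t)))"
    using SU h1(4)[of "s ** t"] h1(2)[of "t ** s" "ct (s ** t)"] by (simp add: cj_def)
  also have "\<dots> = n1 (t ** s ** ct (s ** t))"
  proof -
    have "t ** s ** ct (s ** t) \<in> Sg 1"
      using s t by (simp add: good_def Sg_mult Sg_ct)
    then show ?thesis using s t SU h1(1)[OF Sg_SU] by (simp add: cj_mult_left good_def)
  qed
  finally have "n0 (t ** s ** ct (s ** t)) = n1 (t ** s ** ct (s ** t))"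
    using SU h0(4)[of "s ** t"] h0(2)[of "t ** s" "ct (s ** t)"] by simp
  then show ?thesis by (simp add: ct_mult matrix_mul_assoc)
qed

end

text \<open>The homomorphism \<open>p\<close> is the image of the stabilizer of a plane, and
  \<open>n\<close> that of the normal SU(3) of the stabilizer of a point. The two relations hold
  inside the stabilizers of the point \<open>e\<^sub>3\<close> and of the line \<open>e\<^sub>1
  e\<^sub>1\<^sup>*\<close>.\<close>

locale su3_amalgam = group G for G (structure) +
  fixes p n :: "complex^3^3 \<Rightarrow> 'a"
  assumes homp: "p \<in> hom SU3_group G" and homn: "n \<in> hom SU3_group G"
    and rel3: "X \<in> Ug 3 \<Longrightarrow> Y \<in> SU \<Longrightarrow> cj (p X) (n Y) = n (X ** Y ** ct X)"
    and rel1: "X \<in> Ug 1 \<Longrightarrow> Y \<in> Sg 1 \<Longrightarrow> cj (p X) (n Y) = n (X ** Y ** ct X)"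
begin

lemmas hp = hom_SU[OF is_group homp] and hn = hom_SU[OF is_group homn]

text \<open>The homomorphism \<open>n\<close> is attached to the point \<open>e\<^sub>3\<close>;
  its transport \<open>fam X\<close> is attached to the point \<open>X e\<^sub>3\<close>, and
  depends only on that point.\<close>

definition fam :: "complex^3^3 \<Rightarrow> complex^3^3 \<Rightarrow> 'a" where
  "fam X Y = cj (p X) (n (ct X ** Y ** X))"

lemma fam_closed [simp]: "X \<in> SU \<Longrightarrow> Y \<in> SU \<Longrightarrow> fam X Y \<in> carrier G"
  by (simp add: fam_def hp hn)

lemma fam_hom: "X \<in> SU \<Longrightarrow> fam X \<in> hom SU3_group G"
proof (rule homI)
  fix A B assume "X \<in> SU" and AB: "A \<in> carrier SU3_group" "B \<in> carrier SU3_group"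
  moreover have "ct X ** (A ** B) ** X = (ct X ** A ** X) ** (ct X ** B ** X)"
    using \<open>X \<in> SU\<close> by (simp flip: matrix_mul_assoc)
  ultimately show "fam X (A \<otimes>\<^bsub>SU3_group\<^esub> B) = fam X A \<otimes> fam X B"
    by (simp add: fam_def hp hn(1) hn(2)[of "ct X ** A ** X"] cj_mult_right)
qed simp

lemma fam_mult: "X \<in> SU \<Longrightarrow> Z \<in> SU \<Longrightarrow> Y \<in> SU \<Longrightarrow> fam (X ** Z) Y = cj (p X) (fam Z (ct X ** Y ** X))"
  by (simp add: fam_def hp hn(1) cj_mult_left ct_mult matrix_mul_assoc)

lemma fam_Ug3: "X \<in> Ug 3 \<Longrightarrow> Y \<in> SU \<Longrightarrow> fam X Y = n Y"
  by (simp add: fam_def rel3 Ug_SU) (simp flip: matrix_mul_assoc add: Ug_SU)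

lemma fam_mult_Ug3: "X \<in> SU \<Longrightarrow> Z \<in> Ug 3 \<Longrightarrow> Y \<in> SU \<Longrightarrow> fam (X ** Z) Y = fam X Y"
  by (simp add: fam_mult fam_Ug3 Ug_SU) (simp add: fam_def)

lemma fam_Ug1: assumes "X \<in> Ug 1" "Y \<in> Sg 1" shows "fam X Y = n Y"
proof -
  have "ct X ** Y ** X \<in> Sg 1" using Ug_conj_Sg[OF Ug_ct[OF assms(1)] assms(2)] by simp
  then show ?thesis using assms
    by (simp add: fam_def rel1 Ug_SU) (simp flip: matrix_mul_assoc add: Ug_SU)
qed

lemma fam_one: "Y \<in> SU \<Longrightarrow> fam (mat 1) Y = n Y"
  by (simp add: fam_def hp hn)

text \<open>The rotation \<open>rot\<^sup>2\<close> moves \<open>e\<^sub>3\<close> to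
  \<open>e\<^sub>2\<close>, as does the matrix \<open>t\<close>, which preserves the ray of
  \<open>e\<^sub>1\<close>; so the second relation applies.\<close>

lemma fam_rot2: assumes "Y \<in> Sg 1" shows "fam (rot ** rot) Y = n Y"
proof -
  \<comment> \<open>The sign makes the determinant of this transposition equal to one.\<close>
  define t where "t = mat3 (-1) 0 0 0 0 1 0 1 0"
  have t: "t \<in> Ug 1" "ct t ** (rot ** rot) \<in> Ug 3"
    unfolding t_def Ug_def rot_def
    by (auto simp: mat3_simps intro!: SU_I exI[of _ "-1"] exI[of _ "1"])
  then have "fam (t ** (ct t ** (rot ** rot))) Y = n Y"
    using assms by (simp only: fam_mult_Ug3 fam_Ug1 Ug_SU Sg_SU)
  then show ?thesis using t Ug_SU by simp
qed

lemma fam_rot_step: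
  assumes X: "X \<in> SU" and Z: "Z \<in> SU" and Y: "Y \<in> SU"
    and eq: "fam X (ct rot ** Y ** rot) = fam Z (ct rot ** Y ** rot)"
  shows "fam (rot ** X) Y = fam (rot ** Z) Y"
  using assms by (simp add: fam_mult)

sublocale three_homs G n "fam rot" "fam (rot ** rot)"
proof
  show "n \<in> hom SU3_group G" "fam rot \<in> hom SU3_group G" "fam (rot ** rot) \<in> hom SU3_group G"
    by (simp_all add: homn fam_hom)
  show 1: "fam (rot ** rot) Y = n Y" if "Y \<in> Sg 1" for Y using that by (rule fam_rot2)
  show 2: "fam rot Y = n Y" if Y: "Y \<in> Sg 2" for Y
    using fam_rot_step[of "rot ** rot" "mat 1" Y] 1[OF Sg_rot(1)[OF Y]] Y
    by (simp add: rot_ct fam_one Sg_SU)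
  show "fam (rot ** rot) Y = fam rot Y" if Y: "Y \<in> Sg 3" for Y
    using fam_rot_step[of "rot" "mat 1" Y] 2[OF Sg_rot(2)[OF Y]] Y
    by (simp add: fam_one Sg_SU)
qed

lemma cj_p_n1:
  assumes g: "g \<in> Sg 1" and Y: "Y \<in> SU"
  shows "cj (p g) (fam rot Y) = fam rot (g ** Y ** ct g)"
proof -
  have SU: "g \<in> SU" using g Sg_SU by blast
  have r: "ct rot ** g ** rot \<in> Ug 3" using Sg_rot(3)[OF g] by (rule Sg_Ug)
  have "fam (rot ** (ct rot ** g ** rot)) (g ** Y ** ct g) = fam rot (g ** Y ** ct g)"
    using SU Y r by (intro fam_mult_Ug3) auto
  moreover have "rot ** (ct rot ** g ** rot) = g ** rot" by (simp flip: matrix_mul_assoc)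
  moreover have "ct g ** (g ** Y ** ct g) ** g = Y" using SU by (simp flip: matrix_mul_assoc)
  ultimately show ?thesis using SU Y by (simp add: fam_mult)
qed

lemma \<kappa>_conj:
  assumes g: "g \<in> Sg 1" and s: "s \<in> Sg 1"
  shows "\<kappa> (g ** s ** ct g) = cj (p g) (\<kappa> s)"
  using assms cj_p_n1[OF g, of s] rel1[OF Sg_Ug[OF g] s]
  by (simp add: \<kappa>_def cj_mult_right cj_inv_right hn(1) hp(1) Sg_SU)

text \<open>Conjugation by \<open>p g\<close> carries both images of \<open>Sg 1\<close> to
  themselves, and the defect of \<open>s\<close> to that of its conjugate.\<close>

lemma good_conj:
  assumes g: "g \<in> Sg 1" and s: "s \<in> good"
  shows "g ** s ** ct g \<in> good"
proof -
  have s1: "s \<in> Sg 1" and SU: "g \<in> SU" "s \<in> SU" using g s by (auto simp: good_def Sg_def)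
  have main: "cj (\<kappa> (g ** s ** ct g)) (n x) = n x \<and> cj (\<kappa> (g ** s ** ct g)) (fam rot x) = fam rot x"
    if x: "x \<in> Sg 1" for x
  proof -
    define y where "y = ct g ** x ** g"
    have y: "y \<in> Sg 1" unfolding y_def using Sg_mult Sg_ct g x by blast
    have xy: "x = g ** y ** ct g" using SU by (simp add: y_def matrix_mul_assoc)
    have "n x = cj (p g) (n y)" "fam rot x = cj (p g) (fam rot y)"
      unfolding xy using rel1[OF Sg_Ug[OF g] y] cj_p_n1[OF g, of y] y Sg_SU by auto
    then show ?thesis
      using SU y s by (simp add: \<kappa>_conj[OF g s1] cj_cj hp(1) hn(1) Sg_SU good_def)
  qed
  then show ?thesis using g s1 by (simp add: good_def Sg_mult Sg_ct)
qed

abbreviation "g0 \<equiv> b1 (1 / sqrt 2) (\<i> / sqrt 2)"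

lemma g0_Sg: "g0 \<in> Sg 1"
proof (rule b1_Sg)
  have "complex_of_real (sqrt 2) * complex_of_real (sqrt 2) = 2"
    by (simp only: of_real_mult[symmetric]) simp
  then show "complex_of_real (1 / sqrt 2) * cnj (complex_of_real (1 / sqrt 2)) +
      \<i> / complex_of_real (sqrt 2) * cnj (\<i> / complex_of_real (sqrt 2)) = 1"
    by (simp add: field_simps)
qed

lemma good_all: assumes "s \<in> Sg 1" shows "s \<in> good"
proof -
  obtain a b c where "a * cnj a = 1" "b * cnj b = 1" "c * cnj c = 1"
    "s = d1 a ** (g0 ** d1 c ** ct g0) ** d1 b"
    using Euler_angles[OF assms] by metis
  then show ?thesis using g0_Sg by (simp add: good_mult good_conj d1_good)
qed

text \<open>A diagonal element is the commutator of its square root and a Weyl element.\<close>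

lemma eq_rot_torus:
  assumes l: "l * cnj l = 1" shows "fam rot (d1 l) = n (d1 l)"
proof -
  define m J where "m = csqrt l" and "J = b1 0 1"
  have m: "m * m = l" by (simp add: m_def flip: power2_eq_square)
  have "(cmod l)\<^sup>2 = 1"
    using l unfolding complex_norm_square[symmetric] by (metis of_real_1 of_real_eq_iff)
  then have "cmod l = 1" by (simp add: power2_eq_1_iff) (smt (verit) norm_ge_zero)
  moreover have "(cmod m)\<^sup>2 = cmod l" using m by (metis norm_mult power2_eq_square)
  ultimately have mm: "m * cnj m = 1"
    by (simp flip: complex_norm_square)
  have J: "J \<in> Sg 1" unfolding J_def by (rule b1_Sg) simp
  have "d1 m ** J ** ct (d1 m) ** ct J = d1 l"
    by (simp add: d1_def J_def b1_def mat3_simps m flip: complex_cnj_mult)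
  then show ?thesis
    using \<kappa>_commutator[of J "d1 m"] good_all[OF J] d1_good[OF mm] by simp
qed

lemma eq_rot_Sg1:
  assumes "s \<in> Sg 1" shows "fam rot s = n s"
proof -
  have n1: "fam rot \<in> hom SU3_group G" by (simp add: fam_hom)
  note h1 = hom_SU[OF is_group n1]
  obtain a b c where abc: "a * cnj a = 1" "b * cnj b = 1" "c * cnj c = 1"
    "s = d1 a ** (g0 ** d1 c ** ct g0) ** d1 b"
    using Euler_angles[OF assms] by metis
  note SU = Sg_SU[OF g0_Sg] Sg_SU[OF d_Sg(1)[OF abc(1)]] Sg_SU[OF d_Sg(1)[OF abc(2)]]
    Sg_SU[OF d_Sg(1)[OF abc(3)]]
  have "fam rot (g0 ** d1 c ** ct g0) = n (g0 ** d1 c ** ct g0)"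
    using cj_p_n1[OF g0_Sg SU(4)] rel1[OF Sg_Ug[OF g0_Sg] d_Sg(1)[OF abc(3)]] eq_rot_torus[OF abc(3)]
    by simp
  moreover have "g0 ** d1 c ** ct g0 \<in> SU" using SU by simp
  ultimately show ?thesis
    unfolding abc(4) using SU by (simp only: h1(2) hn(2) mult_SU eq_rot_torus abc)
qed

text \<open>By rotation, equality on \<open>Sg 1\<close> yields equality of the other two pairs
  on \<open>Sg 2\<close> and \<open>Sg 3\<close>; combined with the agreement that is known
  there, it yields equality on a generating set.\<close>

lemma eq_rot: assumes "Y \<in> SU" shows "fam rot Y = n Y"
  using _ _ _ assms
proof (rule SU_generated)
  show "fam rot X = n X" if "X \<in> Sg 1" for X using that by (rule eq_rot_Sg1)
  have 2: "fam (rot ** rot) X = fam rot X" if X: "X \<in> Sg 2" for X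
    using fam_rot_step[of "rot" "mat 1" X] eq_rot_Sg1[OF Sg_rot(1)[OF X]] X
    by (simp add: fam_one Sg_SU)
  show "fam rot X = n X" if X: "X \<in> Sg 3" for X
    using fam_rot_step[of "rot ** rot" "rot" X] 2[OF Sg_rot(2)[OF X]] X agree3[OF X]
    by (simp add: fam_one Sg_SU rot_ct)
  show "fam rot (X ** Y) = n (X ** Y)" if "X \<in> SU" "Y \<in> SU" "fam rot X = n X" "fam rot Y = n Y" for X Y
    using that hom_SU(2)[OF is_group fam_hom[OF rot_SU]] by (simp add: hn)
qed

text \<open>The set of all \<open>X\<close> that satisfy the relation is closed under products,
  contains \<open>rot\<close> because \<open>fam rot = n\<close>, and contains \<open>Sg
  3\<close>; so it contains \<open>Sg 1\<close> as well.\<close>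

theorem rel: assumes X: "X \<in> SU" and Y: "Y \<in> SU" shows "cj (p X) (n Y) = n (X ** Y ** ct X)"
proof -
  define Q where "Q X \<longleftrightarrow> (\<forall>Y\<in>SU. cj (p X) (n Y) = n (X ** Y ** ct X))" for X
  have mult: "Q (X ** Z)" if "X \<in> SU" "Z \<in> SU" "Q X" "Q Z" for X Z
    using that unfolding Q_def
    by (simp add: hp(1,2) hn(1) cj_mult_left ct_mult matrix_mul_assoc)
  have rot: "Q rot"
    unfolding Q_def
  proof
    fix Y assume Y: "Y \<in> SU"
    have "ct rot ** (rot ** Y ** ct rot) ** rot = Y" by (simp flip: matrix_mul_assoc)
    then show "cj (p rot) (n Y) = n (rot ** Y ** ct rot)"
      using eq_rot[of "rot ** Y ** ct rot"] Y by (simp add: fam_def)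
  qed
  have 3: "Q X" if "X \<in> Sg 3" for X
    using rel3[OF Sg_Ug[OF that]] by (simp add: Q_def)
  have 1: "Q X" if X: "X \<in> Sg 1" for X
  proof -
    have "Q (rot ** (ct rot ** X ** rot) ** (rot ** rot))"
      using Sg_SU[OF X] by (intro mult rot 3[OF Sg_rot(3)[OF X]]) auto
    moreover have "rot ** (ct rot ** X ** rot) ** (rot ** rot) = X"
      by (simp flip: rot_ct(1) matrix_mul_assoc)
    ultimately show ?thesis by simp
  qed
  have "Q X" using 1 3 mult X by (rule SU_generated)
  then show ?thesis using Y by (simp add: Q_def)
qed

text \<open>This is \<open>(A, B) = (A B\<^sup>T, 1) \<cdot> (conj B, B)\<close> with the
  factors replaced by their images.\<close>

definition Phi :: "mat_pair \<Rightarrow> 'a" where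
  "Phi x = n (fst x ** transpose (snd x)) \<otimes> p (mat_cnj (snd x))"

lemma Phi_hom: "Phi \<in> hom SU3xSU3 G"
proof (rule homI)
  fix x assume "x \<in> carrier SU3xSU3"
  then show "Phi x \<in> carrier G"
    by (auto simp: SU3xSU3_def DirProd_def Phi_def hn hp simp flip: mat_cnj_ct)
next
  fix x y assume "x \<in> carrier SU3xSU3" "y \<in> carrier SU3xSU3"
  then obtain A B C D where xy: "x = (A, B)" "y = (C, D)" and SU: "A \<in> SU" "B \<in> SU" "C \<in> SU" "D \<in> SU"
    by (auto simp: SU3xSU3_def DirProd_def)
  define b d where "b = mat_cnj B" and "d = mat_cnj D"
  have bd: "b \<in> SU" "d \<in> SU" using SU by (auto simp: b_def d_def)
  have "Phi x \<otimes> Phi y = (n (A ** ct b) \<otimes> p b) \<otimes> (n (C ** ct d) \<otimes> p d)"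
    by (simp add: Phi_def xy b_def d_def ct_cnj)
  also have "\<dots> = n (A ** ct b) \<otimes> cj (p b) (n (C ** ct d)) \<otimes> (p b \<otimes> p d)"
    using SU bd by (simp add: cj_def hn(1) hp(1) m_assoc)
  also have "\<dots> = n (A ** ct b ** (b ** (C ** ct d) ** ct b)) \<otimes> p (b ** d)"
    using SU bd rel[of b "C ** ct d"] hn(2)[of "A ** ct b" "b ** (C ** ct d) ** ct b"] hp(2)[of b d]
    by simp
  also have "A ** ct b ** (b ** (C ** ct d) ** ct b) = (A ** C) ** ct (b ** d)"
    using bd by (simp add: ct_mult flip: matrix_mul_assoc)
  finally show "Phi (x \<otimes>\<^bsub>SU3xSU3\<^esub> y) = Phi x \<otimes> Phi y"
    by (simp add: xy SU3xSU3_def DirProd_def Phi_def mat_cnj_mult b_def d_def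
        flip: ct_cnj)
qed

end

section \<open>Flag complexes of typed graphs\<close>

text \<open>A flag complex is determined by its graph, and the link of a simplex is the flag
  complex of the common neighbours; so all links below are again of this form.\<close>

definition flags :: "'v set \<Rightarrow> ('v \<Rightarrow> 'v \<Rightarrow> bool) \<Rightarrow> 'v set set" where
  "flags W E = {\<alpha>. finite \<alpha> \<and> \<alpha> \<subseteq> W \<and> (\<forall>x\<in>\<alpha>. \<forall>y\<in>\<alpha>. x \<noteq> y \<longrightarrow> E x y)}"

definition residue :: "'v set \<Rightarrow> ('v \<Rightarrow> 'v \<Rightarrow> bool) \<Rightarrow> 'v set \<Rightarrow> 'v set" where
  "residue W E \<alpha> = {x \<in> W. \<forall>y\<in>\<alpha>. E y x}"

definition gallery_step :: "nat \<Rightarrow> 'v set set \<Rightarrow> 'v set \<Rightarrow> 'v set \<Rightarrow> bool" where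
  "gallery_step n \<Delta> c d \<longleftrightarrow> c \<in> chambers \<Delta> \<and> d \<in> chambers \<Delta> \<and> n \<le> card (c \<inter> d) + 1"

definition gallery_connected :: "nat \<Rightarrow> 'v set set \<Rightarrow> bool" where
  "gallery_connected n \<Delta> \<longleftrightarrow> (\<forall>c\<in>chambers \<Delta>. \<forall>d\<in>chambers \<Delta>. (gallery_step n \<Delta>)\<^sup>*\<^sup>* c d)"

lemma gallery_of_steps:
  assumes "(gallery_step n \<Delta>)\<^sup>*\<^sup>* c d" "c \<in> chambers \<Delta>"
  shows "\<exists>cs. gallery n \<Delta> cs \<and> hd cs = c \<and> last cs = d"
  using assms
proof (induction rule: converse_rtranclp_induct)
  case base
  then show ?case by (intro exI[of _ "[d]"]) (simp add: gallery_def)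
next
  case (step y z)
  then obtain cs where "gallery n \<Delta> cs" "hd cs = z" "last cs = d"
    by (auto simp: gallery_step_def)
  then show ?case using step
    by (intro exI[of _ "y # cs"]) (auto simp: gallery_def gallery_step_def successively_Cons)
qed

lemma empty_flags [simp]: "{} \<in> flags W E"
  by (simp add: flags_def)

lemma flags_subset: "\<alpha> \<in> flags W E \<Longrightarrow> \<beta> \<subseteq> \<alpha> \<Longrightarrow> \<beta> \<in> flags W E"
  using finite_subset[of \<beta> \<alpha>] by (auto simp: flags_def)

lemma flags_finite: "\<alpha> \<in> flags W E \<Longrightarrow> finite \<alpha>" and flags_carrier: "\<alpha> \<in> flags W E \<Longrightarrow> \<alpha> \<subseteq> W"
  by (auto simp: flags_def)

lemma singleton_flags [simp]: "{x} \<in> flags W E \<longleftrightarrow> x \<in> W"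
  by (simp add: flags_def)

lemma Union_flags [simp]: "\<Union>(flags W E) = W"
proof -
  have "x \<in> W \<Longrightarrow> {x} \<in> flags W E" for x by simp
  then show ?thesis by (auto simp: flags_def)
qed

lemma simplicial_complex_flags: "W \<noteq> {} \<Longrightarrow> simplicial_complex (flags W E)"
  unfolding simplicial_complex_def Union_flags
  by (auto simp: flags_subset) (simp add: flags_def)

locale typed_graph =
  fixes W :: "'v set" and E :: "'v \<Rightarrow> 'v \<Rightarrow> bool" and t :: "'v \<Rightarrow> 'i" and I :: "'i set"
  assumes sym: "E x y \<Longrightarrow> E y x"
    and types: "E x y \<Longrightarrow> t x \<noteq> t y"
    and finI: "finite I"
    and tI: "x \<in> W \<Longrightarrow> t x \<in> I"
begin

lemma pair_flags: "x \<noteq> y \<Longrightarrow> {x, y} \<in> flags W E \<longleftrightarrow> x \<in> W \<and> y \<in> W \<and> E x y"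
  by (auto simp: flags_def intro: sym)

lemma adj_flags: "adj (flags W E) x y \<longleftrightarrow> x \<in> W \<and> y \<in> W \<and> E x y"
  unfolding adj_def using pair_flags types by metis

lemma flag_complex_flags: "flag_complex (flags W E)"
  unfolding flag_complex_def Union_flags
  by (auto simp: pair_flags) (auto simp: flags_def)

lemma inj_flags: "\<alpha> \<in> flags W E \<Longrightarrow> inj_on t \<alpha>"
  unfolding inj_on_def flags_def using types by blast

lemma card_flags: "\<alpha> \<in> flags W E \<Longrightarrow> card (t ` \<alpha>) = card \<alpha>"
  by (rule card_image) (rule inj_flags)

lemma t_flags: "\<alpha> \<in> flags W E \<Longrightarrow> t ` \<alpha> \<subseteq> I"
  using tI by (auto simp: flags_def)

lemma link_flags:
  assumes "\<alpha> \<in> flags W E"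
  shows "link (flags W E) \<alpha> = flags (residue W E \<alpha>) E"
proof (intro equalityI subsetI)
  fix \<beta> assume b: "\<beta> \<in> link (flags W E) \<alpha>"
  show "\<beta> \<in> flags (residue W E \<alpha>) E"
  proof -
    have "finite \<beta>" "\<beta> \<subseteq> W" "\<And>x y. x \<in> \<beta> \<Longrightarrow> y \<in> \<beta> \<Longrightarrow> x \<noteq> y \<Longrightarrow> E x y"
      using b by (auto simp: link_def flags_def)
    moreover have "E y x" if "x \<in> \<beta>" "y \<in> \<alpha>" for x y
    proof -
      have "x \<noteq> y" using b that by (auto simp: link_def)
      then show ?thesis using b that by (auto simp: link_def flags_def)
    qed
    ultimately show ?thesis by (auto simp: flags_def residue_def)
  qed
next
  fix \<beta> assume b: "\<beta> \<in> flags (residue W E \<alpha>) E"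
  have "\<alpha> \<inter> \<beta> = {}"
  proof (rule ccontr)
    assume "\<alpha> \<inter> \<beta> \<noteq> {}"
    then obtain x where "x \<in> \<alpha>" "x \<in> \<beta>" by blast
    then have "E x x" using b by (auto simp: flags_def residue_def)
    then show False using types by blast
  qed
  moreover have "\<beta> \<in> flags W E" using b by (auto simp: flags_def residue_def)
  moreover have "\<alpha> \<union> \<beta> \<in> flags W E"
    using b assms by (auto simp: flags_def residue_def intro: sym)
  ultimately show "\<beta> \<in> link (flags W E) \<alpha>" by (simp add: link_def)
qed

lemma typed_graph_residue:
  assumes "\<alpha> \<in> flags W E"
  shows "typed_graph (residue W E \<alpha>) E t (I - t ` \<alpha>)"
proof
  show "t x \<in> I - t ` \<alpha>" if "x \<in> residue W E \<alpha>" for x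
    using that tI[of x] types[of _ x] unfolding residue_def by (smt (verit, best) DiffI imageE mem_Collect_eq)
  show "E y x" if "E x y" for x y using that by (rule sym)
  show "t x \<noteq> t y" if "E x y" for x y using that by (rule types)
  show "finite (I - t ` \<alpha>)" using finI by simp
qed

lemma insert_flags:
  "\<alpha> \<in> flags W E \<Longrightarrow> x \<in> residue W E \<alpha> \<Longrightarrow> insert x \<alpha> \<in> flags W E"
  by (auto simp: flags_def residue_def intro: sym)

end

text \<open>Every flag that misses a type can be extended by at least three vertices of that type;
  this gives purity and thickness at once, and it is inherited by residues.\<close>

locale thick_graph = typed_graph W E t I for W E t I +
  assumes extend: "\<alpha> \<in> flags W E \<Longrightarrow> i \<in> I \<Longrightarrow> i \<notin> t ` \<alpha> \<Longrightarrow>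
      \<exists>S \<subseteq> residue W E \<alpha>. card S = 3 \<and> t ` S \<subseteq> {i}"
begin

lemma extend_one:
  assumes "\<alpha> \<in> flags W E" "i \<in> I" "i \<notin> t ` \<alpha>"
  obtains x where "x \<in> residue W E \<alpha>" "t x = i"
proof -
  obtain S where S: "S \<subseteq> residue W E \<alpha>" "card S = 3" "t ` S \<subseteq> {i}" using extend[OF assms] by auto
  then have "S \<noteq> {}" by auto
  then obtain x where "x \<in> S" by auto
  with S show ?thesis using that[of x] by auto
qed

lemma extend_full: "\<alpha> \<in> flags W E \<Longrightarrow> \<exists>\<gamma>\<in>flags W E. \<alpha> \<subseteq> \<gamma> \<and> t ` \<gamma> = I"
proof (induction "card (I - t ` \<alpha>)" arbitrary: \<alpha>)
  case 0
  then have "t ` \<alpha> = I" using finI t_flags[of \<alpha>] by auto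
  then show ?case using 0 by auto
next
  case (Suc k)
  then have "I - t ` \<alpha> \<noteq> {}" by (metis card.empty nat.simps(3))
  then obtain i where i: "i \<in> I" "i \<notin> t ` \<alpha>" by auto
  obtain x where x: "x \<in> residue W E \<alpha>" "t x = i" using extend_one[OF Suc.prems i] .
  have "I - t ` \<alpha> = insert i (I - t ` insert x \<alpha>)" using i x by auto
  moreover have "i \<notin> I - t ` insert x \<alpha>" using x by auto
  ultimately have "card (I - t ` \<alpha>) = Suc (card (I - t ` insert x \<alpha>))"
    using finI card_insert_disjoint[of "I - t ` insert x \<alpha>" i] by (metis finite_Diff)
  then have "k = card (I - t ` insert x \<alpha>)" using Suc.hyps(2) by linarith
  from Suc.hyps(1)[OF this insert_flags[OF Suc.prems x(1)]] show ?case by auto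
qed

lemma chambers_flags: "chambers (flags W E) = {\<gamma> \<in> flags W E. t ` \<gamma> = I}"
proof (intro equalityI subsetI)
  fix \<gamma> assume "\<gamma> \<in> chambers (flags W E)"
  then show "\<gamma> \<in> {\<gamma> \<in> flags W E. t ` \<gamma> = I}"
    using extend_full[of \<gamma>] by (auto simp: chambers_def)
next
  fix \<gamma> assume g: "\<gamma> \<in> {\<gamma> \<in> flags W E. t ` \<gamma> = I}"
  have "\<beta> = \<gamma>" if b: "\<beta> \<in> flags W E" "\<gamma> \<subseteq> \<beta>" for \<beta>
  proof
    show "\<beta> \<subseteq> \<gamma>"
    proof
      fix x assume x: "x \<in> \<beta>"
      then have "t x \<in> t ` \<gamma>" using g t_flags[OF b(1)] by auto
      then obtain y where "y \<in> \<gamma>" "t x = t y" by auto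
      then show "x \<in> \<gamma>" using inj_onD[OF inj_flags[OF b(1)], of x y] x b(2) by auto
    qed
  qed (fact b)
  then show "\<gamma> \<in> chambers (flags W E)" using g by (simp add: chambers_def)
qed

lemma pure_flags: "pure_of_rank (card I) (flags W E)"
  unfolding pure_of_rank_def chambers_flags
proof (intro conjI ballI)
  show "\<exists>\<gamma>\<in>{\<gamma> \<in> flags W E. t ` \<gamma> = I}. \<alpha> \<subseteq> \<gamma>" if "\<alpha> \<in> flags W E" for \<alpha>
    using extend_full[OF that] by auto
qed (use card_flags in auto)

lemma thick_graph_residue:
  assumes "\<alpha> \<in> flags W E"
  shows "thick_graph (residue W E \<alpha>) E t (I - t ` \<alpha>)"
proof -
  interpret r: typed_graph "residue W E \<alpha>" E t "I - t ` \<alpha>" using assms by (rule typed_graph_residue)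
  show ?thesis
  proof
    fix \<beta> i assume b: "\<beta> \<in> flags (residue W E \<alpha>) E" and i: "i \<in> I - t ` \<alpha>" "i \<notin> t ` \<beta>"
    have "\<alpha> \<union> \<beta> \<in> flags W E" using b link_flags[OF assms] by (auto simp: link_def)
    moreover have "i \<in> I" "i \<notin> t ` (\<alpha> \<union> \<beta>)" using i by auto
    ultimately obtain S where S: "S \<subseteq> residue W E (\<alpha> \<union> \<beta>)" "card S = 3" "t ` S \<subseteq> {i}"
      using extend[of "\<alpha> \<union> \<beta>" i] by auto
    have "residue W E (\<alpha> \<union> \<beta>) = residue (residue W E \<alpha>) E \<beta>" by (auto simp: residue_def)
    with S show "\<exists>S\<subseteq>residue (residue W E \<alpha>) E \<beta>. card S = 3 \<and> t ` S \<subseteq> {i}" by auto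
  qed
qed

lemma chamber_complex_flags:
  assumes "I \<noteq> {}" "gallery_connected (card I) (flags W E)"
  shows "chamber_complex (card I) (flags W E)"
proof -
  obtain i where "i \<in> I" using assms by blast
  then obtain x where "x \<in> W" using extend_one[of "{}" i] by (auto simp: residue_def)
  then have "simplicial_complex (flags W E)" by (intro simplicial_complex_flags) auto
  moreover have "\<exists>cs. gallery (card I) (flags W E) cs \<and> hd cs = c \<and> last cs = d"
    if "c \<in> chambers (flags W E)" "d \<in> chambers (flags W E)" for c d
    using that assms(2) by (intro gallery_of_steps) (auto simp: gallery_connected_def)
  ultimately show ?thesis
    using pure_flags by (simp add: chamber_complex_def)
qed

lemma thick_flags: "thick (card I) (flags W E)"
  unfolding thick_def
proof (intro ballI impI)
  fix \<alpha> assume a: "\<alpha> \<in> flags W E" "card \<alpha> + 1 = card I"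
  then have "t ` \<alpha> \<noteq> I" "t ` \<alpha> \<subseteq> I" using card_flags t_flags by auto
  then obtain i where i: "i \<in> I" "i \<notin> t ` \<alpha>" by blast
  then obtain S where S: "S \<subseteq> residue W E \<alpha>" "card S = 3" "t ` S \<subseteq> {i}"
    using extend[OF a(1) i] by auto
  have cI: "I = insert i (t ` \<alpha>)"
    using i \<open>t ` \<alpha> \<subseteq> I\<close> a card_flags[OF a(1)] finI
    by (intro card_subset_eq[symmetric]) (auto simp: card_insert_if finite_subset)
  have na: "x \<notin> \<alpha>" if "x \<in> S" for x using that S i by auto
  show "\<exists>S\<subseteq>{\<gamma> \<in> chambers (flags W E). \<alpha> \<subseteq> \<gamma>}. card S = 3"
  proof (intro exI[of _ "(\<lambda>x. insert x \<alpha>) ` S"] conjI)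
    show "(\<lambda>x. insert x \<alpha>) ` S \<subseteq> {\<gamma> \<in> chambers (flags W E). \<alpha> \<subseteq> \<gamma>}"
      using S insert_flags[OF a(1)] cI by (auto simp: chambers_flags)
    have "inj_on (\<lambda>x. insert x \<alpha>) S" using na by (auto simp: inj_on_def)
    then show "card ((\<lambda>x. insert x \<alpha>) ` S) = 3" using S by (simp add: card_image)
  qed
qed

text \<open>In rank one any two chambers meet in corank at most one.\<close>

lemma gallery_connected_rank_1: "card I \<le> 1 \<Longrightarrow> gallery_connected (card I) (flags W E)"
  unfolding gallery_connected_def gallery_step_def by (auto intro!: r_into_rtranclp)

text \<open>Purity and thickness come from the extension property, and links are residues; what
  remains is connectivity in corank at least two.\<close>

theorem geometry_flags:
  assumes "I \<noteq> {}"
    and conn: "\<And>\<alpha>. \<alpha> \<in> flags W E \<Longrightarrow> 2 \<le> card (I - t ` \<alpha>) \<Longrightarrow>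
      gallery_connected (card (I - t ` \<alpha>)) (flags (residue W E \<alpha>) E)"
  shows "geometry I (flags W E) t"
proof -
  have cc: "chamber_complex (card (I - t ` \<alpha>)) (flags (residue W E \<alpha>) E)"
    if a: "\<alpha> \<in> flags W E" "t ` \<alpha> \<noteq> I" for \<alpha>
  proof -
    interpret r: thick_graph "residue W E \<alpha>" E t "I - t ` \<alpha>" using a(1) by (rule thick_graph_residue)
    have "I - t ` \<alpha> \<noteq> {}" using a t_flags by blast
    moreover have "gallery_connected (card (I - t ` \<alpha>)) (flags (residue W E \<alpha>) E)"
      using conn[OF a(1)] r.gallery_connected_rank_1 by (cases "2 \<le> card (I - t ` \<alpha>)") auto
    ultimately show ?thesis by (rule r.chamber_complex_flags)
  qed
  have "chamber_complex (card I) (flags W E)"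
    using cc[of "{}"] assms(1) by (simp add: residue_def)
  moreover have "\<exists>m. chamber_complex m (link (flags W E) \<alpha>)"
    if "\<alpha> \<in> flags W E - chambers (flags W E)" for \<alpha>
  proof -
    have a: "\<alpha> \<in> flags W E" "t ` \<alpha> \<noteq> I" using that by (auto simp: chambers_flags)
    show ?thesis using cc[OF a] unfolding link_flags[OF a(1)] by (rule exI)
  qed
  ultimately show ?thesis
    unfolding geometry_def
    using finI thick_flags inj_flags flag_complex_flags tI by auto
qed

end

text \<open>In rank 2, galleries come from paths.\<close>

definition path_connected_graph :: "'v set \<Rightarrow> ('v \<Rightarrow> 'v \<Rightarrow> bool) \<Rightarrow> bool" where
  "path_connected_graph W E \<longleftrightarrow>
     (\<forall>a\<in>W. \<forall>b\<in>W. (\<lambda>x y. x \<in> W \<and> y \<in> W \<and> E x y)\<^sup>*\<^sup>* a b)"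

context thick_graph begin

lemma gallery_connected_rank_2:
  assumes I: "card I = 2" and conn: "path_connected_graph W E"
  shows "gallery_connected 2 (flags W E)"
proof -
  let ?ch = "chambers (flags W E)"
  have share: "gallery_step 2 (flags W E) c d" if "c \<in> ?ch" "d \<in> ?ch" "x \<in> c" "x \<in> d" for c d x
  proof -
    have "finite (c \<inter> d)" using that by (auto simp: chambers_flags dest: flags_finite)
    then have "card (c \<inter> d) \<noteq> 0" using that by auto
    then show ?thesis using that by (simp add: gallery_step_def)
  qed
  have edge: "{x, y} \<in> ?ch" if "x \<in> W" "y \<in> W" "E x y" for x y
  proof -
    have "card {t x, t y} = 2" "{t x, t y} \<subseteq> I" using that types tI by auto
    then have "{t x, t y} = I" using I finI by (simp add: card_subset_eq)
    then show ?thesis using that pair_flags[of x y] types by (auto simp: chambers_flags)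
  qed
  have path: "(gallery_step 2 (flags W E))\<^sup>*\<^sup>* c d"
    if "(\<lambda>x y. x \<in> W \<and> y \<in> W \<and> E x y)\<^sup>*\<^sup>* a b" "c \<in> ?ch" "d \<in> ?ch" "a \<in> c" "b \<in> d" for a b c d
    using that
  proof (induction arbitrary: d rule: rtranclp_induct)
    case base
    then show ?case using share by blast
  next
    case (step y z)
    then have "(gallery_step 2 (flags W E))\<^sup>*\<^sup>* c {y, z}" using edge by auto
    moreover have "gallery_step 2 (flags W E) {y, z} d" using step edge share[of "{y,z}" d z] by auto
    ultimately show ?case by simp
  qed
  show ?thesis
    unfolding gallery_connected_def
  proof (intro ballI)
    fix c d assume cd: "c \<in> ?ch" "d \<in> ?ch"
    then have "c \<noteq> {}" "d \<noteq> {}" using I by (auto simp: chambers_flags)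
    then obtain a b where ab: "a \<in> c" "b \<in> d" by blast
    then have "a \<in> W" "b \<in> W" using cd by (auto simp: chambers_flags dest!: flags_carrier)
    then show "(gallery_step 2 (flags W E))\<^sup>*\<^sup>* c d"
      using conn by (intro path[OF _ cd ab]) (auto simp: path_connected_graph_def)
  qed
qed

end

section \<open>Generalized polygons\<close>

lemma path_rtranclp:
  "successively R xs \<Longrightarrow> xs \<noteq> [] \<Longrightarrow> R\<^sup>*\<^sup>* (hd xs) (last xs)"
proof (induction xs)
  case (Cons x xs)
  then show ?case
    by (cases xs) (auto intro: converse_rtranclp_into_rtranclp)
qed simp

locale thick_bipartite = thick_graph W E t "{i, j}" for W E t i j +
  assumes ij: "i \<noteq> j"
begin

abbreviation "\<Delta> \<equiv> flags W E"

lemma opposite_type: "E x y \<Longrightarrow> x \<in> W \<Longrightarrow> y \<in> W \<Longrightarrow> (t y = i) \<noteq> (t x = i)"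
  using types[of x y] tI[of x] tI[of y] by auto

lemma same_type: "x \<in> W \<Longrightarrow> y \<in> W \<Longrightarrow> t x \<noteq> t y \<longleftrightarrow> (t y = i) \<noteq> (t x = i)"
  using tI[of x] tI[of y] ij by auto

lemma type_eq_iff: "x \<in> W \<Longrightarrow> y \<in> W \<Longrightarrow> t x = t y \<longleftrightarrow> (t y = i) = (t x = i)"
  using same_type by blast

lemma neighbour:
  assumes "x \<in> W" obtains y where "y \<in> W" "E x y"
proof -
  define k where "k = (if t x = i then j else i)"
  have "k \<in> {i, j}" "k \<notin> t ` {x}" using ij by (auto simp: k_def)
  then obtain y where "y \<in> residue W E {x}" using extend_one[of "{x}" k] assms by auto
  then show ?thesis using that by (auto simp: residue_def)
qed

text \<open>The type alternates along a cycle, so its length is even.\<close>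

lemma short_cycles:
  assumes c: "is_cycle \<Delta> xs" and l: "length xs \<le> 7"
  shows "(\<exists>a b c d. xs = [a, b, c, d]) \<or> (\<exists>a b c d f g. xs = [a, b, c, d, f, g])"
proof -
  have "length xs \<in> {3, 4, 5, 6, 7}" using l c by (auto simp: is_cycle_def)
  then consider "length xs = 3" | "length xs = 4" | "length xs = 5" | "length xs = 6" | "length xs = 7" by blast
  then show ?thesis
  proof cases
    case 1
    then obtain a b d where xs: "xs = [a, b, d]" by (auto simp: length_Suc_conv numeral_eq_Suc)
    have "E a b" "E b d" "E d a" "a \<in> W" "b \<in> W" "d \<in> W"
      using c by (auto simp: xs is_cycle_def adj_flags)
    then have False using opposite_type[of a b] opposite_type[of b d] opposite_type[of d a] by blast
    then show ?thesis ..
  next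
    case 2
    then show ?thesis by (auto simp: length_Suc_conv numeral_eq_Suc)
  next
    case 3
    then obtain a b d f g where xs: "xs = [a, b, d, f, g]" by (auto simp: length_Suc_conv numeral_eq_Suc)
    have "E a b" "E b d" "E d f" "E f g" "E g a" "a \<in> W" "b \<in> W" "d \<in> W" "f \<in> W" "g \<in> W"
      using c by (auto simp: xs is_cycle_def adj_flags)
    then have False using opposite_type[of a b] opposite_type[of b d] opposite_type[of d f]
      opposite_type[of f g] opposite_type[of g a] by blast
    then show ?thesis ..
  next
    case 4
    then show ?thesis by (auto simp: length_Suc_conv numeral_eq_Suc)
  next
    case 5
    then obtain a b d f g h k where xs: "xs = [a, b, d, f, g, h, k]" by (auto simp: length_Suc_conv numeral_eq_Suc)
    have "E a b" "E b d" "E d f" "E f g" "E g h" "E h k" "E k a" "a \<in> W" "b \<in> W" "d \<in> W" "f \<in> W" "g \<in> W" "h \<in> W" "k \<in> W"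
      using c by (auto simp: xs is_cycle_def adj_flags)
    then have False using opposite_type[of a b] opposite_type[of b d] opposite_type[of d f]
      opposite_type[of f g] opposite_type[of g h] opposite_type[of h k] opposite_type[of k a] by blast
    then show ?thesis ..
  qed
qed

definition is_path :: "'a list \<Rightarrow> 'a \<Rightarrow> 'a \<Rightarrow> bool" where
  "is_path xs a b \<longleftrightarrow> xs \<noteq> [] \<and> successively (adj \<Delta>) xs \<and> hd xs = a \<and> last xs = b"

lemma path_connected:
  assumes "\<And>a b. a \<in> W \<Longrightarrow> b \<in> W \<Longrightarrow> \<exists>xs. is_path xs a b"
  shows "path_connected_graph W E"
  unfolding path_connected_graph_def
proof (intro ballI)
  fix a b assume "a \<in> W" "b \<in> W"
  then obtain xs where "is_path xs a b" using assms by blast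
  then show "(\<lambda>x y. x \<in> W \<and> y \<in> W \<and> E x y)\<^sup>*\<^sup>* a b"
    using path_rtranclp[of "adj \<Delta>" xs] by (simp add: is_path_def adj_flags[abs_def])
qed

text \<open>The path condition bounds the diameter from above and gives connectedness; a pair of
  vertices without short connecting path bounds it from below.\<close>

theorem generalized_polygon_flags:
  assumes k: "2 \<le> k"
    and paths: "\<And>a b. a \<in> W \<Longrightarrow> b \<in> W \<Longrightarrow> \<exists>xs. is_path xs a b \<and> length xs \<le> k + 1"
    and no_short: "\<And>xs. is_cycle \<Delta> xs \<Longrightarrow> 2 * k \<le> length xs"
    and cycle: "is_cycle \<Delta> ys" "length ys = 2 * k"
    and far: "a \<in> W" "b \<in> W" "\<And>xs. is_path xs a b \<Longrightarrow> k < length xs"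
  shows "generalized_polygon k {i, j} \<Delta> t"
proof -
  have card2: "card {i, j} = 2" using ij by simp
  have pc: "path_connected_graph W E" by (rule path_connected) (use paths in blast)
  have "geometry {i, j} \<Delta> t"
  proof (rule geometry_flags)
    fix \<alpha> assume a: "\<alpha> \<in> \<Delta>" "2 \<le> card ({i, j} - t ` \<alpha>)"
    have "{i, j} - t ` \<alpha> = {i, j}"
      by (rule card_seteq) (use a card2 in auto)
    then have "t ` \<alpha> \<inter> {i, j} = {}" by blast
    then have "t ` \<alpha> = {}" using t_flags[OF a(1)] by blast
    then have "\<alpha> = {}" by blast
    then show "gallery_connected (card ({i, j} - t ` \<alpha>)) (flags (residue W E \<alpha>) E)"
      using gallery_connected_rank_2[OF card2 pc] card2 by (simp add: residue_def)
  qed simp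
  moreover have "girth \<Delta> = enat (2 * k)"
    unfolding girth_def
  proof (rule antisym)
    show "(INF xs\<in>{xs. is_cycle \<Delta> xs}. enat (length xs)) \<le> enat (2 * k)"
      using cycle by (metis INF_lower mem_Collect_eq)
    show "enat (2 * k) \<le> (INF xs\<in>{xs. is_cycle \<Delta> xs}. enat (length xs))"
      by (rule INF_greatest) (use no_short in auto)
  qed
  moreover have "graph_diameter \<Delta> = enat k"
    unfolding graph_diameter_def Union_flags
  proof (rule antisym)
    have "graph_dist \<Delta> x y \<le> enat k" if xy: "x \<in> W" "y \<in> W" for x y
    proof -
      obtain xs where xs: "is_path xs x y" "length xs \<le> k + 1" using paths xy by blast
      then have "graph_dist \<Delta> x y \<le> enat (length xs - 1)"
        unfolding graph_dist_def is_path_def by (intro INF_lower) auto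
      also have "\<dots> \<le> enat k" using xs by simp
      finally show ?thesis .
    qed
    then show "(SUP x\<in>W. SUP y\<in>W. graph_dist \<Delta> x y) \<le> enat k"
      by (intro SUP_least) auto
    have "enat k \<le> graph_dist \<Delta> a b"
      unfolding graph_dist_def
      by (rule INF_greatest) (use far(3) in \<open>fastforce simp: is_path_def\<close>)
    also have "\<dots> \<le> (SUP y\<in>W. graph_dist \<Delta> a y)" using far by (intro SUP_upper)
    also have "\<dots> \<le> (SUP x\<in>W. SUP y\<in>W. graph_dist \<Delta> x y)" using far by (intro SUP_upper)
    finally show "enat k \<le> (SUP x\<in>W. SUP y\<in>W. graph_dist \<Delta> x y)" .
  qed
  ultimately show ?thesis using k card2 by (simp add: generalized_polygon_def)
qed

lemma path_lists:
  "is_path xs a b \<Longrightarrow> length xs \<le> 4 \<Longrightarrow> xs = [a] \<and> a = b \<or> xs = [a, b] \<and> adj \<Delta> a b \<or>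
     (\<exists>c. xs = [a, c, b] \<and> adj \<Delta> a c \<and> adj \<Delta> c b) \<or>
     (\<exists>c d. xs = [a, c, d, b] \<and> adj \<Delta> a c \<and> adj \<Delta> c d \<and> adj \<Delta> d b)"
  by (cases xs; cases "tl xs"; cases "tl (tl xs)"; cases "tl (tl (tl xs))"; cases "tl (tl (tl (tl xs)))")
     (auto simp: is_path_def)

lemma is_path_simps:
  "is_path [a] a b \<longleftrightarrow> a = b" "is_path [a, b] a b \<longleftrightarrow> adj \<Delta> a b"
  "is_path [a, c, b] a b \<longleftrightarrow> adj \<Delta> a c \<and> adj \<Delta> c b"
  "is_path [a, c, d, b] a b \<longleftrightarrow> adj \<Delta> a c \<and> adj \<Delta> c d \<and> adj \<Delta> d b"
  "is_path [a, c, d, f, b] a b \<longleftrightarrow> adj \<Delta> a c \<and> adj \<Delta> c d \<and> adj \<Delta> d f \<and> adj \<Delta> f b"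
  by (auto simp: is_path_def)

theorem digon:
  assumes inc: "\<And>x y. x \<in> W \<Longrightarrow> y \<in> W \<Longrightarrow> t x \<noteq> t y \<Longrightarrow> E x y"
  shows "generalized_polygon 2 {i, j} \<Delta> t"
proof -
  have two: "\<exists>a b. a \<in> W \<and> b \<in> W \<and> a \<noteq> b \<and> t a = k \<and> t b = k" if k: "k \<in> {i, j}" for k
  proof -
    obtain S where S: "S \<subseteq> residue W E {}" "card S = 3" "t ` S \<subseteq> {k}"
      using extend[of "{}" k] k by auto
    then obtain a b c where "S = {a, b, c}" "a \<noteq> b" by (auto simp: card_3_iff)
    with S show ?thesis by (auto simp: residue_def)
  qed
  obtain a c where ac: "a \<in> W" "c \<in> W" "a \<noteq> c" "t a = i" "t c = i" using two[of i] by blast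
  obtain b d where bd: "b \<in> W" "d \<in> W" "b \<noteq> d" "t b = j" "t d = j" using two[of j] by blast
  show ?thesis
  proof (rule generalized_polygon_flags[where ys = "[a, b, c, d]" and a = a and b = c])
    fix x y assume xy: "x \<in> W" "y \<in> W"
    show "\<exists>xs. is_path xs x y \<and> length xs \<le> 2 + 1"
    proof (cases "t x = t y")
      case False
      then show ?thesis using xy inc by (intro exI[of _ "[x, y]"]) (simp add: is_path_simps adj_flags)
    next
      case True
      obtain z where z: "z \<in> W" "E x z" using neighbour[OF xy(1)] .
      then have "E z y" using True types[OF z(2)] inc xy by auto
      then show ?thesis using xy z by (intro exI[of _ "[x, z, y]"]) (simp add: is_path_simps adj_flags)
    qed
  next
    fix xs assume "is_cycle \<Delta> xs"
    then show "2 * 2 \<le> length xs" using short_cycles[of xs] by fastforce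
  next
    fix xs assume "is_path xs a c"
    then show "2 < length xs" using path_lists[of xs a c] ac types[of a c]
      by (cases "length xs \<le> 4") (auto simp: adj_flags)
  next
    show "is_cycle \<Delta> [a, b, c, d]" using ac bd ij inc by (auto simp: is_cycle_def adj_flags)
  qed (use ac in auto)
qed

text \<open>Opposite vertices of the hexagon are at distance three, since a shorter path would
  close up to a quadrangle.\<close>

theorem projective_plane:
  assumes join: "\<And>x y. x \<in> W \<Longrightarrow> y \<in> W \<Longrightarrow> x \<noteq> y \<Longrightarrow> t x = t y \<Longrightarrow> \<exists>z\<in>W. E x z \<and> E z y"
    and no4: "\<And>a b c d. {a, b, c, d} \<subseteq> W \<Longrightarrow> E a b \<Longrightarrow> E b c \<Longrightarrow> E c d \<Longrightarrow> E d a \<Longrightarrow> a \<noteq> c \<Longrightarrow> b \<noteq> d \<Longrightarrow> False"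
    and cyc: "is_cycle \<Delta> [a, b, c, d, f, g]"
  shows "generalized_polygon 3 {i, j} \<Delta> t"
proof -
  have W: "{a, b, c, d, f, g} \<subseteq> W" "E a b" "E b c" "E c d" "distinct [a, b, c, d]"
    using cyc by (auto simp: is_cycle_def adj_flags)
  have "(t b = i) \<noteq> (t a = i)" "(t c = i) \<noteq> (t b = i)" "(t d = i) \<noteq> (t c = i)"
    by (rule opposite_type; use W in simp)+
  then have tad: "t a \<noteq> t d" by metis
  show ?thesis
  proof (rule generalized_polygon_flags[OF _ _ _ cyc, where a = a and b = d])
    fix x y assume xy: "x \<in> W" "y \<in> W"
    show "\<exists>xs. is_path xs x y \<and> length xs \<le> 3 + 1"
    proof (cases "t x = t y")
      case True
      show ?thesis
      proof (cases "x = y")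
        case False
        then obtain z where "z \<in> W" "E x z" "E z y" using join True xy by blast
        then show ?thesis using xy by (intro exI[of _ "[x, z, y]"]) (simp add: is_path_simps adj_flags)
      qed (auto intro: exI[of _ "[x]"] simp: is_path_simps)
    next
      case False
      obtain w where w: "w \<in> W" "E y w" using neighbour[OF xy(2)] .
      have tw: "t x = t w"
        using False opposite_type[OF w(2) xy(2) w(1)] same_type[OF xy] type_eq_iff[OF xy(1) w(1)] by blast
      show ?thesis
      proof (cases "x = w")
        case True
        then show ?thesis using xy w sym by (intro exI[of _ "[x, y]"]) (simp add: is_path_simps adj_flags)
      next
        case False
        then obtain z where "z \<in> W" "E x z" "E z w" using join[OF xy(1) w(1) False tw] by auto
        then show ?thesis using xy w sym[OF w(2)]
          by (intro exI[of _ "[x, z, w, y]"]) (simp add: is_path_simps adj_flags)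
      qed
    qed
  next
    fix xs assume xs: "is_cycle \<Delta> xs"
    show "2 * 3 \<le> length xs"
    proof (rule ccontr)
      assume "\<not> 2 * 3 \<le> length xs"
      then obtain p q r s where "xs = [p, q, r, s]" using short_cycles[OF xs] by auto
      then show False using xs no4[of p q r s] by (auto simp: is_cycle_def adj_flags)
    qed
  next
    fix xs assume p: "is_path xs a d"
    have "\<not> E a d" using no4[of a b c d] W sym[of a d] by auto
    moreover have "\<not> (E a z \<and> E z d)" if "z \<in> W" for z
    proof
      assume e: "E a z \<and> E z d"
      have "(t z = i) \<noteq> (t a = i)" "(t d = i) \<noteq> (t z = i)"
        by (rule opposite_type; use that e W in simp)+
      moreover have "a \<in> W" "d \<in> W" using W by auto
      ultimately have "t a = t d" using type_eq_iff[of a d] by blast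
      with tad show False ..
    qed
    ultimately show "3 < length xs" using path_lists[OF p] W
      by (cases "length xs \<le> 4") (auto simp: adj_flags)
  qed (use W in auto)
qed

text \<open>Opposite vertices of the octagon are at distance four, since a shorter path would
  close up to a quadrangle or a hexagon.\<close>

theorem generalized_quadrangle:
  assumes proj: "\<And>x y. x \<in> W \<Longrightarrow> y \<in> W \<Longrightarrow> t x \<noteq> t y \<Longrightarrow> \<not> E x y \<Longrightarrow>
        \<exists>y'\<in>W. \<exists>x'\<in>W. E x y' \<and> E y' x' \<and> E x' y"
    and no4: "\<And>a b c d. {a, b, c, d} \<subseteq> W \<Longrightarrow> E a b \<Longrightarrow> E b c \<Longrightarrow> E c d \<Longrightarrow> E d a \<Longrightarrow> a \<noteq> c \<Longrightarrow> b \<noteq> d \<Longrightarrow> False"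
    and no6: "\<And>a b c d f g. {a, b, c, d, f, g} \<subseteq> W \<Longrightarrow> E a b \<Longrightarrow> E b c \<Longrightarrow> E c d \<Longrightarrow> E d f \<Longrightarrow> E f g \<Longrightarrow> E g a \<Longrightarrow>
        distinct [a, b, c, d, f, g] \<Longrightarrow> False"
    and cyc: "is_cycle \<Delta> [a, b, c, d, f, g, h, k]"
  shows "generalized_polygon 4 {i, j} \<Delta> t"
proof -
  have W: "{a, b, c, d, f} \<subseteq> W" "E a b" "E b c" "E c d" "E d f" "distinct [a, b, c, d, f]"
    using cyc by (auto simp: is_cycle_def adj_flags)
  have "(t b = i) \<noteq> (t a = i)" "(t c = i) \<noteq> (t b = i)" "(t d = i) \<noteq> (t c = i)" "(t f = i) \<noteq> (t d = i)"
    by (rule opposite_type; use W in simp)+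
  then have tac: "(t c = i) = (t a = i)" and "(t f = i) = (t a = i)" by blast+
  moreover have "a \<in> W" "f \<in> W" using W by auto
  ultimately have taf: "t a = t f" using type_eq_iff[of a f] by blast
  show ?thesis
  proof (rule generalized_polygon_flags[OF _ _ _ cyc, where a = a and b = f])
    fix x y assume xy: "x \<in> W" "y \<in> W"
    have diff: "\<exists>xs. is_path xs x z \<and> length xs \<le> 4" if z: "z \<in> W" "t x \<noteq> t z" for z
    proof (cases "E x z")
      case True
      then show ?thesis using xy z by (intro exI[of _ "[x, z]"]) (simp add: is_path_simps adj_flags)
    next
      case False
      then obtain u v where "u \<in> W" "v \<in> W" "E x u" "E u v" "E v z" using proj xy z by blast
      then show ?thesis using xy z by (intro exI[of _ "[x, u, v, z]"]) (simp add: is_path_simps adj_flags)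
    qed
    show "\<exists>xs. is_path xs x y \<and> length xs \<le> 4 + 1"
    proof (cases "t x = t y")
      case True
      obtain w where w: "w \<in> W" "E y w" using neighbour[OF xy(2)] .
      then have wy: "E w y" using sym by simp
      have "t x \<noteq> t w" using True types[OF w(2)] by simp
      from diff[OF w(1) this] obtain xs where "is_path xs x w" "length xs \<le> 4" by auto
      then show ?thesis using w wy xy
        by (intro exI[of _ "xs @ [y]"]) (auto simp: is_path_def successively_append_iff adj_flags)
    next
      case False
      from diff[OF xy(2) False] show ?thesis by auto
    qed
  next
    fix xs assume xs: "is_cycle \<Delta> xs"
    show "2 * 4 \<le> length xs"
    proof (rule ccontr)
      assume "\<not> 2 * 4 \<le> length xs"
      then consider p q r s where "xs = [p, q, r, s]" | p q r s u v where "xs = [p, q, r, s, u, v]"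
        using short_cycles[OF xs] by auto
      then show False
      proof cases
        case 1
        then show False using xs no4[of p q r s] by (auto simp: is_cycle_def adj_flags)
      next
        case 2
        then show False using xs no6[of p q r s u v] by (auto simp: is_cycle_def adj_flags)
      qed
    qed
  next
    fix xs assume p: "is_path xs a f"
    have "\<not> E a f" using taf types by blast
    moreover have "\<not> (E a z \<and> E z f)" if z: "z \<in> W" for z
    proof
      assume e: "E a z \<and> E z f"
      have "z \<noteq> a" "z \<noteq> f" using e types by blast+
      have "(t z = i) \<noteq> (t a = i)" by (rule opposite_type; use e z W in simp)
      then have "z \<noteq> c" using tac by blast
      show False
      proof (cases "z = b \<or> z = d")
        case True
        then show False
        proof
          assume "z = b"
          then show False using no4[of b c d f] e W sym[of b f] by simp
        next
          assume "z = d"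
          then show False using no4[of a b c d] e W sym[of a d] by simp
        qed
      next
        case False
        then show False using no6[of a b c d f z] W e sym[of a z] sym[of z f] z \<open>z \<noteq> c\<close> \<open>z \<noteq> a\<close> \<open>z \<noteq> f\<close> by auto
      qed
    qed
    moreover have "\<not> (E a z \<and> E z w \<and> E w f)" if "z \<in> W" "w \<in> W" for z w
    proof
      assume e: "E a z \<and> E z w \<and> E w f"
      have "(t z = i) \<noteq> (t a = i)" "(t w = i) \<noteq> (t z = i)" "(t f = i) \<noteq> (t w = i)"
        by (rule opposite_type; use that e W in simp)+
      with taf show False by metis
    qed
    ultimately show "4 < length xs" using path_lists[OF p] W
      by (cases "length xs \<le> 4") (auto simp: adj_flags)
  qed (use W in auto)
qed

end

context thick_graph begin

text \<open>As all vertices of the types \<open>i\<close> and \<open>j\<close> are incident, any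
  two chambers \<open>c\<close> and \<open>d\<close> are linked by a chamber that shares one of
  its vertices with \<open>c\<close> and another one with \<open>d\<close>; the galleries run
  inside two residues.\<close>

lemma gallery_connected_rank_3:
  assumes I: "card I = 3" and ij: "i \<in> I" "j \<in> I" "i \<noteq> j"
    and all: "\<And>x y. x \<in> W \<Longrightarrow> y \<in> W \<Longrightarrow> t x = i \<Longrightarrow> t y = j \<Longrightarrow> E x y"
    and res: "\<And>x. x \<in> W \<Longrightarrow> t x \<in> {i, j} \<Longrightarrow> gallery_connected 2 (flags (residue W E {x}) E)"
  shows "gallery_connected 3 (flags W E)"
proof -
  let ?ch = "chambers (flags W E)"
  have res_ch: "insert x c \<in> ?ch \<and> x \<notin> c" if "c \<in> chambers (flags (residue W E {x}) E)" "x \<in> W" for x c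
  proof -
    interpret r: thick_graph "residue W E {x}" E t "I - t ` {x}"
      by (rule thick_graph_residue) (simp add: that)
    have c: "c \<in> flags (residue W E {x}) E" "t ` c = I - {t x}"
      using that(1) unfolding r.chambers_flags by auto
    have "c \<in> link (flags W E) {x}" using c(1) that(2) link_flags[of "{x}"] by simp
    then have "insert x c \<in> flags W E" "x \<notin> c" by (auto simp: link_def)
    moreover have "t ` insert x c = I" using c(2) tI[OF that(2)] by auto
    ultimately show ?thesis by (simp add: chambers_flags)
  qed
  have ch_res: "c - {x} \<in> chambers (flags (residue W E {x}) E)" if "c \<in> ?ch" "x \<in> c" "x \<in> W" for x c
  proof -
    interpret r: thick_graph "residue W E {x}" E t "I - t ` {x}"
      by (rule thick_graph_residue) (simp add: that)
    have c: "c \<in> flags W E" "t ` c = I" using that by (auto simp: chambers_flags)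
    have "insert x (c - {x}) = c" using that by auto
    then have "c - {x} \<in> link (flags W E) {x}"
      using c flags_subset[of c W E "c - {x}"] by (auto simp: link_def)
    then have "c - {x} \<in> flags (residue W E {x}) E" using link_flags[of "{x}"] that by simp
    moreover have "t ` (c - {x}) = I - {t x}"
      using inj_on_image_set_diff[OF inj_flags[OF c(1)], of c "{x}"] c(2) that by auto
    ultimately show ?thesis unfolding r.chambers_flags by simp
  qed
  have fin: "finite c" if "c \<in> ?ch" for c using that by (auto simp: chambers_flags dest: flags_finite)
  have share: "(gallery_step 3 (flags W E))\<^sup>*\<^sup>* c d"
    if cd: "c \<in> ?ch" "d \<in> ?ch" "x \<in> c" "x \<in> d" and x: "x \<in> W" "t x \<in> {i, j}" for c d x
  proof -
    have "(gallery_step 2 (flags (residue W E {x}) E))\<^sup>*\<^sup>* (c - {x}) (d - {x})"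
      using res[OF x] ch_res[OF cd(1,3) x(1)] ch_res[OF cd(2,4) x(1)] by (auto simp: gallery_connected_def)
    then have "(gallery_step 3 (flags W E))\<^sup>*\<^sup>* (insert x (c - {x})) (insert x (d - {x}))"
    proof (induction rule: rtranclp_induct)
      case (step y z)
      have yz: "y \<in> chambers (flags (residue W E {x}) E)" "z \<in> chambers (flags (residue W E {x}) E)"
        "2 \<le> card (y \<inter> z) + 1" using step(2) by (auto simp: gallery_step_def)
      have "insert x y \<inter> insert x z = insert x (y \<inter> z)" by auto
      moreover have "finite (y \<inter> z)" using fin[of "insert x y"] res_ch[OF yz(1) x(1)] by auto
      moreover have "x \<notin> y \<inter> z" using res_ch[OF yz(1) x(1)] by auto
      ultimately have "gallery_step 3 (flags W E) (insert x y) (insert x z)"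
        using yz res_ch[OF yz(1) x(1)] res_ch[OF yz(2) x(1)] by (simp add: gallery_step_def)
      with step(3) show ?case by simp
    qed simp
    moreover have "insert x (c - {x}) = c" "insert x (d - {x}) = d" using cd by auto
    ultimately show ?thesis by simp
  qed
  show ?thesis
    unfolding gallery_connected_def
  proof (intro ballI)
    fix c d assume cd: "c \<in> ?ch" "d \<in> ?ch"
    then have "i \<in> t ` c" "j \<in> t ` d" "c \<subseteq> W" "d \<subseteq> W"
      using ij by (auto simp: chambers_flags dest!: flags_carrier)
    then obtain x y where x: "x \<in> c" "t x = i" "x \<in> W" and y: "y \<in> d" "t y = j" "y \<in> W" by auto
    have "x \<noteq> y" using x y ij by auto
    then have "{x, y} \<in> flags W E" using pair_flags x y all by simp
    from extend_full[OF this] obtain m where m: "m \<in> flags W E" "{x, y} \<subseteq> m" "t ` m = I" by blast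
    then have mc: "m \<in> ?ch" by (simp add: chambers_flags)
    have "(gallery_step 3 (flags W E))\<^sup>*\<^sup>* c m" using share[OF cd(1) mc, of x] x m by auto
    also have "(gallery_step 3 (flags W E))\<^sup>*\<^sup>* m d" using share[OF mc cd(2), of y] y m by auto
    finally show "(gallery_step 3 (flags W E))\<^sup>*\<^sup>* c d" .
  qed
qed

end

section \<open>More on unit vectors\<close>

abbreviation unit :: "complex^3 \<Rightarrow> bool" where "unit x \<equiv> herm x x = 1"

lemma SU_eq_1:
  assumes "Z \<in> SU" "Z *v e 1 = e 1" "Z *v e 2 = e 2" shows "Z = mat 1"
proof -
  have "Z \<in> Sg 1" using assms by (simp add: Sg_def)
  then obtain a b where Z: "Z = b1 a b" "a * cnj a + b * cnj b = 1" by (rule Sg1_form)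
  have "a = 1 \<and> b = 0" using assms(3) by (simp add: Z b1_def mat3_simps)
  then show ?thesis by (simp add: Z b1_def mat3_simps)
qed

text \<open>In a frame that starts with \<open>w\<close> and \<open>x\<close>, the vector
  \<open>d\<close> has a nonzero third coordinate, which forces the third coordinate of
  \<open>x'\<close> to vanish.\<close>

lemma perp_perp_proportional:
  assumes w: "unit w" and d: "\<And>c. d \<noteq> c *s w"
    and x: "unit x" "herm x w = 0" "herm x d = 0" and x': "herm x' w = 0" "herm x' d = 0"
  obtains c where "x' = c *s x"
proof -
  have "herm w x = 0" using x(2) by (simp add: herm_zero_commute)
  then obtain X where X: "X \<in> SU" "X *v e 1 = w" "X *v e 2 = x" using SU_frame w x(1) by metis
  define y f where "y = ct X *v x'" and "f = ct X *v d"
  have xd: "x' = X *v y" "d = X *v f" using X by (simp_all add: y_def f_def)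
  have "herm y (e 1) = 0" using x'(1) X by (metis SU_herm xd(1))
  then have y: "y = vector [0, y$2, y$3]" using vector3_eta[of y] by (simp add: herm_e_right)
  have "herm (e 2) f = 0" using x(3) X by (metis SU_herm xd(2))
  then have "f $ 2 = 0" using herm_zero_commute[of "e 2" f] by (simp add: herm_e_right)
  then have f: "f = vector [f$1, 0, f$3]" using vector3_eta[of f] by simp
  have f3: "f $ 3 \<noteq> 0"
  proof
    assume "f $ 3 = 0"
    then have "f = f$1 *s e 1" by (subst f) (simp add: mat3_simps)
    then have "d = f$1 *s w" using X by (metis mv_scale xd(2))
    with d show False by blast
  qed
  have "herm y f = 0" using x'(2) X xd by simp
  moreover have "herm y f = y$3 * cnj (f$3)" by (subst y, subst f) (simp add: herm_3 vector_3)
  ultimately have "y$3 = 0" using f3 by simp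
  then have "y = y$2 *s e 2" by (subst y) (simp add: mat3_simps)
  then have "x' = y$2 *s x" using X by (metis mv_scale xd(1))
  then show ?thesis by (rule that)
qed

lemma gram_schmidt:
  assumes v: "unit v" and v': "\<And>c. v' \<noteq> c *s v"
  obtains y r where "unit y" "herm v y = 0" "v' = herm v' v *s v + complex_of_real r *s y"
    "r \<noteq> 0" "complex_of_real (r\<^sup>2) = herm v' v' - herm v' v * cnj (herm v' v)"
proof -
  define d where "d = v' - herm v' v *s v"
  have d0: "d \<noteq> 0" using v' by (auto simp: d_def)
  have dv: "herm d v = 0" by (simp add: d_def herm_diff herm_scale v)
  have dd: "of_real ((norm d)\<^sup>2) = herm v' v' - herm v' v * cnj (herm v' v)"
  proof -
    have "herm d d = herm d v'"
      using dv by (subst (2) d_def) (simp add: herm_diff herm_scale)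
    also have "\<dots> = herm v' v' - herm v' v * cnj (herm v' v)"
      by (simp add: d_def herm_diff herm_scale herm_commute[of v v'])
    finally show ?thesis by (simp add: herm_self)
  qed
  let ?y = "complex_of_real (inverse (norm d)) *s d"
  have "unit ?y"
    using d0 by (subst herm_scale(1), subst herm_scale(2), subst herm_self) (simp add: power2_eq_square field_simps)
  moreover have "herm v ?y = 0" using dv by (simp add: herm_scale herm_zero_commute[of v])
  moreover have "v' = herm v' v *s v + complex_of_real (norm d) *s ?y"
    using d0 by (simp add: vector_smult_assoc) (simp add: d_def)
  ultimately show ?thesis using that dd d0 by (metis norm_eq_zero)
qed

lemma herm_minus [simp]: "herm (- x) y = - herm x y" "herm x (- y) = - herm x y"
  by (simp_all add: herm_def sum_negf)

text \<open>The Witt extension property: Gram and Schmidt turn the two pairs into orthonormal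
  ones with the same coefficients.\<close>

lemma isometry_extends:
  assumes v: "unit v" "unit v'" "\<And>c. v' \<noteq> c *s v" and u: "unit u" "unit u'"
    and eq: "herm u' u = herm v' v"
  obtains N where "N \<in> SU" "N *v v = u" "N *v v' = u'"
proof -
  obtain y r where y: "unit y" "herm v y = 0" "v' = herm v' v *s v + complex_of_real r *s y"
    "r \<noteq> 0" "complex_of_real (r\<^sup>2) = herm v' v' - herm v' v * cnj (herm v' v)"
    using gram_schmidt[OF v(1,3)] by blast
  have u'u: "u' \<noteq> c *s u" for c
  proof
    assume a: "u' = c *s u"
    then have "c = herm v' v" using eq u by (simp add: herm_scale)
    then have "herm v' v * cnj (herm v' v) = 1" using u a by (simp add: herm_scale mult.commute)
    then show False using y(4,5) v by simp
  qed
  obtain z s where z: "unit z" "herm u z = 0" "u' = herm u' u *s u + complex_of_real s *s z"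
    "s \<noteq> 0" "complex_of_real (s\<^sup>2) = herm u' u' - herm u' u * cnj (herm u' u)"
    using gram_schmidt[OF u(1) u'u] by blast
  have "complex_of_real (s\<^sup>2) = complex_of_real (r\<^sup>2)" using z(5) y(5) eq v u by simp
  then have "s\<^sup>2 = r\<^sup>2" by (simp only: of_real_eq_iff)
  then have "s = r \<or> s = - r" by (simp add: power2_eq_iff)
  then obtain z' where z': "unit z'" "herm u z' = 0" "u' = herm u' u *s u + complex_of_real r *s z'"
  proof
    assume "s = - r"
    then show ?thesis using z by (intro that[of "- 1 *s z"]) (simp_all add: herm_scale vector_smult_assoc)
  qed (use z that in blast)
  obtain X where X: "X \<in> SU" "X *v e 1 = v" "X *v e 2 = y" using SU_frame v(1) y by metis
  obtain Y where Y: "Y \<in> SU" "Y *v e 1 = u" "Y *v e 2 = z'" using SU_frame u(1) z' by metis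
  have N: "(Y ** ct X) *v v = u" "(Y ** ct X) *v y = z'"
    using X Y by (metis SU_ct_simps(8) mv_assoc)+
  have "(Y ** ct X) *v v' = u'"
    using z'(3)[unfolded eq] by (subst y(3)) (simp add: matrix_vector_right_distrib mv_scale N)
  then show ?thesis using N X Y by (intro that[of "Y ** ct X"]) auto
qed

lemma isometry_unique:
  assumes v: "unit v" "unit v'" "\<And>c. v' \<noteq> c *s v" and N: "N \<in> SU" "M \<in> SU"
    and eq: "N *v v = M *v v" "N *v v' = M *v v'"
  shows "N = M"
proof -
  obtain y r where y: "unit y" "herm v y = 0" "v' = herm v' v *s v + complex_of_real r *s y" "r \<noteq> 0"
    using gram_schmidt[OF v(1,3)] by blast
  obtain X where X: "X \<in> SU" "X *v e 1 = v" "X *v e 2 = y" using SU_frame v(1) y by metis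
  have "N *v (complex_of_real r *s y) = M *v (complex_of_real r *s y)"
  proof -
    have "complex_of_real r *s y = v' - herm v' v *s v" using y(3) by (metis add_diff_cancel_left')
    then show ?thesis using eq by (simp add: matrix_vector_mult_diff_distrib mv_scale)
  qed
  then have "complex_of_real (inverse r) *s (complex_of_real r *s (N *v y)) =
      complex_of_real (inverse r) *s (complex_of_real r *s (M *v y))" by (simp add: mv_scale)
  then have y': "N *v y = M *v y" using y(4) by (simp add: vector_smult_assoc)
  have P: "M ** X \<in> SU" using N X by simp
  have e12: "(N ** X) *v e 1 = (M ** X) *v e 1" "(N ** X) *v e 2 = (M ** X) *v e 2"
    using eq(1) y' by (simp_all only: mv_assoc X(2,3))
  have "ct (M ** X) ** (N ** X) = mat 1"
  proof (rule SU_eq_1)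
    show "(ct (M ** X) ** (N ** X)) *v e 1 = e 1" "(ct (M ** X) ** (N ** X)) *v e 2 = e 2"
      by (simp_all only: mv_assoc[of "ct (M ** X)"] e12 SU_ct_simps(8)[OF P])
  qed (use N X P in auto)
  then have "(M ** X) ** (ct (M ** X) ** (N ** X)) = M ** X" by simp
  then have "N ** X = M ** X" using N X by (metis SU_ct_simps(3) mult_SU)
  then show ?thesis using X by (metis SU_ct_simps(5))
qed

text \<open>The matrix \<open>u v\<^sup>*\<close> of rank one.\<close>

definition outer :: "complex^3 \<Rightarrow> complex^3 \<Rightarrow> complex^3^3" where
  "outer u v = (\<chi> i j. u $ i * cnj (v $ j))"

lemma outer_mv: "outer u v *v x = herm x v *s u"
  by (simp add: vec_eq_iff outer_def matrix_vector_mult_def herm_def sum_distrib_left sum_distrib_right mult_ac)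

lemma outer_scale: "outer (c *s u) (d *s v) = (\<chi> i j. c * cnj d * outer u v $ i $ j)"
  by (simp add: vec_eq_iff outer_def mult_ac)

lemma mult_outer: "A ** outer u v = outer (A *v u) v"
  by (simp add: vec_eq_iff outer_def matrix_matrix_mult_def matrix_vector_mult_def sum_distrib_left sum_distrib_right mult_ac)

lemma outer_mult: "outer u v ** B = outer u (ct B *v v)"
  by (simp add: vec_eq_iff outer_def matrix_matrix_mult_def matrix_vector_mult_def sum_distrib_left mult_ac)

lemma ct_outer: "ct (outer u v) = outer v u"
  by (simp add: vec_eq_iff outer_def mult_ac)

lemma outer_eq_D:
  assumes "outer u v = outer u' v'" "unit u" "unit v" "unit u'" "unit v'"
  shows "\<exists>c. cnj c * c = 1 \<and> u = c *s u' \<and> v = c *s v'"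
proof -
  have u: "u = herm v v' *s u'" using arg_cong[OF assms(1), of "\<lambda>A. A *v v", unfolded outer_mv] assms(2-) by (simp add: vector_smult_lid)
  have v: "v = herm u u' *s v'"
    using arg_cong[OF assms(1), of "\<lambda>A. ct A *v u", unfolded ct_outer outer_mv] assms(2-)
    by (simp add: vector_smult_lid)
  have "herm u u' = herm v v'" using arg_cong[OF u, of "\<lambda>x. herm x u'"] assms by (simp add: herm_scale)
  moreover have "cnj (herm v v') * herm v v' = 1" using arg_cong[OF u, of "\<lambda>x. herm x x"] assms
    by (simp add: herm_scale mult.commute)
  ultimately show ?thesis using u v by metis
qed

lemma outer_phase: "cnj c * c = 1 \<Longrightarrow> outer (c *s u) (c *s v) = outer u v"
  by (simp add: outer_scale mult.commute vec_eq_iff)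

lemma unit_proportional: "unit x \<Longrightarrow> unit y \<Longrightarrow> y = c *s x \<Longrightarrow> cnj c * c = 1"
  by (simp add: herm_scale mult.commute)

section \<open>The flat geometry of SU(3)\<close>

text \<open>Vertices are coded as sets of sets of pairs of matrices so that all three kinds of
  vertices live in one type and the action becomes linear in both components.\<close>

definition plane :: "complex^3^3 \<Rightarrow> mat_pair set set" where "plane M = {{(M, 0)}}"
definition line :: "complex^3 \<Rightarrow> complex^3 \<Rightarrow> mat_pair set set" where "line u v = {{(outer u v, 0)}}"
definition point :: "complex^3 \<Rightarrow> mat_pair set set" where "point w = {{(0, outer w w)}}"

definition vertices :: "mat_pair set set set" where
  "vertices = plane ` SU \<union> {line u v | u v. unit u \<and> unit v} \<union> {point w | w. unit w}"

inductive inc0 :: "mat_pair set set \<Rightarrow> mat_pair set set \<Rightarrow> bool" where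
  plane_line: "M \<in> SU \<Longrightarrow> unit v \<Longrightarrow> inc0 (plane M) (line (M *v v) v)"
| line_point: "unit u \<Longrightarrow> unit v \<Longrightarrow> unit w \<Longrightarrow> herm v w = 0 \<Longrightarrow> inc0 (line u v) (point w)"
| plane_point: "M \<in> SU \<Longrightarrow> unit w \<Longrightarrow> inc0 (plane M) (point w)"

definition inc :: "mat_pair set set \<Rightarrow> mat_pair set set \<Rightarrow> bool" where
  "inc x y \<longleftrightarrow> inc0 x y \<or> inc0 y x"

definition vtype :: "mat_pair set set \<Rightarrow> pdq" where
  "vtype x = (if x \<in> plane ` SU then Tp else if \<exists>w. x = point w then Tq else Td)"

lemma plane_eq_iff [simp]: "plane M = plane N \<longleftrightarrow> M = N"
  by (simp add: plane_def)

lemma line_eq_iff: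
  assumes "unit u" "unit v" "unit u'" "unit v'"
  shows "line u v = line u' v' \<longleftrightarrow> (\<exists>c. cnj c * c = 1 \<and> u = c *s u' \<and> v = c *s v')"
  using outer_eq_D[OF _ assms] outer_phase by (auto simp: line_def)

lemma point_eq_iff:
  assumes "unit w" "unit w'" shows "point w = point w' \<longleftrightarrow> (\<exists>c. w = c *s w')"
  using outer_eq_D[OF _ assms(1,1) assms(2,2)] outer_phase unit_proportional[OF assms(2,1)]
  by (auto simp: point_def)

lemma outer_nonzero: "unit u \<Longrightarrow> unit v \<Longrightarrow> outer u v \<noteq> 0"
  using outer_mv[of u v v] by auto

lemma SU_nonzero: "M \<in> SU \<Longrightarrow> M \<noteq> 0"
  using SU_herm[of M "e 1" "e 1"] by (auto simp del: SU_herm)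

lemma plane_neq_line [simp]: "M \<in> SU \<Longrightarrow> unit u \<Longrightarrow> unit v \<Longrightarrow> plane M \<noteq> line u v"
proof
  assume M: "M \<in> SU" and "plane M = line u v"
  then have Mo: "M = outer u v" by (simp add: plane_def line_def)
  obtain x where x: "unit x" "herm x v = 0" by (rule unit_perp_exists)
  have "herm (M *v x) (M *v x) = 1" using M x by simp
  then show False using x by (simp add: Mo outer_mv)
qed

lemma plane_neq_point [simp]: "M \<in> SU \<Longrightarrow> plane M \<noteq> point w"
  by (simp add: plane_def point_def SU_nonzero)

lemma line_neq_point [simp]: "unit u \<Longrightarrow> unit v \<Longrightarrow> line u v \<noteq> point w"
  by (simp add: line_def point_def outer_nonzero)

lemma vtype_simps [simp]: "M \<in> SU \<Longrightarrow> vtype (plane M) = Tp" "unit u \<Longrightarrow> unit v \<Longrightarrow> vtype (line u v) = Td"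
  "vtype (point w) = Tq"
proof -
  show "vtype (plane M) = Tp" if "M \<in> SU" using that by (simp add: vtype_def)
  show "vtype (line u v) = Td" if "unit u" "unit v"
    using plane_neq_line[OF _ that] line_neq_point[OF that] unfolding vtype_def by (metis imageE)
  show "vtype (point w) = Tq"
    using plane_neq_point unfolding vtype_def by (metis imageE)
qed

lemma vertices_simps [simp]: "M \<in> SU \<Longrightarrow> plane M \<in> vertices" "unit u \<Longrightarrow> unit v \<Longrightarrow> line u v \<in> vertices"
  "unit w \<Longrightarrow> point w \<in> vertices"
  by (auto simp: vertices_def)

lemma vertices_cases:
  assumes "x \<in> vertices"
  obtains M where "M \<in> SU" "x = plane M" | u v where "unit u" "unit v" "x = line u v" | w where "unit w" "x = point w"
  using assms by (auto simp: vertices_def)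

lemma vertices_of_type:
  assumes "x \<in> vertices"
  shows "vtype x = Tp \<Longrightarrow> \<exists>M. M \<in> SU \<and> x = plane M" "vtype x = Td \<Longrightarrow> \<exists>u v. unit u \<and> unit v \<and> x = line u v"
    "vtype x = Tq \<Longrightarrow> \<exists>w. unit w \<and> x = point w"
  using assms by (cases rule: vertices_cases; auto)+

lemma inc_sym: "inc x y \<Longrightarrow> inc y x"
  by (auto simp: inc_def)

lemma inc0_types: "inc0 x y \<Longrightarrow> (vtype x, vtype y) \<in> {(Tp, Td), (Td, Tq), (Tp, Tq)}"
  by (induction rule: inc0.induct) auto

lemma inc_types: "inc x y \<Longrightarrow> vtype x \<noteq> vtype y"
  using inc0_types[of x y] inc0_types[of y x] by (auto simp: inc_def)

lemma inc0_plane_line: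
  assumes "M \<in> SU" "unit u" "unit v" shows "inc0 (plane M) (line u v) \<longleftrightarrow> M *v v = u"
proof
  assume "inc0 (plane M) (line u v)"
  then show "M *v v = u"
  proof (cases rule: inc0.cases)
    case (plane_line N v')
    then have "line u v = line (M *v v') v'" by simp
    then obtain c where "u = c *s (M *v v')" "v = c *s v'"
      using assms plane_line by (auto simp: line_eq_iff)
    then show ?thesis by (simp add: mv_scale)
  qed (use assms in auto)
next
  assume "M *v v = u"
  then show "inc0 (plane M) (line u v)" using assms inc0.plane_line[of M v] by simp
qed

lemma inc0_line_point:
  assumes "unit u" "unit v" "unit w" shows "inc0 (line u v) (point w) \<longleftrightarrow> herm v w = 0"
proof
  assume "inc0 (line u v) (point w)"
  then show "herm v w = 0"
  proof (cases rule: inc0.cases)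
    case (line_point u' v' w')
    then obtain c d where "v = c *s v'" "w = d *s w'" using assms by (auto simp: line_eq_iff point_eq_iff)
    then show ?thesis using line_point by (simp add: herm_scale)
  qed (use assms plane_neq_line in \<open>metis+\<close>)
qed (use assms in \<open>auto intro: inc0.intros\<close>)

lemma inc_simps [simp]:
  assumes "M \<in> SU" "unit u" "unit v" "unit w"
  shows "inc (plane M) (line u v) \<longleftrightarrow> M *v v = u" "inc (line u v) (plane M) \<longleftrightarrow> M *v v = u"
    "inc (line u v) (point w) \<longleftrightarrow> herm v w = 0" "inc (point w) (line u v) \<longleftrightarrow> herm v w = 0"
    "inc (plane M) (point w)" "inc (point w) (plane M)"
  using inc0_plane_line[of M u v] inc0_line_point[of u v w] assms inc0_types[of "line u v" "plane M"] inc0_types[of "point w" "line u v"]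
  by (auto simp: inc_def intro: inc0.intros)

text \<open>An orthonormal basis of the orthogonal complement of \<open>w\<close> together with
  a combination of its two vectors with coefficients 3/5 and 4/5.\<close>

lemma three_points:
  assumes w: "unit w"
  obtains a b c where "unit a" "unit b" "unit c" "herm a w = 0" "herm b w = 0" "herm c w = 0"
    "distinct [point a, point b, point c]"
proof -
  obtain a where a: "unit a" "herm a w = 0" by (rule unit_perp_exists)
  obtain b where b: "unit b" "herm b w = 0" "herm b a = 0" by (rule unit_perp_exists)
  define c where "c = (3/5) *s a + (4/5) *s b"
  have ab: "herm a b = 0" using b by (simp add: herm_zero_commute)
  have c: "unit c" "herm c w = 0" "herm c a = 3/5" "herm c b = 4/5"
    using a b ab by (simp_all add: c_def herm_add herm_scale)
  have ne: "point x \<noteq> point y" if q: "unit x" "unit y" "cnj (herm x y) * herm x y \<noteq> 1" for x y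
  proof
    assume "point x = point y"
    then obtain k where "x = k *s y" using point_eq_iff[OF q(1,2)] by auto
    then show False using q by (simp add: herm_scale mult.commute)
  qed
  have "cnj (herm b a) * herm b a \<noteq> 1" "cnj (herm c a) * herm c a \<noteq> 1" "cnj (herm c b) * herm c b \<noteq> 1"
    unfolding c(3,4) b(3) by simp_all
  then have "point b \<noteq> point a" "point c \<noteq> point a" "point c \<noteq> point b" using ne a(1) b(1) c(1) by blast+
  then show ?thesis using a b c that[of a b c] by auto
qed

lemma three_planes:
  assumes "unit u" "unit v"
  obtains L M N where "L \<in> SU" "M \<in> SU" "N \<in> SU" "L *v v = u" "M *v v = u" "N *v v = u" "distinct [L, M, N]"
proof -
  obtain X Y where X: "X \<in> SU" "X *v e 1 = v" and Y: "Y \<in> SU" "Y *v e 1 = u"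
    using assms SU_frame unit_perp_exists herm_zero_commute by metis
  define F where "F a = Y ** b1 a 0 ** ct X" for a
  have F: "F a \<in> SU" "F a *v v = u" if "a * cnj a = 1" for a
  proof -
    have b: "b1 a 0 \<in> Sg 1" using b1_Sg[of a 0] that by simp
    then have "b1 a 0 \<in> SU" "b1 a 0 *v e 1 = e 1" by (auto simp: Sg_def)
    moreover have "ct X *v v = e 1" using X by (metis SU_ct_simps(8))
    ultimately show "F a \<in> SU" "F a *v v = u" using X Y by (simp_all add: F_def mv_assoc)
  qed
  have inj: "a = b" if "F a = F b" for a b
  proof -
    have "ct Y ** F a ** X = ct Y ** F b ** X" using that by simp
    then have "b1 a 0 = b1 b 0" using X Y by (simp add: F_def flip: matrix_mul_assoc)
    then show ?thesis by (simp add: b1_def mat3_simps)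
  qed
  have "F 1 \<noteq> F (-1)" "F 1 \<noteq> F \<i>" "F (-1) \<noteq> F \<i>" using inj by (force simp: complex_eq_iff)+
  then show ?thesis using F that[of "F 1" "F (-1)" "F \<i>"] by simp
qed

text \<open>A flag is contained in a triple of one plane, one line and one point; vertices that
  are absent from the flag are chosen arbitrarily.\<close>

lemma flag_of_type:
  assumes a: "\<alpha> \<in> flags vertices inc"
  shows "\<exists>M\<in>SU. \<forall>x\<in>\<alpha>. vtype x = Tp \<longrightarrow> x = plane M"
    "\<exists>u v. unit u \<and> unit v \<and> (\<forall>x\<in>\<alpha>. vtype x = Td \<longrightarrow> x = line u v)"
    "\<exists>w. unit w \<and> (\<forall>x\<in>\<alpha>. vtype x = Tq \<longrightarrow> x = point w)"
proof -
  have uniq: "x = y" if "x \<in> \<alpha>" "y \<in> \<alpha>" "vtype x = vtype y" for x y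
    using a that inc_types[of x y] by (auto simp: flags_def)
  have V: "x \<in> vertices" if "x \<in> \<alpha>" for x using a that by (auto simp: flags_def)
  have un: "unit (e 1)" by simp
  show "\<exists>M\<in>SU. \<forall>x\<in>\<alpha>. vtype x = Tp \<longrightarrow> x = plane M"
  proof (cases "\<exists>x\<in>\<alpha>. vtype x = Tp")
    case True
    then obtain x where x: "x \<in> \<alpha>" "vtype x = Tp" by blast
    then obtain M where "M \<in> SU" "x = plane M" using vertices_of_type[OF V[OF x(1)]] x(2) by auto
    then show ?thesis using uniq[OF _ x(1)] x(2) by auto
  qed (use one_SU in blast)
  show "\<exists>u v. unit u \<and> unit v \<and> (\<forall>x\<in>\<alpha>. vtype x = Td \<longrightarrow> x = line u v)"
  proof (cases "\<exists>x\<in>\<alpha>. vtype x = Td")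
    case True
    then obtain x where x: "x \<in> \<alpha>" "vtype x = Td" by blast
    then obtain u v where "unit u" "unit v" "x = line u v" using vertices_of_type[OF V[OF x(1)]] x(2) by auto
    then show ?thesis using uniq[OF _ x(1)] x(2) by auto
  qed (use un in blast)
  show "\<exists>w. unit w \<and> (\<forall>x\<in>\<alpha>. vtype x = Tq \<longrightarrow> x = point w)"
  proof (cases "\<exists>x\<in>\<alpha>. vtype x = Tq")
    case True
    then obtain x where x: "x \<in> \<alpha>" "vtype x = Tq" by blast
    then obtain w where "unit w" "x = point w" using vertices_of_type[OF V[OF x(1)]] x(2) by auto
    then show ?thesis using uniq[OF _ x(1)] x(2) by auto
  qed (use un in blast)
qed

lemma pdq_UNIV: "UNIV = {Tp, Td, Tq}"
  using pdq.exhaust by auto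

lemma insert3: "x \<in> S \<Longrightarrow> y \<in> S \<Longrightarrow> z \<in> S \<Longrightarrow> {x, y, z} \<subseteq> S" for x y z
  by simp

interpretation model: thick_graph vertices inc vtype UNIV
proof
  show "finite (UNIV :: pdq set)" by (simp add: pdq_UNIV)
  show "inc y x" if "inc x y" for x y using that by (rule inc_sym)
  show "vtype x \<noteq> vtype y" if "inc x y" for x y using that by (rule inc_types)
  fix \<alpha> i assume a: "\<alpha> \<in> flags vertices inc" and i: "i \<notin> vtype ` \<alpha>"
  obtain M where M: "M \<in> SU" "\<And>x. x \<in> \<alpha> \<Longrightarrow> vtype x = Tp \<Longrightarrow> x = plane M"
    using flag_of_type(1)[OF a] by auto
  obtain u v where uv: "unit u" "unit v" "\<And>x. x \<in> \<alpha> \<Longrightarrow> vtype x = Td \<Longrightarrow> x = line u v"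
    using flag_of_type(2)[OF a] by auto
  obtain w where w: "unit w" "\<And>x. x \<in> \<alpha> \<Longrightarrow> vtype x = Tq \<Longrightarrow> x = point w"
    using flag_of_type(3)[OF a] by auto
  have t: "vtype x \<noteq> i" if "x \<in> \<alpha>" for x using i that by auto
  show "\<exists>S\<subseteq>residue vertices inc \<alpha>. card S = 3 \<and> vtype ` S \<subseteq> {i}"
  proof (cases i)
    case Tp
    have cases: "x = line u v \<or> x = point w" if "x \<in> \<alpha>" for x
      using t[OF that] uv(3)[OF that] w(2)[OF that] Tp by (cases "vtype x") auto
    obtain X Y Z where XYZ: "X \<in> SU" "Y \<in> SU" "Z \<in> SU" "X *v v = u" "Y *v v = u" "Z *v v = u" "distinct [X, Y, Z]"
      by (rule three_planes[OF uv(1,2)])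
    have "plane L \<in> residue vertices inc \<alpha>" if "L \<in> SU" "L *v v = u" for L
      using that uv w inc_simps[OF that(1) uv(1,2) w(1)] by (auto simp: residue_def dest: cases)
    then show ?thesis using XYZ Tp by (intro exI[of _ "{plane X, plane Y, plane Z}"] conjI insert3) auto
  next
    case Td
    have cases: "x = plane M \<or> x = point w" if "x \<in> \<alpha>" for x
      using t[OF that] M(2)[OF that] w(2)[OF that] Td by (cases "vtype x") auto
    obtain a b c where abc: "unit a" "unit b" "unit c" "herm a w = 0" "herm b w = 0" "herm c w = 0"
      "distinct [point a, point b, point c]" by (rule three_points[OF w(1)])
    have ne: "line (M *v a) a \<noteq> line (M *v b) b" if "unit a" "unit b" "point a \<noteq> point b" for a b
      using that M(1) by (auto simp: line_eq_iff point_eq_iff)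
    have "line (M *v a) a \<in> residue vertices inc \<alpha>" if "unit a" "herm a w = 0" for a
      using that M w inc_simps[OF M(1) _ that(1) w(1), of "M *v a"] by (auto simp: residue_def dest: cases)
    then show ?thesis using abc Td M(1) ne[of a b] ne[of a c] ne[of b c]
      by (intro exI[of _ "{line (M *v a) a, line (M *v b) b, line (M *v c) c}"] conjI insert3) auto
  next
    case Tq
    have cases: "x = plane M \<or> x = line u v" if "x \<in> \<alpha>" for x
      using t[OF that] M(2)[OF that] uv(3)[OF that] Tq by (cases "vtype x") auto
    obtain a b c where abc: "unit a" "unit b" "unit c" "herm a v = 0" "herm b v = 0" "herm c v = 0"
      "distinct [point a, point b, point c]" by (rule three_points[OF uv(2)])
    have "point a \<in> residue vertices inc \<alpha>" if "unit a" "herm a v = 0" for a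
      using that M uv inc_simps[OF M(1) uv(1,2) that(1)] herm_zero_commute[of v a]
      by (auto simp: residue_def dest: cases)
    then show ?thesis using abc Tq by (intro exI[of _ "{point a, point b, point c}"] conjI insert3) auto
  qed
qed simp

subsection \<open>Residues\<close>

lemma residue_plane:
  assumes M: "M \<in> SU"
  shows "residue vertices inc {plane M} = {line (M *v v) v | v. unit v} \<union> {point w | w. unit w}"
proof (intro equalityI subsetI)
  fix x assume x: "x \<in> residue vertices inc {plane M}"
  then have xV: "x \<in> vertices" and i: "inc (plane M) x" by (auto simp: residue_def)
  from xV show "x \<in> {line (M *v v) v | v. unit v} \<union> {point w | w. unit w}"
  proof (cases rule: vertices_cases)
    case (1 N) then show ?thesis using inc_types[OF i] M by simp
  next
    case (2 u v) then show ?thesis using inc_simps(1)[OF M 2(1,2,2)] i by auto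
  qed auto
next
  fix x assume "x \<in> {line (M *v v) v | v. unit v} \<union> {point w | w. unit w}"
  then show "x \<in> residue vertices inc {plane M}"
    using M by (auto simp: residue_def)
qed

lemma residue_line:
  assumes uv: "unit u" "unit v"
  shows "residue vertices inc {line u v} = {plane M | M. M \<in> SU \<and> M *v v = u} \<union> {point w | w. unit w \<and> herm v w = 0}"
proof (intro equalityI subsetI)
  fix x assume x: "x \<in> residue vertices inc {line u v}"
  then have xV: "x \<in> vertices" and i: "inc (line u v) x" by (auto simp: residue_def)
  from xV show "x \<in> {plane M | M. M \<in> SU \<and> M *v v = u} \<union> {point w | w. unit w \<and> herm v w = 0}"
  proof (cases rule: vertices_cases)
    case (1 N) then show ?thesis using inc_simps(2)[OF 1(1) uv uv(2)] i by auto
  next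
    case (2 u v) then show ?thesis using inc_types[OF i] uv by simp
  next
    case (3 w) then show ?thesis using inc_simps(3)[OF one_SU uv 3(1)] i by auto
  qed
next
  fix x assume "x \<in> {plane M | M. M \<in> SU \<and> M *v v = u} \<union> {point w | w. unit w \<and> herm v w = 0}"
  then show "x \<in> residue vertices inc {line u v}"
    using uv inc_simps(2)[OF _ uv uv(2)] inc_simps(3)[OF one_SU uv] by (auto simp: residue_def)
qed

lemma residue_point:
  assumes w: "unit w"
  shows "residue vertices inc {point w} = plane ` SU \<union> {line u v | u v. unit u \<and> unit v \<and> herm v w = 0}"
proof (intro equalityI subsetI)
  fix x assume x: "x \<in> residue vertices inc {point w}"
  then have xV: "x \<in> vertices" and i: "inc (point w) x" by (auto simp: residue_def)
  from xV show "x \<in> plane ` SU \<union> {line u v | u v. unit u \<and> unit v \<and> herm v w = 0}"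
  proof (cases rule: vertices_cases)
    case (2 u v) then show ?thesis using inc_simps(4)[OF one_SU 2(1,2) w] i by auto
  next
    case (3 w') then show ?thesis using inc_types[OF i] by simp
  qed auto
next
  fix x assume "x \<in> plane ` SU \<union> {line u v | u v. unit u \<and> unit v \<and> herm v w = 0}"
  then show "x \<in> residue vertices inc {point w}"
    using w inc_simps(4)[OF one_SU _ _ w] by (auto simp: residue_def)
qed

lemma thick_bipartite_residue:
  assumes "x \<in> vertices" "UNIV - {vtype x} = {i, j}" "i \<noteq> j"
  shows "thick_bipartite (residue vertices inc {x}) inc vtype i j"
proof -
  have "thick_graph (residue vertices inc {x}) inc vtype (UNIV - vtype ` {x})"
    by (rule model.thick_graph_residue) (simp add: assms)
  then show ?thesis using assms by (simp add: thick_bipartite_def thick_bipartite_axioms_def)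
qed

lemma lines_through_two_points:
  assumes "unit v" "unit v'" "unit w" "unit w'" "herm v w = 0" "herm v w' = 0" "herm v' w = 0" "herm v' w' = 0"
    "point w \<noteq> point w'"
  obtains c where "v' = c *s v" "cnj c * c = 1"
proof -
  have "w' \<noteq> c *s w" for c using assms point_eq_iff[of w' w] by auto
  then obtain c where "v' = c *s v" using perp_perp_proportional assms by metis
  then show ?thesis using that unit_proportional assms by metis
qed

text \<open>Lines and points in a plane are the rays of \<open>\<complex>\<^sup>3\<close>, with
  orthogonality as incidence.\<close>

theorem residue_of_plane:
  assumes M: "M \<in> SU" and ij: "{i, j} = {Td, Tq}" "i \<noteq> j"
  shows "generalized_polygon 3 {i, j} (flags (residue vertices inc {plane M}) inc) vtype"
proof -
  let ?W = "residue vertices inc {plane M}"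
  interpret r: thick_bipartite ?W inc vtype i j
    by (rule thick_bipartite_residue) (use M ij in \<open>auto simp: pdq_UNIV\<close>)
  note W = residue_plane[OF M]
  have i: "inc (line (M *v v) v) (point w) \<longleftrightarrow> herm v w = 0" "inc (point w) (line (M *v v) v) \<longleftrightarrow> herm v w = 0"
    if "unit v" "unit w" for v w
    using that M inc_simps(3,4)[OF M, of "M *v v" v w] by auto
  show ?thesis
  proof (rule r.projective_plane)
    fix x y assume xy: "x \<in> ?W" "y \<in> ?W" "x \<noteq> y" "vtype x = vtype y"
    show "\<exists>z\<in>?W. inc x z \<and> inc z y"
    proof (cases "vtype x = Tq")
      case True
      then obtain w w' where w: "x = point w" "y = point w'" "unit w" "unit w'" using xy M by (auto simp: W)
      obtain v where "unit v" "herm v w = 0" "herm v w' = 0" by (rule unit_perp_exists)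
      then show ?thesis using w i by (intro bexI[of _ "line (M *v v) v"]) (auto simp: W)
    next
      case False
      then obtain v v' where v: "x = line (M *v v) v" "y = line (M *v v') v'" "unit v" "unit v'" using xy M by (auto simp: W)
      obtain w where "unit w" "herm w v = 0" "herm w v' = 0" by (rule unit_perp_exists)
      moreover then have "herm v w = 0" "herm v' w = 0" using herm_zero_commute by blast+
      ultimately show ?thesis using v i by (intro bexI[of _ "point w"]) (auto simp: W)
    qed
  next
    have main: False if h: "{a, b, c, d} \<subseteq> ?W" "inc a b" "inc b c" "inc c d" "inc d a" "a \<noteq> c" "b \<noteq> d" "vtype a = Td" for a b c d
    proof -
      have "vtype b \<noteq> Td" "vtype d \<noteq> Td" using inc_types h(2,5,8) by metis+
      then obtain w w' where w: "b = point w" "d = point w'" "unit w" "unit w'" using h(1) M by (auto simp: W)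
      then have "vtype c \<noteq> Tq" using inc_types[OF h(3)] by auto
      then obtain v v' where v: "a = line (M *v v) v" "c = line (M *v v') v'" "unit v" "unit v'" using h(1,8) M by (auto simp: W)
      obtain k where "v' = k *s v" "cnj k * k = 1"
        using lines_through_two_points[OF v(3,4) w(3,4)] h v w i by metis
      then have "c = a" using v M by (simp add: mv_scale line_def outer_phase)
      with h show False by simp
    qed
    fix a b c d assume h: "{a, b, c, d} \<subseteq> ?W" "inc a b" "inc b c" "inc c d" "inc d a" "a \<noteq> c" "b \<noteq> d"
    have "vtype a = Td \<or> vtype b = Td"
      using h(1) inc_types[OF h(2)] M by (auto simp: W)
    then show False using main[of a b c d] main[of b c d a] h by auto
  next
    show "is_cycle (flags ?W inc) [line (M *v e 1) (e 1), point (e 2), line (M *v e 3) (e 3), point (e 1), line (M *v e 2) (e 2), point (e 3)]"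
    proof -
      have "line (M *v e k) (e k) \<noteq> line (M *v e l) (e l)" "point (e k) \<noteq> point (e l)" if "k \<noteq> l" for k l :: 3
      proof -
        have "e k \<noteq> c *s e l" for c
          using that herm_e[of k k] by (metis herm_e herm_scale(1) mult_zero_right zero_neq_one)
        then show "line (M *v e k) (e k) \<noteq> line (M *v e l) (e l)" "point (e k) \<noteq> point (e l)"
          using M by (auto simp: line_eq_iff point_eq_iff)
      qed
      moreover have "line (M *v e k) (e k) \<in> ?W" "point (e k) \<in> ?W" for k
        using M by (auto simp: W)
      moreover have "line (M *v e k) (e k) \<noteq> point (e l)" "point (e l) \<noteq> line (M *v e k) (e k)" for k l
        using M line_neq_point[of "M *v e k" "e k" "e l"] by (simp_all add: eq_commute[of "point (e l)"])
      ultimately show ?thesis using i by (simp add: is_cycle_def r.adj_flags)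
    qed
  qed
qed

theorem residue_of_line:
  assumes uv: "unit u" "unit v" and ij: "{i, j} = {Tp, Tq}" "i \<noteq> j"
  shows "generalized_polygon 2 {i, j} (flags (residue vertices inc {line u v}) inc) vtype"
proof -
  let ?W = "residue vertices inc {line u v}"
  interpret r: thick_bipartite ?W inc vtype i j
    by (rule thick_bipartite_residue) (use uv ij in \<open>auto simp: pdq_UNIV\<close>)
  show ?thesis
  proof (rule r.digon)
    fix x y assume "x \<in> ?W" "y \<in> ?W" "vtype x \<noteq> vtype y"
    then show "inc x y" using inc_simps(5,6) uv by (auto simp: residue_line[OF uv])
  qed
qed

text \<open>The residue of a point \<open>w\<close> is the quadrangle of totally isotropic subspaces of
  \<open>\<complex>\<^sup>2 \<oplus> \<complex>\<^sup>3\<close> with an indefinite hermitian form: a line \<open>u v\<^sup>*\<close>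
  is the isotropic span of \<open>(v, u)\<close>, and a plane \<open>M\<close> is the graph of its restriction to
  \<open>w\<^sup>\<bottom>\<close>.\<close>

text \<open>If \<open>N\<close> maps \<open>v\<close> to \<open>u\<close> and agrees with
  \<open>M\<close> at \<open>x\<close>, then \<open>x\<close> is orthogonal to \<open>M\<^sup>*
  u - v\<close>. This vector is not a multiple of \<open>w\<close>, because \<open>M\<^sup>*
  u\<close> is a unit vector; so \<open>x\<close> is determined up to a phase.\<close>

lemma quadrangle_unique:
  assumes w: "unit w" and uv: "unit u" "unit v" "herm v w = 0" and M: "M \<in> SU" "M *v v \<noteq> u"
    and x: "unit x" "herm x w = 0" "N \<in> SU" "N *v v = u" "N *v x = M *v x"
    and y: "unit y" "herm y w = 0" "L \<in> SU" "L *v v = u" "L *v y = M *v y"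
  obtains c where "y = c *s x" "cnj c * c = 1"
proof -
  define d where "d = ct M *v u - v"
  have perp: "herm x d = 0" if "N \<in> SU" "N *v v = u" "N *v x = M *v x" for N x
  proof -
    have "herm x (ct M *v u) = herm (M *v x) u" by (simp add: herm_ct)
    also have "\<dots> = herm (N *v x) (N *v v)" using that by (simp only:)
    also have "\<dots> = herm x v" by (rule SU_herm[OF that(1)])
    finally show ?thesis by (simp add: d_def herm_diff)
  qed
  have "d \<noteq> c *s w" for c
  proof
    assume d: "d = c *s w"
    then have mu: "ct M *v u = v + c *s w" by (metis d_def diff_add_cancel add.commute)
    have "herm (ct M *v u) (ct M *v u) = 1" using M uv by simp
    moreover have "herm w v = 0" using uv herm_zero_commute by blast
    ultimately have "c * cnj c = 0" using uv w
      by (simp add: mu herm_add herm_scale)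
    then have "c = 0" by simp
    then have "ct M *v u = v" using mu by simp
    then have "u = M *v v" using M by (metis SU_ct_simps(7))
    then show False using M by simp
  qed
  then obtain c where "y = c *s x"
    using perp_perp_proportional[OF w _ x(1,2) perp[OF x(3-5)] y(2) perp[OF y(3-5)]] by metis
  then show ?thesis using that unit_proportional x(1) y(1) by metis
qed

text \<open>The vector \<open>x\<close> is chosen orthogonal to \<open>w\<close> and to
  \<open>M\<^sup>* u - v\<close>, which is the condition for an isometry with the two prescribed
  values.\<close>

lemma quadrangle_projection:
  assumes w: "unit w" and uv: "unit u" "unit v" "herm v w = 0" and M: "M \<in> SU" "M *v v \<noteq> u"
  obtains x N where "unit x" "herm x w = 0" "N \<in> SU" "N *v v = u" "N *v x = M *v x"
proof -
  obtain x where x: "unit x" "herm x w = 0" "herm x (ct M *v u - v) = 0" by (rule unit_perp_exists)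
  have eq: "herm (M *v x) u = herm x v" using x(3) by (simp add: herm_ct herm_diff)
  have "x \<noteq> c *s v" for c
  proof
    assume a: "x = c *s v"
    then have c: "cnj c * c = 1" using unit_proportional uv x by metis
    have "c * herm (M *v v) u = c" using eq uv by (simp add: a mv_scale herm_scale)
    then have "herm (M *v v) u = 1" using c by auto
    then have "herm (M *v v - u) (M *v v - u) = 0"
      using M uv by (simp add: herm_diff herm_commute[of u "M *v v"])
    then show False using M by (simp add: herm_self_0)
  qed
  then obtain N where "N \<in> SU" "N *v v = u" "N *v x = M *v x"
    using isometry_extends[OF uv(2) x(1) _ uv(1), of "M *v x"] M x eq by auto
  then show ?thesis using that x by blast
qed

theorem residue_of_point:
  assumes w: "unit w" and ij: "{i, j} = {Tp, Td}" "i \<noteq> j"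
  shows "generalized_polygon 4 {i, j} (flags (residue vertices inc {point w}) inc) vtype"
proof -
  let ?W = "residue vertices inc {point w}"
  interpret r: thick_bipartite ?W inc vtype i j
    by (rule thick_bipartite_residue) (use w ij in \<open>auto simp: pdq_UNIV\<close>)
  note W = residue_point[OF w]
  have i: "inc (plane M) (line u v) \<longleftrightarrow> M *v v = u" "inc (line u v) (plane M) \<longleftrightarrow> M *v v = u"
    if "M \<in> SU" "unit u" "unit v" for M u v
    using inc_simps(1,2)[OF that w] by auto
  have P: "\<exists>M\<in>SU. x = plane M" if "x \<in> ?W" "vtype x \<noteq> Td" for x using that by (auto simp: W)
  have L: "\<exists>u v. unit u \<and> unit v \<and> herm v w = 0 \<and> x = line u v" if "x \<in> ?W" "vtype x \<noteq> Tp" for x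
    using that by (auto simp: W)
  have PL: "vtype x = Tp \<or> vtype x = Td" if "x \<in> ?W" for x using that by (auto simp: W)
  have proj: "\<exists>y'\<in>?W. \<exists>x'\<in>?W. inc x y' \<and> inc y' x' \<and> inc x' y"
    if h: "x \<in> ?W" "y \<in> ?W" "vtype x = Tp" "vtype y = Td" "\<not> inc x y" for x y
  proof -
    obtain M where M: "M \<in> SU" "x = plane M" using P[OF h(1)] h(3) by auto
    obtain u v where uv: "unit u" "unit v" "herm v w = 0" "y = line u v" using L[OF h(2)] h(4) by auto
    have "M *v v \<noteq> u" using h(5) M uv i by simp
    then obtain z N where z: "unit z" "herm z w = 0" "N \<in> SU" "N *v v = u" "N *v z = M *v z"
      using quadrangle_projection[OF w uv(1-3) M(1)] by metis
    have "unit (M *v z)" using z M by simp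
    moreover then have "line (M *v z) z \<in> ?W" "plane N \<in> ?W" using z unfolding W by blast+
    ultimately show ?thesis using M uv z i[of M "M *v z" z] i[of N "M *v z" z] i[of N u v] by blast
  qed
  have no4: False if h: "{a, b, c, d} \<subseteq> ?W" "inc a b" "inc b c" "inc c d" "inc d a" "a \<noteq> c" "b \<noteq> d" "vtype a = Tp" for a b c d
  proof -
    have "vtype b \<noteq> Tp" "vtype d \<noteq> Tp" using inc_types h(2,5,8) by metis+
    then obtain u v u' v' where b: "b = line u v" "unit u" "unit v" "herm v w = 0"
      and d: "d = line u' v'" "unit u'" "unit v'" "herm v' w = 0" using L[of b] L[of d] h(1) by auto
    have "vtype c \<noteq> Td" using inc_types[OF h(3)] b by auto
    then obtain M N where a: "a = plane M" "M \<in> SU" and c: "c = plane N" "N \<in> SU" using P[of a] P[of c] h(1,8) by auto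
    have eq: "M *v v = u" "N *v v = u" "M *v v' = u'" "N *v v' = u'"
      using h(2-5) a b c d i by auto
    have "v' \<noteq> k *s v" for k
    proof
      assume k: "v' = k *s v"
      then have "u' = k *s u" using eq by (metis mv_scale)
      then have "d = b" using b d k unit_proportional[OF b(3) d(3) k] by (simp add: line_def outer_phase)
      then show False using h(7) by simp
    qed
    then have "M = N" using isometry_unique[OF b(3) d(3)] a c eq by metis
    then show False using h(6) a c by simp
  qed
  have no4': False if h: "{a, b, c, d} \<subseteq> ?W" "inc a b" "inc b c" "inc c d" "inc d a" "a \<noteq> c" "b \<noteq> d" for a b c d
  proof -
    have "vtype a = Tp \<or> vtype b = Tp" using PL[of a] PL[of b] inc_types[OF h(2)] h(1) by auto
    then show False using no4[of a b c d] no4[of b c d a] h by auto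
  qed
  have no6: False if h: "{a, b, c, d, f, g} \<subseteq> ?W" "inc a b" "inc b c" "inc c d" "inc d f" "inc f g" "inc g a"
        "distinct [a, b, c, d, f, g]" "vtype a = Tp" for a b c d f g
  proof -
    have bg: "vtype b \<noteq> Tp" "vtype g \<noteq> Tp" using inc_types h(2,7,9) by metis+
    then have cf: "vtype c \<noteq> Td" "vtype f \<noteq> Td"
      using inc_types[OF h(3)] inc_types[OF h(6)] PL[of b] PL[of g] h(1) by auto
    then have d': "vtype d \<noteq> Tp" using inc_types[OF h(4)] PL[of c] h(1) by auto
    obtain M where a: "a = plane M" "M \<in> SU" using P[of a] h(1,9) by auto
    obtain N where c: "c = plane N" "N \<in> SU" using P[of c] h(1) cf by auto
    obtain L where f: "f = plane L" "L \<in> SU" using P[of f] h(1) cf by auto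
    obtain u1 v1 where b: "b = line u1 v1" "unit u1" "unit v1" "herm v1 w = 0" using L[of b] h(1) bg by auto
    obtain u2 v2 where d: "d = line u2 v2" "unit u2" "unit v2" "herm v2 w = 0" using L[of d] h(1) d' by auto
    obtain u3 v3 where g: "g = line u3 v3" "unit u3" "unit v3" "herm v3 w = 0" using L[of g] h(1) bg by auto
    have eq: "M *v v1 = u1" "N *v v1 = u1" "N *v v2 = u2" "L *v v2 = u2" "L *v v3 = u3" "M *v v3 = u3"
      using h(2-7) a b c d f g i by auto
    have "M *v v2 \<noteq> u2"
    proof
      assume "M *v v2 = u2"
      then have "inc d a" using i a d by simp
      then show False using no4'[of a b c d] h by auto
    qed
    then obtain k where k: "v3 = k *s v1" "cnj k * k = 1"
      using quadrangle_unique[OF w d(2-4) a(2) _ b(3,4) c(2) eq(3) _ g(3,4) f(2) eq(4)] eq by metis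
    then have "u3 = k *s u1" using eq by (metis mv_scale)
    then have "g = b" using b g k by (simp add: line_def outer_phase)
    then show False using h(8) by simp
  qed
  have "\<exists>a b c d f g h k. is_cycle (flags ?W inc) [a, b, c, d, f, g, h, k]"
  proof -
    obtain v1 where v1: "unit v1" "herm v1 w = 0" by (rule unit_perp_exists)
    have "herm w v1 = 0" using v1 by (simp add: herm_zero_commute)
    then obtain X where X: "X \<in> SU" "X *v e 1 = w" "X *v e 2 = v1" using SU_frame w v1 by metis
    define v2 where "v2 = X *v e 3"
    have v2: "unit v2" "herm v2 w = 0" using X(1) by (simp_all add: v2_def flip: X(2))
    \<comment> \<open>The planes of the apartment act as signs on the frame of the complement of the point.\<close>
  define D where "D s t = X ** mat3 (s * t) 0 0 0 s 0 0 0 t ** ct X" for s t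
    have D: "D s t \<in> SU" "D s t *v v1 = s *s v1" "D s t *v v2 = t *s v2"
      if "s \<in> {1, -1}" "t \<in> {1, -1}" for s t
    proof -
      have "mat3 (s * t) 0 0 0 s 0 0 0 t \<in> SU"
        using that by (intro SU_I) (auto simp: mat3_simps)
      then show "D s t \<in> SU" using X by (simp add: D_def)
      have m: "mat3 (s * t) 0 0 0 s 0 0 0 t *v e 2 = s *s e 2" "mat3 (s * t) 0 0 0 s 0 0 0 t *v e 3 = t *s e 3"
        by (simp_all add: mat3_simps)
      show "D s t *v v1 = s *s v1" "D s t *v v2 = t *s v2"
        using X(1) by (simp_all add: D_def mv_assoc v2_def m mv_scale flip: X(3))
    qed
    have v12: "herm v1 v2 = 0" using X(1) by (simp add: v2_def flip: X(3))
    have ne: "line (s *s v1) v1 \<noteq> line (t *s v2) v2" if "s \<in> {1, -1}" "t \<in> {1, -1}" for s t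
    proof
      assume a: "line (s *s v1) v1 = line (t *s v2) v2"
      have "unit (s *s v1)" "unit (t *s v2)" using that v1 v2 by (auto simp: herm_scale)
      then obtain c where "v1 = c *s v2" using a v1 v2 line_eq_iff by metis
      then have "herm v1 v1 = 0" using v12 by (simp add: herm_scale)
      then show False using v1 by simp
    qed
    have sgn: "line (1 *s v) v \<noteq> line ((-1) *s v) v" if "unit v" for v
    proof
      assume "line (1 *s v) v = line ((-1) *s v) v"
      then have "outer v v *v v = outer (- v) v *v v" by (simp add: line_def vector_smult_lid)
      then have "v = - v" using that by (simp add: outer_mv vector_smult_lid)
      then show False using that herm_minus(1)[of v v] by (metis neg_equal_iff_equal one_neq_neg_one)
    qed
    have scale_inj: "s = t" if "s *s v = t *s v" "unit v" for s t and v :: "complex^3"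
      using arg_cong[OF that(1), of "\<lambda>x. herm x v"] that(2) by (simp add: herm_scale)
    have Dne: "D s t \<noteq> D s' t'" if "s \<in> {1, -1}" "t \<in> {1, -1}" "s' \<in> {1, -1}" "t' \<in> {1, -1}" "s \<noteq> s' \<or> t \<noteq> t'" for s t s' t'
    proof
      assume "D s t = D s' t'"
      then have "s *s v1 = s' *s v1" "t *s v2 = t' *s v2"
        using D(2,3)[OF that(1,2)] D(2,3)[OF that(3,4)] by metis+
      from scale_inj[OF this(1) v1(1)] scale_inj[OF this(2) v2(1)] show False using that(5) by simp
    qed
    have in1: "inc (plane (D s t)) (line (s *s v1) v1)" "inc (line (s *s v1) v1) (plane (D s t))"
      "inc (plane (D s t)) (line (t *s v2) v2)" "inc (line (t *s v2) v2) (plane (D s t))"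
      "plane (D s t) \<in> ?W" "line (s *s v1) v1 \<in> ?W" "line (t *s v2) v2 \<in> ?W"
      if st: "s \<in> {1, -1}" "t \<in> {1, -1}" for s t
    proof -
      have "unit (s *s v1)" "unit (t *s v2)" using st v1 v2 by (auto simp: herm_scale)
      then show "inc (plane (D s t)) (line (s *s v1) v1)" "inc (line (s *s v1) v1) (plane (D s t))"
        "inc (plane (D s t)) (line (t *s v2) v2)" "inc (line (t *s v2) v2) (plane (D s t))"
        "plane (D s t) \<in> ?W" "line (s *s v1) v1 \<in> ?W" "line (t *s v2) v2 \<in> ?W"
        using i[OF D(1)[OF st]] D(2,3)[OF st] D(1)[OF st] v1 v2 by (auto simp: W)
    qed
    have PLne: "plane (D s t) \<noteq> line (s' *s v) v" if "s \<in> {1, -1}" "t \<in> {1, -1}" "s' \<in> {1, -1}" "unit v" for s t s' v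
      using that D(1)[OF that(1,2)] by (intro plane_neq_line) (auto simp: herm_scale)
    define l1 l2 where "l1 s = line (s *s v1) v1" and "l2 s = line (s *s v2) v2" for s
    have dist: "plane (D s t) \<noteq> l1 s'" "plane (D s t) \<noteq> l2 s'"
      if "s \<in> {1, -1}" "t \<in> {1, -1}" "s' \<in> {1, -1}" for s t s'
      using PLne[OF that v1(1)] PLne[OF that v2(1)] unfolding l1_def l2_def by blast+
    have dist12: "l1 s \<noteq> l2 t" if "s \<in> {1, -1}" "t \<in> {1, -1}" for s t
      using ne[OF that] unfolding l1_def l2_def by blast
    have dist0: "l1 1 \<noteq> l1 (-1)" "l2 1 \<noteq> l2 (-1)"
      using sgn[OF v1(1)] sgn[OF v2(1)] unfolding l1_def l2_def by blast+
    note sg = insertI1[of 1 "{- 1}"] insertI2[OF singletonI, of "- 1" 1]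
    have "is_cycle (flags ?W inc) [plane (D 1 1), l1 1, plane (D 1 (-1)), l2 (-1), plane (D (-1) (-1)), l1 (-1), plane (D (-1) 1), l2 1]"
      unfolding is_cycle_def
    proof (intro conjI)
      show "distinct [plane (D 1 1), l1 1, plane (D 1 (-1)), l2 (-1), plane (D (-1) (-1)), l1 (-1), plane (D (-1) 1), l2 1]"
        using Dne dist dist[symmetric] dist12 dist12[symmetric] dist0 dist0[symmetric] by simp
      show "successively (adj (flags ?W inc))
          [plane (D 1 1), l1 1, plane (D 1 (-1)), l2 (-1), plane (D (-1) (-1)), l1 (-1), plane (D (-1) 1), l2 1]"
        unfolding successively.simps r.adj_flags l1_def l2_def
        by (intro conjI TrueI in1 sg) (rule sg(1))+
      show "adj (flags ?W inc)
          (last [plane (D 1 1), l1 1, plane (D 1 (-1)), l2 (-1), plane (D (-1) (-1)), l1 (-1), plane (D (-1) 1), l2 1])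
          (hd [plane (D 1 1), l1 1, plane (D 1 (-1)), l2 (-1), plane (D (-1) (-1)), l1 (-1), plane (D (-1) 1), l2 1])"
        using in1[OF sg(1,1)] by (simp only: last.simps list.sel list.simps if_False r.adj_flags l2_def simp_thms if_True)
    qed simp
    then show ?thesis by blast
  qed
  then obtain a b c d f g h k where cyc: "is_cycle (flags ?W inc) [a, b, c, d, f, g, h, k]" by blast
  show ?thesis
  proof (rule r.generalized_quadrangle[OF _ _ _ cyc])
    fix x y assume xy: "x \<in> ?W" "y \<in> ?W" "vtype x \<noteq> vtype y" "\<not> inc x y"
    show "\<exists>y'\<in>?W. \<exists>x'\<in>?W. inc x y' \<and> inc y' x' \<and> inc x' y"
    proof (cases "vtype x = Tp")
      case True
      then show ?thesis using proj[OF xy(1,2)] PL[OF xy(2)] xy by auto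
    next
      case False
      then obtain y' x' where "y' \<in> ?W" "x' \<in> ?W" "inc y y'" "inc y' x'" "inc x' x"
        using proj[OF xy(2,1)] PL[OF xy(2)] PL[OF xy(1)] xy inc_sym[of y x] by auto
      then show ?thesis using inc_sym by blast
    qed
  next
    fix a b c d f g
    assume h: "{a, b, c, d, f, g} \<subseteq> ?W" "inc a b" "inc b c" "inc c d" "inc d f" "inc f g" "inc g a"
        "distinct [a, b, c, d, f, g]"
    have "vtype a = Tp \<or> vtype b = Tp" using PL[of a] PL[of b] inc_types[OF h(2)] h(1) by auto
    then show False
    proof
      assume b: "vtype b = Tp"
      have "{b, c, d, f, g, a} \<subseteq> ?W" using h(1) by simp
      moreover have "distinct [b, c, d, f, g, a]"
        using distinct1_rotate[of "[a, b, c, d, f, g]"] h(8) by (simp only: rotate1.simps append.simps)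
      ultimately show False by (rule no6[OF _ h(3-7,2) _ b])
    qed (rule no6[OF h])
  next
    fix a b c d
    assume "{a, b, c, d} \<subseteq> ?W" "inc a b" "inc b c" "inc c d" "inc d a" "a \<noteq> c" "b \<noteq> d"
    then show False by (rule no4')
  qed
qed

subsection \<open>The geometry\<close>

lemma connected_of_polygon:
  assumes "generalized_polygon k I \<Delta> t" shows "gallery_connected 2 \<Delta>"
proof -
  have c: "chamber_complex 2 \<Delta>" using assms unfolding generalized_polygon_def geometry_def by metis
  show ?thesis
    unfolding gallery_connected_def
  proof (intro ballI)
    fix x y assume "x \<in> chambers \<Delta>" "y \<in> chambers \<Delta>"
    then obtain cs where "gallery 2 \<Delta> cs" "hd cs = x" "last cs = y"
      using c unfolding chamber_complex_def by blast
    moreover have "successively (gallery_step 2 \<Delta>) cs" if "successively (\<lambda>c d. 2 \<le> card (c \<inter> d) + 1) cs" "set cs \<subseteq> chambers \<Delta>" for cs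
      using that by (induction cs rule: induct_list012) (auto simp: gallery_step_def)
    ultimately show "(gallery_step 2 \<Delta>)\<^sup>*\<^sup>* x y"
      using path_rtranclp[of "gallery_step 2 \<Delta>" cs] by (auto simp: gallery_def)
  qed
qed

theorem residue_polygon:
  assumes x: "x \<in> vertices" and ij: "UNIV - {vtype x} = {i, j}" "i \<noteq> j"
  shows "generalized_polygon (C3_matrix i j) {i, j} (flags (residue vertices inc {x}) inc) vtype"
  using x
proof (cases rule: vertices_cases)
  case (1 M)
  have "{i, j} = {Td, Tq}" using 1 ij by (auto simp: pdq_UNIV)
  moreover then have "C3_matrix i j = 3" using ij(2) by (auto simp: doubleton_eq_iff)
  ultimately show ?thesis using residue_of_plane[OF 1(1) _ ij(2)] 1 by simp
next
  case (2 u v)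
  have "{i, j} = {Tp, Tq}" using 2 ij by (auto simp: pdq_UNIV)
  moreover then have "C3_matrix i j = 2" using ij(2) by (auto simp: doubleton_eq_iff)
  ultimately show ?thesis using residue_of_line[OF 2(1,2) _ ij(2)] 2 by simp
next
  case (3 w)
  have "{i, j} = {Tp, Td}" using 3 ij by (auto simp: pdq_UNIV)
  moreover then have "C3_matrix i j = 4" using ij(2) by (auto simp: doubleton_eq_iff)
  ultimately show ?thesis using residue_of_point[OF 3(1) _ ij(2)] 3 by simp
qed

lemma two_types: "\<exists>i j. UNIV - {k} = {i, j} \<and> i \<noteq> (j :: pdq)"
  by (cases k) (auto simp: pdq_UNIV)

lemma card_pdq: "card (UNIV :: pdq set) = 3"
  by (simp add: pdq_UNIV)

theorem model_geometry: "geometry_of_type UNIV C3_matrix (flags vertices inc) vtype"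
proof -
  have res: "gallery_connected 2 (flags (residue vertices inc {x}) inc)" if "x \<in> vertices" for x
    using residue_polygon[OF that] two_types[of "vtype x"] connected_of_polygon by metis
  have "geometry UNIV (flags vertices inc) vtype"
  proof (rule model.geometry_flags)
    fix \<alpha> assume a: "\<alpha> \<in> flags vertices inc" "2 \<le> card (UNIV - vtype ` \<alpha>)"
    have fin: "finite (UNIV :: pdq set)" by (simp add: pdq_UNIV)
    have "card (UNIV - vtype ` \<alpha>) = 3 - card \<alpha>"
      using model.card_flags[OF a(1)] card_Diff_subset[OF finite_subset[OF subset_UNIV fin] subset_UNIV, of "vtype ` \<alpha>"]
      by (simp add: card_pdq)
    then have c01: "card \<alpha> = 0 \<or> card \<alpha> = 1" and eq: "card (UNIV - vtype ` \<alpha>) = 3 - card \<alpha>" using a(2) by linarith+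
    from c01 show "gallery_connected (card (UNIV - vtype ` \<alpha>)) (flags (residue vertices inc \<alpha>) inc)"
    proof
      assume "card \<alpha> = 0"
      then have "\<alpha> = {}" using flags_finite[OF a(1)] by simp
      moreover have "gallery_connected 3 (flags vertices inc)"
      proof (rule model.gallery_connected_rank_3[of Tp Tq])
        fix x y assume "x \<in> vertices" "y \<in> vertices" "vtype x = Tp" "vtype y = Tq"
        then show "inc x y" using vertices_of_type[of x] vertices_of_type[of y] inc_simps(5)[OF _ _ _ ]
          by (metis herm_e)
      qed (auto simp: card_pdq res)
      ultimately show ?thesis by (simp add: residue_def card_pdq)
    next
      assume c1: "card \<alpha> = 1"
      then obtain x where "\<alpha> = {x}" using card_1_singletonE by blast
      then show ?thesis using a(1) res c1 eq by simp
    qed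
  qed simp
  moreover have "generalized_polygon (C3_matrix i j) {i, j} (link (flags vertices inc) \<alpha>) vtype"
    if "\<alpha> \<in> flags vertices inc" "i \<noteq> j" "UNIV - vtype ` \<alpha> = {i, j}" for \<alpha> i j
  proof -
    have fin: "finite (UNIV :: pdq set)" by (simp add: pdq_UNIV)
    have "card (UNIV - vtype ` \<alpha>) = 3 - card \<alpha>"
      using model.card_flags[OF that(1)] card_Diff_subset[OF finite_subset[OF subset_UNIV fin] subset_UNIV, of "vtype ` \<alpha>"]
      by (simp add: card_pdq)
    then have "card \<alpha> = 1" using that by simp
    then obtain x where "\<alpha> = {x}" using card_1_singletonE by blast
    then show ?thesis using that residue_polygon[of x i j] model.link_flags[OF that(1)] by simp
  qed
  ultimately show ?thesis by (auto simp: geometry_of_type_def)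
qed

section \<open>The group SU(3) x SU(3) and its subgroups\<close>

abbreviation "SS \<equiv> SU3xSU3"

lemma group_SS: "group SS"
  unfolding SU3xSU3_def by (intro DirProd_group group_SU3)

lemma SS_simps [simp]: "carrier SS = SU \<times> SU" "(A, B) \<otimes>\<^bsub>SS\<^esub> (C, D) = (A ** C, B ** D)"
  "\<one>\<^bsub>SS\<^esub> = (mat 1, mat 1)"
  by (simp_all add: SU3xSU3_def DirProd_def)

lemma SS_inv [simp]: "A \<in> SU \<Longrightarrow> B \<in> SU \<Longrightarrow> inv\<^bsub>SS\<^esub> (A, B) = (ct A, ct B)"
  using group.inv_equality[OF group_SS, of "(ct A, ct B)" "(A, B)"] by simp

lemma mv_e1: "A *v e 1 = c *s e 1 \<longleftrightarrow> A $ 1 $ 1 = c \<and> A $ 2 $ 1 = 0 \<and> A $ 3 $ 1 = 0" for A :: "complex^3^3"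
  by (simp only: mv_axis vec_eq_iff forall_3) (simp add: axis_def)

lemma mv_e3: "A *v e 3 = c *s e 3 \<longleftrightarrow> A $ 3 $ 3 = c \<and> A $ 1 $ 3 = 0 \<and> A $ 2 $ 3 = 0" for A :: "complex^3^3"
  by (simp only: mv_axis vec_eq_iff forall_3) (auto simp add: axis_def)

lemma diag21_mat3: "diag21 Y y = mat3 (Y$1$1) (Y$1$2) 0 (Y$2$1) (Y$2$2) 0 0 0 y"
  by (simp add: diag21_def mat3_def)

lemma diag12_mat3: "diag12 z Y = mat3 z 0 0 0 (Y$1$1) (Y$1$2) 0 (Y$2$1) (Y$2$2)"
  by (simp add: diag12_def mat3_def)

lemma U2_iff: "Y \<in> U_mats \<longleftrightarrow> Y ** ct Y = mat 1 \<and> ct Y ** Y = (mat 1 :: complex^2^2)"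
  by (simp add: U_mats_def unitary_matrix_def ct_def)

lemma mat2_mult_ct:
  fixes Y :: "complex^2^2"
  shows "Y ** ct Y = mat 1 \<longleftrightarrow>
    Y$1$1 * cnj (Y$1$1) + Y$1$2 * cnj (Y$1$2) = 1 \<and> Y$1$1 * cnj (Y$2$1) + Y$1$2 * cnj (Y$2$2) = 0 \<and>
    Y$2$1 * cnj (Y$1$1) + Y$2$2 * cnj (Y$1$2) = 0 \<and> Y$2$1 * cnj (Y$2$1) + Y$2$2 * cnj (Y$2$2) = 1"
  by (simp add: vec_eq_iff forall_2 matrix_matrix_mult_def sum_2 mat_def conj_ac)

text \<open>The elements of \<open>Ug 3\<close> are block diagonal, since their adjoints
  preserve the same ray.\<close>

lemma block21:
  assumes "B \<in> Ug 3"
  obtains Y y where "B = diag21 Y y" "Y \<in> U_mats" "y = cnj (det Y)"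
proof -
  obtain y where y: "B *v e 3 = y *s e 3" "cnj y * y = 1" "ct B *v e 3 = cnj y *s e 3"
    using Ug_phase[OF assms] by blast
  have B: "B \<in> SU" using assms by (rule Ug_SU)
  have z: "B$3$3 = y" "B$1$3 = 0" "B$2$3 = 0" "B$3$1 = 0" "B$3$2 = 0"
    using y(1,3) unfolding mv_e3 by simp_all
  define Y :: "complex^2^2" where "Y = vector [vector [B$1$1, B$1$2], vector [B$2$1, B$2$2]]"
  have BY: "B = diag21 Y y"
    using mat3_eta[of B] by (simp add: diag21_mat3 Y_def vector_2 z)
  have "B ** ct B = mat 1" using B by simp
  then have "Y ** ct Y = mat 1"
    by (simp add: BY diag21_mat3 mat3_simps mat2_mult_ct)
  then have "Y \<in> U_mats" by (simp add: U2_iff mat_inverse_unique)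
  moreover have "det B = 1" using B by (rule SU_det)
  then have "det Y * y = 1" by (simp add: BY diag21_mat3 mat3_simps det_2 algebra_simps)
  then have "y = cnj (det Y)"
  proof -
    assume a: "det Y * y = 1"
    have "det Y = cnj y * (det Y * y)" using y(2) by (simp add: algebra_simps)
    then show ?thesis using a by simp
  qed
  ultimately show ?thesis using that BY by blast
qed

lemma diag21_Ug:
  assumes Y: "Y \<in> U_mats"
  shows "diag21 Y (cnj (det Y)) \<in> Ug 3"
proof -
  have u: "Y ** ct Y = mat 1" "ct Y ** Y = mat 1" using Y by (auto simp: U2_iff)
  have d: "det Y * cnj (det Y) = 1"
  proof -
    have "det Y * det (ct Y) = 1" using arg_cong[OF u(1), of det] by (simp add: det_mul)
    then show ?thesis by (simp add: det_2 mult.commute)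
  qed
  have "diag21 Y (cnj (det Y)) ** ct (diag21 Y (cnj (det Y))) = mat 1"
    using u(1) d by (simp add: diag21_mat3 mat3_simps mat2_mult_ct mult.commute)
  then have "ct (diag21 Y (cnj (det Y))) ** diag21 Y (cnj (det Y)) = mat 1" by (rule mat_inverse_unique)
  moreover have "det (diag21 Y (cnj (det Y))) = det Y * cnj (det Y)"
    by (simp add: diag21_mat3 mat3_simps det_2 algebra_simps)
  ultimately have "diag21 Y (cnj (det Y)) \<in> SU" using d by (intro SU_I) auto
  moreover have "diag21 Y (cnj (det Y)) *v e 3 = cnj (det Y) *s e 3"
    unfolding mv_e3 by (simp add: diag21_mat3)
  ultimately show ?thesis by (auto simp: Ug_def)
qed

lemma block12:
  assumes "B \<in> Ug 1" "B *v e 1 = z *s e 1"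
  obtains Y where "B = diag12 z Y" "Y \<in> U_mats"
proof -
  have B: "B \<in> SU" using assms(1) by (rule Ug_SU)
  obtain z' where y: "B *v e 1 = z' *s e 1" "ct B *v e 1 = cnj z' *s e 1"
    using Ug_phase[OF assms(1)] by blast
  have z: "B$1$1 = z" "B$2$1 = 0" "B$3$1 = 0" "B$1$2 = 0" "B$1$3 = 0"
    using y(2) assms(2) unfolding mv_e1 by simp_all
  define Y :: "complex^2^2" where "Y = vector [vector [B$2$2, B$2$3], vector [B$3$2, B$3$3]]"
  have BY: "B = diag12 z Y"
    using mat3_eta[of B] by (simp add: diag12_mat3 Y_def vector_2 z)
  have "B ** ct B = mat 1" using B by simp
  then have "Y ** ct Y = mat 1"
    by (simp add: BY diag12_mat3 mat3_simps mat2_mult_ct)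
  then have "Y \<in> U_mats" by (simp add: U2_iff mat_inverse_unique)
  then show ?thesis using that BY by blast
qed

lemma K_group_Tp: "(A, B) \<in> K_group Tp \<longleftrightarrow> B \<in> SU \<and> A = mat_cnj B"
  by auto

lemma K_group_Tq: "(A, B) \<in> K_group Tq \<longleftrightarrow> A \<in> SU \<and> B \<in> Ug 3"
  by (auto simp: diag21_Ug elim: block21)

lemma K_group_Td: "(A, B) \<in> K_group Td \<longleftrightarrow>
   A \<in> SU \<and> B \<in> SU \<and> (\<exists>z. cnj z * z = 1 \<and> A *v e 1 = cnj z *s e 1 \<and> B *v e 1 = z *s e 1)"
proof
  assume "(A, B) \<in> K_group Td"
  then obtain z Y1 Y2 where z: "norm z = 1" "A = diag12 (cnj z) Y2" "B = diag12 z Y1" and SU: "A \<in> SU" "B \<in> SU"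
    by auto
  have "z * cnj z = 1" using z(1) complex_norm_square[of z] by simp
  moreover have "A *v e 1 = cnj z *s e 1" "B *v e 1 = z *s e 1"
    unfolding mv_e1 by (simp_all add: z diag12_mat3)
  ultimately show "A \<in> SU \<and> B \<in> SU \<and> (\<exists>z. cnj z * z = 1 \<and> A *v e 1 = cnj z *s e 1 \<and> B *v e 1 = z *s e 1)"
    using SU by (auto simp: mult.commute)
next
  assume "A \<in> SU \<and> B \<in> SU \<and> (\<exists>z. cnj z * z = 1 \<and> A *v e 1 = cnj z *s e 1 \<and> B *v e 1 = z *s e 1)"
  then obtain z where SU: "A \<in> SU" "B \<in> SU" and z: "cnj z * z = 1" "A *v e 1 = cnj z *s e 1" "B *v e 1 = z *s e 1"
    by blast
  have "of_real ((norm z)\<^sup>2) = (of_real 1 :: complex)" using z(1) by (simp only: complex_norm_square of_real_1 mult.commute)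
  then have "(norm z)\<^sup>2 = 1" by (simp only: of_real_eq_iff)
  then have n: "norm z = 1" by (simp add: power2_eq_1_iff) (smt (verit) norm_ge_zero)
  have "A \<in> Ug 1" "B \<in> Ug 1" using SU z by (auto simp: Ug_def)
  then obtain Y Y' where "A = diag12 (cnj z) Y" "Y \<in> U_mats" "B = diag12 z Y'" "Y' \<in> U_mats"
    using block12 z by metis
  then show "(A, B) \<in> K_group Td" using n SU by auto
qed

section \<open>The action on the flat geometry\<close>

text \<open>The first component carries planes and lines, the second one the projections onto
  points.\<close>

definition act2 :: "mat_pair \<Rightarrow> mat_pair \<Rightarrow> mat_pair" where
  "act2 x N = (fst x ** fst N ** transpose (snd x), mat_cnj (snd x) ** snd N ** transpose (snd x))"

definition mv :: "mat_pair \<Rightarrow> mat_pair set set \<Rightarrow> mat_pair set set" where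
  "mv x v = (\<lambda>S. act2 x ` S) ` v"

lemma zero_mult [simp]: "A ** 0 = 0" "0 ** A = (0 :: complex^3^3)" for A :: "complex^3^3"
  by (simp_all add: vec_eq_iff matrix_matrix_mult_def)

lemma ct_transpose: "ct (transpose B) = mat_cnj B"
  by (simp add: vec_eq_iff transpose_def)

lemma mv_simps [simp]:
  "mv (A, B) (plane M) = plane (A ** M ** ct (mat_cnj B))"
  "mv (A, B) (line u v) = line (A *v u) (mat_cnj B *v v)"
  "mv (A, B) (point w) = point (mat_cnj B *v w)"
  by (simp_all add: mv_def act2_def plane_def line_def point_def mult_outer outer_mult ct_transpose ct_cnj)

lemma mv_mult: "mv (x \<otimes>\<^bsub>SS\<^esub> y) v = mv x (mv y v)"
proof -
  have "act2 (x \<otimes>\<^bsub>SS\<^esub> y) = act2 x \<circ> act2 y"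
    by (cases x; cases y) (auto simp: act2_def fun_eq_iff mat_cnj_mult matrix_transpose_mul matrix_mul_assoc)
  then show ?thesis by (simp add: mv_def image_image)
qed

lemma mv_one: "mv \<one>\<^bsub>SS\<^esub> v = v"
  by (simp add: mv_def act2_def)

lemma mv_vertices: assumes "x \<in> carrier SS" "v \<in> vertices" shows "mv x v \<in> vertices" "vtype (mv x v) = vtype v"
proof -
  obtain A B where x: "x = (A, B)" "A \<in> SU" "B \<in> SU" using assms by auto
  from assms(2) show "mv x v \<in> vertices" "vtype (mv x v) = vtype v"
    by (cases rule: vertices_cases; simp add: x)+
qed

lemma mv_inc:
  assumes x: "x \<in> carrier SS" and "inc v w" shows "inc (mv x v) (mv x w)"
proof -
  obtain A B where x: "x = (A, B)" "A \<in> SU" "B \<in> SU" using assms by auto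
  have "inc0 (mv x v) (mv x w)" if "inc0 v w" for v w
    using that
  proof (cases rule: inc0.cases)
    case (plane_line M v)
    have "inc0 (plane (A ** M ** ct (mat_cnj B))) (line ((A ** M ** ct (mat_cnj B)) *v (mat_cnj B *v v)) (mat_cnj B *v v))"
      using plane_line x by (intro inc0.plane_line) auto
    then show ?thesis using plane_line x by (simp add: mv_assoc)
  next
    case (line_point u v w)
    then show ?thesis using x by (auto intro: inc0.line_point)
  next
    case (plane_point M w)
    then show ?thesis using x by (auto intro: inc0.plane_point)
  qed
  then show ?thesis using assms(2) by (auto simp: inc_def)
qed

fun base :: "pdq \<Rightarrow> mat_pair set set" where
  "base Tp = plane (mat 1)" | "base Td = line (e 1) (e 1)" | "base Tq = point (e 3)"

lemma base_vertices [simp]: "base i \<in> vertices" "vtype (base i) = i"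
  by (cases i; simp)+

text \<open>This identifies the given groups of block matrices with stabilizers.\<close>

lemma K_group_stabilizer: "K_group i = {x \<in> carrier SS. mv x (base i) = base i}"
proof -
  have "(A, B) \<in> K_group i \<longleftrightarrow> A \<in> SU \<and> B \<in> SU \<and> mv (A, B) (base i) = base i" for A B
  proof (cases i)
    case Tp
    have "A ** mat 1 ** ct (mat_cnj B) = mat 1 \<longleftrightarrow> A = mat_cnj B" if "A \<in> SU" "B \<in> SU"
    proof
      assume "A ** mat 1 ** ct (mat_cnj B) = mat 1"
      then have "(A ** ct (mat_cnj B)) ** mat_cnj B = mat_cnj B" by simp
      then show "A = mat_cnj B" using that mat_cnj_SU by (metis SU_ct_simps(6))
    qed (use that in simp)
    then show ?thesis using Tp by (auto simp: K_group_Tp simp del: K_group.simps)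
  next
    case Td
    have "(\<exists>z. cnj z * z = 1 \<and> A *v e 1 = cnj z *s e 1 \<and> B *v e 1 = z *s e 1) \<longleftrightarrow>
       line (A *v e 1) (mat_cnj B *v e 1) = line (e 1) (e 1)" if SU: "A \<in> SU" "B \<in> SU"
    proof -
      have c: "mat_cnj B *v e 1 = cnj z *s e 1 \<longleftrightarrow> B *v e 1 = z *s e 1" for z
        unfolding mv_e1 by auto
      have "line (A *v e 1) (mat_cnj B *v e 1) = line (e 1) (e 1) \<longleftrightarrow>
          (\<exists>c. cnj c * c = 1 \<and> A *v e 1 = c *s e 1 \<and> mat_cnj B *v e 1 = c *s e 1)"
        using SU by (intro line_eq_iff) auto
      also have "\<dots> \<longleftrightarrow> (\<exists>z. cnj z * z = 1 \<and> A *v e 1 = cnj z *s e 1 \<and> B *v e 1 = z *s e 1)"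
        unfolding c[symmetric] by (metis complex_cnj_cnj mult.commute)
      finally show ?thesis by simp
    qed
    then show ?thesis using Td by (auto simp: K_group_Td simp del: K_group.simps)
  next
    case Tq
    have "B \<in> Ug 3 \<longleftrightarrow> point (mat_cnj B *v e 3) = point (e 3)" if SU: "B \<in> SU"
    proof -
      have c: "mat_cnj B *v e 3 = cnj z *s e 3 \<longleftrightarrow> B *v e 3 = z *s e 3" for z
        unfolding mv_e3 by auto
      have "point (mat_cnj B *v e 3) = point (e 3) \<longleftrightarrow> (\<exists>c. mat_cnj B *v e 3 = c *s e 3)"
        using SU by (intro point_eq_iff) auto
      also have "\<dots> \<longleftrightarrow> (\<exists>z. B *v e 3 = z *s e 3)"
        unfolding c[symmetric] by (metis complex_cnj_cnj)
      finally show ?thesis using SU by (simp add: Ug_def)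
    qed
    then show ?thesis using Tq Ug_SU by (auto simp: K_group_Tq simp del: K_group.simps)
  qed
  then show ?thesis by auto
qed

text \<open>The matrix \<open>R\<close> takes \<open>e\<^sub>1\<close> to \<open>-
  e\<^sub>1\<close> and \<open>e\<^sub>3\<close> to \<open>e\<^sub>2\<close>; it translates the
  frame produced for the first two coordinate vectors into one for the first and the
  third.\<close>

lemma chamber_from_base:
  assumes "\<gamma> \<in> chambers (flags vertices inc)"
  obtains x where "x \<in> carrier SS" "\<gamma> = mv x ` range base"
proof -
  have g: "\<gamma> \<in> flags vertices inc" "vtype ` \<gamma> = UNIV"
    using assms by (auto simp: model.chambers_flags)
  then obtain a b c where abc: "a \<in> \<gamma>" "b \<in> \<gamma>" "c \<in> \<gamma>" "vtype a = Tp" "vtype b = Td" "vtype c = Tq"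
    using UNIV_I[of Tp] UNIV_I[of Td] UNIV_I[of Tq] unfolding g(2)[symmetric] image_iff by metis
  have V: "a \<in> vertices" "b \<in> vertices" "c \<in> vertices" using abc(1-3) flags_carrier[OF g(1)] by auto
  obtain M where M: "M \<in> SU" "a = plane M" using vertices_of_type(1)[OF V(1) abc(4)] by blast
  obtain u v where uv: "unit u" "unit v" "b = line u v" using vertices_of_type(2)[OF V(2) abc(5)] by blast
  obtain w where w: "unit w" "c = point w" using vertices_of_type(3)[OF V(3) abc(6)] by blast
  have "a \<noteq> b" "b \<noteq> c" using abc(4-6) by auto
  then have "inc a b" "inc b c" using g(1) abc(1-3) by (auto simp: flags_def)
  then have i: "M *v v = u" "herm v w = 0" using M uv w inc_simps(1,3)[OF M(1) uv(1,2) w(1)] by simp_all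
  obtain X where X: "X \<in> SU" "X *v e 1 = v" "X *v e 2 = w" using SU_frame[OF uv(2) w(1) i(2)] by metis
  define R where "R = mat3 (- 1) 0 0 0 0 1 0 1 0"
  have R: "R \<in> SU" "R *v e 1 = - 1 *s e 1" "R *v e 3 = e 2"
    unfolding R_def by (auto simp: mat3_simps intro!: SU_I)
  define Y where "Y = X ** R"
  have Y: "Y \<in> SU" "Y *v e 1 = - 1 *s v" "Y *v e 3 = w"
    using X R by (simp_all only: Y_def mv_assoc mv_scale mult_SU)
  let ?x = "(M ** Y, mat_cnj Y)"
  have im: "mv ?x (base Tp) = a" "mv ?x (base Tq) = c"
    using Y M w by (simp_all add: matrix_mul_assoc[symmetric])
  have "line (M *v (- 1 *s v)) (- 1 *s v) = line u v" unfolding mv_scale i(1) by (simp add: line_def outer_def)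
  then have im2: "mv ?x (base Td) = b" using Y uv by (simp add: mv_assoc)
  have "\<gamma> = {a, b, c}"
  proof
    show "\<gamma> \<subseteq> {a, b, c}"
    proof
      fix y assume y: "y \<in> \<gamma>"
      have "vtype y = vtype a \<or> vtype y = vtype b \<or> vtype y = vtype c"
        using abc by (cases "vtype y") auto
      then show "y \<in> {a, b, c}" using inj_onD[OF model.inj_flags[OF g(1)]] y abc(1-3) by blast
    qed
  qed (use abc in auto)
  moreover have "mv ?x ` range base = {a, b, c}"
    unfolding pdq_UNIV image_insert im im2 by auto
  ultimately show ?thesis using that[of ?x] M Y by simp
qed

lemma all_pdq: "(\<forall>i. P i) \<longleftrightarrow> P Tp \<and> P Td \<and> P Tq"
  using pdq.exhaust by metis

lemma Z_group_iff: "z \<in> Z_group \<longleftrightarrow> z \<in> carrier SS \<and> (\<forall>i. mv z (base i) = base i) \<and> (\<forall>x\<in>carrier SS. z \<otimes>\<^bsub>SS\<^esub> x = x \<otimes>\<^bsub>SS\<^esub> z)"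
  unfolding Z_group_def K_group_stabilizer all_pdq Int_iff mem_Collect_eq by blast

lemma base_orbit:
  assumes v: "v \<in> vertices" obtains x i where "x \<in> carrier SS" "v = mv x (base i)"
proof -
  obtain \<gamma> where \<gamma>: "\<gamma> \<in> flags vertices inc" "{v} \<subseteq> \<gamma>" "vtype ` \<gamma> = UNIV"
    using model.extend_full[of "{v}"] v by auto
  then have "\<gamma> \<in> chambers (flags vertices inc)" by (simp add: model.chambers_flags)
  then obtain x where "x \<in> carrier SS" "\<gamma> = mv x ` range base" by (rule chamber_from_base)
  then show ?thesis using \<gamma>(2) that by auto
qed

text \<open>A central element that fixes the base vertices fixes their orbits.\<close>

lemma Z_group_trivial:
  assumes z: "z \<in> Z_group" and v: "v \<in> vertices" shows "mv z v = v"
proof -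
  obtain x i where x: "x \<in> carrier SS" "v = mv x (base i)" using v by (rule base_orbit)
  have "mv z v = mv (z \<otimes>\<^bsub>SS\<^esub> x) (base i)" by (simp only: mv_mult x)
  also have "z \<otimes>\<^bsub>SS\<^esub> x = x \<otimes>\<^bsub>SS\<^esub> z" using z x(1) unfolding Z_group_iff by blast
  also have "mv (x \<otimes>\<^bsub>SS\<^esub> z) (base i) = mv x (mv z (base i))" by (rule mv_mult)
  also have "mv z (base i) = base i" using z unfolding Z_group_iff by blast
  finally show ?thesis unfolding x(2)[symmetric] .
qed

lemma Z_group_normal: "Z_group \<lhd> SS"
proof -
  interpret S: group SS by (rule group_SS)
  have sub: "subgroup Z_group SS"
  proof
    show "Z_group \<subseteq> carrier SS" by (auto simp only: Z_group_iff)
    show "\<one>\<^bsub>SS\<^esub> \<in> Z_group" by (simp add: Z_group_iff mv_one[simplified])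
    fix x y assume x: "x \<in> Z_group" and y: "y \<in> Z_group"
    have xc: "x \<in> carrier SS" "y \<in> carrier SS" using x y by (auto simp only: Z_group_iff)
    have "(x \<otimes>\<^bsub>SS\<^esub> y) \<otimes>\<^bsub>SS\<^esub> a = a \<otimes>\<^bsub>SS\<^esub> (x \<otimes>\<^bsub>SS\<^esub> y)" if "a \<in> carrier SS" for a
    proof -
      have c: "x \<otimes>\<^bsub>SS\<^esub> a = a \<otimes>\<^bsub>SS\<^esub> x" "y \<otimes>\<^bsub>SS\<^esub> a = a \<otimes>\<^bsub>SS\<^esub> y" using x y that unfolding Z_group_iff by blast+
      have "(x \<otimes>\<^bsub>SS\<^esub> y) \<otimes>\<^bsub>SS\<^esub> a = (x \<otimes>\<^bsub>SS\<^esub> a) \<otimes>\<^bsub>SS\<^esub> y"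
        by (simp only: S.m_assoc[OF xc that] S.m_assoc[OF xc(1) that xc(2)] c(2))
      then show ?thesis by (simp only: c(1) S.m_assoc[OF that xc])
    qed
    then show "x \<otimes>\<^bsub>SS\<^esub> y \<in> Z_group"
      using x y S.m_closed[OF xc] unfolding Z_group_iff mv_mult by metis
  next
    fix x assume x: "x \<in> Z_group"
    have xc: "x \<in> carrier SS" using x by (auto simp only: Z_group_iff)
    have "mv (inv\<^bsub>SS\<^esub> x) (base i) = base i" for i
    proof -
      have "mv (inv\<^bsub>SS\<^esub> x) (mv x (base i)) = base i"
        using S.l_inv[OF xc] by (simp only: mv_mult[symmetric] mv_one)
      then show ?thesis using x by (simp only: Z_group_iff)
    qed
    moreover have "inv\<^bsub>SS\<^esub> x \<otimes>\<^bsub>SS\<^esub> a = a \<otimes>\<^bsub>SS\<^esub> inv\<^bsub>SS\<^esub> x" if "a \<in> carrier SS" for a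
    proof -
      have c: "x \<otimes>\<^bsub>SS\<^esub> a = a \<otimes>\<^bsub>SS\<^esub> x" using x that unfolding Z_group_iff by blast
      note ic = S.inv_closed[OF xc]
      have "inv\<^bsub>SS\<^esub> x \<otimes>\<^bsub>SS\<^esub> a = inv\<^bsub>SS\<^esub> x \<otimes>\<^bsub>SS\<^esub> ((a \<otimes>\<^bsub>SS\<^esub> x) \<otimes>\<^bsub>SS\<^esub> inv\<^bsub>SS\<^esub> x)"
        by (simp only: S.m_assoc[OF that xc ic] S.r_inv[OF xc] S.r_one[OF that])
      also have "\<dots> = inv\<^bsub>SS\<^esub> x \<otimes>\<^bsub>SS\<^esub> (x \<otimes>\<^bsub>SS\<^esub> (a \<otimes>\<^bsub>SS\<^esub> inv\<^bsub>SS\<^esub> x))"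
        by (simp only: c[symmetric] S.m_assoc[OF xc that ic])
      also have "\<dots> = a \<otimes>\<^bsub>SS\<^esub> inv\<^bsub>SS\<^esub> x"
        by (rule S.inv_cancel(1)[OF xc S.m_closed[OF that ic]])
      finally show ?thesis .
    qed
    ultimately show "inv\<^bsub>SS\<^esub> x \<in> Z_group" using S.inv_closed[OF xc] unfolding Z_group_iff by blast
  qed
  show ?thesis
  proof (rule S.normal_invI[OF sub])
    fix x h assume x: "x \<in> carrier SS" and h: "h \<in> Z_group"
    have hc: "h \<in> carrier SS" using h by (auto simp only: Z_group_iff)
    have "x \<otimes>\<^bsub>SS\<^esub> h \<otimes>\<^bsub>SS\<^esub> inv\<^bsub>SS\<^esub> x = h"
    proof -
      have "x \<otimes>\<^bsub>SS\<^esub> h = h \<otimes>\<^bsub>SS\<^esub> x" using h x unfolding Z_group_iff by metis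
      then show ?thesis by (simp only: S.m_assoc[OF hc x S.inv_closed[OF x]] S.r_inv[OF x] S.r_one[OF hc])
    qed
    then show "x \<otimes>\<^bsub>SS\<^esub> h \<otimes>\<^bsub>SS\<^esub> inv\<^bsub>SS\<^esub> x \<in> Z_group" using h by simp
  qed
qed

text \<open>Commuting with a diagonal sign matrix forces the off-diagonal entries in one column
  to vanish.\<close>

lemma centre_fixes_axes:
  assumes P: "P \<in> SU" "\<And>M. M \<in> SU \<Longrightarrow> P ** M = M ** P"
  shows "\<exists>c. P *v e 1 = c *s e 1" "\<exists>c. P *v e 3 = c *s e 3"
proof -
  have m: "mat3 1 0 0 0 (-1) 0 0 0 (-1) \<in> SU" "mat3 (-1) 0 0 0 (-1) 0 0 0 1 \<in> SU"
    by (auto simp: mat3_simps intro!: SU_I)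
  have "P ** mat3 1 0 0 0 (-1) 0 0 0 (-1) = mat3 1 0 0 0 (-1) 0 0 0 (-1) ** P"
    "P ** mat3 (-1) 0 0 0 (-1) 0 0 0 1 = mat3 (-1) 0 0 0 (-1) 0 0 0 1 ** P"
    using P(2) m by blast+
  then show "\<exists>c. P *v e 1 = c *s e 1" "\<exists>c. P *v e 3 = c *s e 3"
    unfolding mv_e1 mv_e3 by (simp_all add: vec_eq_iff forall_3 matrix_matrix_mult_def sum_3)
qed

text \<open>The quotient of the two elements fixes the plane \<open>1\<close>, so it has the
  form \<open>(P, conj P)\<close>; as it fixes all planes, \<open>P\<close> is central in
  SU(3).\<close>

lemma planes_separate:
  assumes x: "x \<in> carrier SS" and y: "y \<in> carrier SS"
    and eq: "\<And>M. M \<in> SU \<Longrightarrow> mv x (plane M) = mv y (plane M)"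
  shows "inv\<^bsub>SS\<^esub> y \<otimes>\<^bsub>SS\<^esub> x \<in> Z_group"
proof -
  interpret S: group SS by (rule group_SS)
  define z where "z = inv\<^bsub>SS\<^esub> y \<otimes>\<^bsub>SS\<^esub> x"
  have zc: "z \<in> carrier SS" unfolding z_def using x y by (intro S.m_closed S.inv_closed)
  then obtain P R where z: "z = (P, R)" "P \<in> SU" "R \<in> SU" by auto
  have fixpl: "mv z (plane M) = plane M" if M: "M \<in> SU" for M
  proof -
    have "mv z (plane M) = mv (inv\<^bsub>SS\<^esub> y) (mv y (plane M))" using eq[OF M] by (simp only: z_def mv_mult)
    also have "\<dots> = plane M" using S.l_inv[OF y] by (simp only: mv_mult[symmetric] mv_one)
    finally show ?thesis .
  qed
  have PM: "P ** M ** ct (mat_cnj R) = M" if "M \<in> SU" for M using fixpl[OF that] by (simp add: z)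
  have PR: "P = mat_cnj R" using PM[of "mat 1"] z by (metis SU_ct_simps(6) matrix_mul_lid matrix_mul_rid one_SU mat_cnj_SU)
  have comm: "P ** M = M ** P" if "M \<in> SU" for M
    using PM[OF that] z by (metis PR SU_ct_simps(6))
  have RP: "R = mat_cnj P" using PR by simp
  have commR: "R ** M = M ** R" if "M \<in> SU" for M
    using comm[of "mat_cnj M"] that unfolding RP by (metis mat_cnj_SU mat_cnj_cnj mat_cnj_mult)
  have "mv z (base i) = base i" for i
  proof (cases i)
    case Tp then show ?thesis using fixpl by simp
  next
    case Td
    obtain c where c: "P *v e 1 = c *s e 1" using centre_fixes_axes(1)[OF z(2) comm] by blast
    have "line (c *s e 1) (c *s e 1) = line (e 1) (e 1)"
      using unit_proportional[OF _ _ c] z by (simp add: line_def outer_phase)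
    then show ?thesis using Td c by (simp add: z PR[symmetric])
  next
    case Tq
    obtain c where c: "P *v e 3 = c *s e 3" using centre_fixes_axes(2)[OF z(2) comm] by blast
    have "point (c *s e 3) = point (e 3)"
      using unit_proportional[OF _ _ c] z by (simp add: point_def outer_phase)
    then show ?thesis using Tq c by (simp add: z PR[symmetric])
  qed
  moreover have "z \<otimes>\<^bsub>SS\<^esub> a = a \<otimes>\<^bsub>SS\<^esub> z" if "a \<in> carrier SS" for a
    using that comm commR by (cases a) (simp add: z)
  ultimately show ?thesis using zc unfolding Z_group_iff z_def[symmetric] by blast
qed

section \<open>Compactness and the quotient topology\<close>

lemma topspace_quotient_topology [simp]: "topspace (quotient_topology X f) = f ` topspace X"
proof -
  have "openin (quotient_topology X f) (f ` topspace X)"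
    by (simp add: openin_quotient_topology) (metis (no_types, lifting) Collect_cong image_eqI mem_Collect_eq openin_topspace Collect_mem_eq)
  then show ?thesis
    using openin_subset[of "quotient_topology X f"] openin_topspace[of "quotient_topology X f"]
    unfolding openin_quotient_topology by blast
qed

lemma quotient_map_quotient_topology: "quotient_map X (quotient_topology X f) f"
  unfolding quotient_map_def by (auto simp: openin_quotient_topology)

lemma continuous_on_matrix_mult [continuous_intros]:
  fixes f :: "'a::topological_space \<Rightarrow> complex^'n^'m" and g :: "'a \<Rightarrow> complex^'k^'n"
  assumes "continuous_on S f" "continuous_on S g"
  shows "continuous_on S (\<lambda>x. f x ** g x)"
  unfolding matrix_matrix_mult_def by (intro continuous_intros assms)

lemma continuous_on_transpose [continuous_intros]:
  fixes f :: "'a::topological_space \<Rightarrow> complex^'n^'m"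
  assumes "continuous_on S f" shows "continuous_on S (\<lambda>x. transpose (f x))"
  unfolding transpose_def by (intro continuous_intros assms)

lemma continuous_on_mat_cnj [continuous_intros]:
  fixes f :: "'a::topological_space \<Rightarrow> complex^'n^'m"
  assumes "continuous_on S f" shows "continuous_on S (\<lambda>x. mat_cnj (f x))"
  unfolding mat_cnj_def by (intro continuous_intros assms)

lemma continuous_on_ct [continuous_intros]:
  fixes f :: "'a::topological_space \<Rightarrow> complex^'n^'m"
  assumes "continuous_on S f" shows "continuous_on S (\<lambda>x. ct (f x))"
  unfolding ct_def by (intro continuous_intros assms)

lemma compact_SU: "compact SU"
proof -
  have row: "norm (A $ i) = 1" if A: "A \<in> SU" for A i
  proof -
    have "(A ** ct A) $ i $ i = 1" using A by (simp add: mat_def)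
    then have "herm (A $ i) (A $ i) = 1" by (simp add: matrix_matrix_mult_def herm_def)
    then show ?thesis by (simp add: herm_self_1)
  qed
  have "norm A \<le> 3" if A: "A \<in> SU" for A
  proof -
    have "norm A \<le> (\<Sum>i\<in>UNIV. norm (A $ i))" unfolding norm_vec_def[of A] by (rule L2_set_le_sum) simp
    then show ?thesis by (simp add: row[OF A])
  qed
  then have "bounded SU" by (auto simp: bounded_iff)
  have eq: "SU = {A. ct A ** A = mat 1} \<inter> {A. det A = 1}"
    by (auto simp: SU_det intro: SU_I)
  have "closed {A :: complex^3^3. ct A ** A = mat 1}" "closed {A :: complex^3^3. det A = 1}"
    unfolding det_3 by (intro closed_Collect_eq continuous_intros)+
  then have "closed SU" by (subst eq) (rule closed_Int)
  with \<open>bounded SU\<close> show ?thesis by (simp add: compact_eq_bounded_closed)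
qed

abbreviation "TS \<equiv> top_of_set (carrier SS)"

lemma compact_TS: "compact_space TS"
  by (simp add: compact_space_subtopology compactin_euclidean_iff compact_Times compact_SU)

definition "GG = SS Mod Z_group"
definition "TG = quotient_topology TS proj_Z"

lemma carrier_GG: "carrier GG = proj_Z ` carrier SS"
  unfolding GG_def carrier_FactGroup proj_Z_def[abs_def] ..

lemma group_GG: "group GG"
  unfolding GG_def by (rule normal.factorgroup_is_group[OF Z_group_normal])

lemma proj_hom: "proj_Z \<in> hom SS GG"
  using normal.r_coset_hom_Mod[OF Z_group_normal] unfolding GG_def proj_Z_def[abs_def] .

lemma proj_mult: "x \<in> carrier SS \<Longrightarrow> y \<in> carrier SS \<Longrightarrow> proj_Z x \<otimes>\<^bsub>GG\<^esub> proj_Z y = proj_Z (x \<otimes>\<^bsub>SS\<^esub> y)"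
  using hom_mult[OF proj_hom] by simp

lemma proj_closed: "x \<in> carrier SS \<Longrightarrow> proj_Z x \<in> carrier GG"
  by (auto simp: carrier_GG)

lemma proj_inv: "x \<in> carrier SS \<Longrightarrow> inv\<^bsub>GG\<^esub> (proj_Z x) = proj_Z (inv\<^bsub>SS\<^esub> x)"
  using group_hom.hom_inv[of SS GG proj_Z x] proj_hom group_SS group_GG
  by (simp add: group_hom_def group_hom_axioms_def del: SS_simps)

lemma proj_eq_iff:
  assumes x: "x \<in> carrier SS" and y: "y \<in> carrier SS"
  shows "proj_Z x = proj_Z y \<longleftrightarrow> inv\<^bsub>SS\<^esub> y \<otimes>\<^bsub>SS\<^esub> x \<in> Z_group"
proof -
  interpret S: group SS by (rule group_SS)
  interpret Z: normal Z_group SS by (rule Z_group_normal)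
  have "proj_Z x = proj_Z y \<longleftrightarrow> x <#\<^bsub>SS\<^esub> Z_group = y <#\<^bsub>SS\<^esub> Z_group"
    unfolding proj_Z_def bspec[OF Z.coset_eq x] bspec[OF Z.coset_eq y] ..
  also have "\<dots> \<longleftrightarrow> inv\<^bsub>SS\<^esub> y \<otimes>\<^bsub>SS\<^esub> x \<in> Z_group"
  proof
    assume "x <#\<^bsub>SS\<^esub> Z_group = y <#\<^bsub>SS\<^esub> Z_group"
    then have "x \<in> y <#\<^bsub>SS\<^esub> Z_group" using S.r_one[OF x] Z.one_closed unfolding l_coset_def by force
    then obtain z where z: "z \<in> Z_group" "x = y \<otimes>\<^bsub>SS\<^esub> z" unfolding l_coset_def by blast
    have "inv\<^bsub>SS\<^esub> y \<otimes>\<^bsub>SS\<^esub> x = z" unfolding z(2) by (rule S.inv_cancel(1)[OF y Z.mem_carrier[OF z(1)]])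
    then show "inv\<^bsub>SS\<^esub> y \<otimes>\<^bsub>SS\<^esub> x \<in> Z_group" using z(1) by simp
  next
    assume z: "inv\<^bsub>SS\<^esub> y \<otimes>\<^bsub>SS\<^esub> x \<in> Z_group"
    have "x = y \<otimes>\<^bsub>SS\<^esub> (inv\<^bsub>SS\<^esub> y \<otimes>\<^bsub>SS\<^esub> x)" by (rule S.inv_cancel(2)[OF y x, symmetric])
    then have "x \<in> y <#\<^bsub>SS\<^esub> Z_group" using z unfolding l_coset_def by blast
    then show "x <#\<^bsub>SS\<^esub> Z_group = y <#\<^bsub>SS\<^esub> Z_group"
      using S.l_repr_independence[OF _ y Z.is_subgroup] by simp
  qed
  finally show ?thesis .
qed

lemma quotient_map_proj: "quotient_map TS TG proj_Z"
  unfolding TG_def by (rule quotient_map_quotient_topology)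

lemma topspace_TG: "topspace TG = carrier GG"
  by (simp add: TG_def carrier_GG)

lemma compact_TG: "compact_space TG"
proof -
  have "compactin TG (proj_Z ` topspace TS)"
    using compact_TS quotient_imp_continuous_map[OF quotient_map_proj]
    unfolding compact_space_def by (rule image_compactin)
  then show ?thesis
    unfolding compact_space_def quotient_imp_surjective_map[OF quotient_map_proj] .
qed

definition actG :: "mat_pair set \<Rightarrow> mat_pair set set \<Rightarrow> mat_pair set set" where
  "actG g = (\<lambda>v\<in>vertices. mv (SOME x. x \<in> carrier SS \<and> proj_Z x = g) v)"

lemma mv_cong:
  assumes x: "x \<in> carrier SS" and y: "y \<in> carrier SS" and eq: "proj_Z x = proj_Z y" and v: "v \<in> vertices"
  shows "mv x v = mv y v"
proof -
  interpret S: group SS by (rule group_SS)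
  have z: "inv\<^bsub>SS\<^esub> y \<otimes>\<^bsub>SS\<^esub> x \<in> Z_group" using proj_eq_iff[OF x y] eq by simp
  have "mv x v = mv (y \<otimes>\<^bsub>SS\<^esub> (inv\<^bsub>SS\<^esub> y \<otimes>\<^bsub>SS\<^esub> x)) v" using S.inv_cancel(2)[OF y x] by simp
  also have "\<dots> = mv y v" by (simp only: mv_mult[of y] Z_group_trivial[OF z v])
  finally show ?thesis .
qed

lemma actG_proj: "x \<in> carrier SS \<Longrightarrow> v \<in> vertices \<Longrightarrow> actG (proj_Z x) v = mv x v"
  unfolding actG_def
  by (simp del: SS_simps) (rule someI2[of _ x], blast, rule mv_cong, blast+)

text \<open>The functions \<open>(A, B) \<mapsto> A M B\<^sup>T\<close> are continuous on the quotient and separate its points.\<close>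

lemma Hausdorff_TG: "Hausdorff_space TG"
  unfolding Hausdorff_space_def topspace_TG
proof (intro allI impI, elim conjE)
  fix g h assume g: "g \<in> carrier GG" and h: "h \<in> carrier GG" and ne: "g \<noteq> h"
  obtain x y where x: "x \<in> carrier SS" "g = proj_Z x" and y: "y \<in> carrier SS" "h = proj_Z y"
    using g h by (auto simp: carrier_GG)
  have "inv\<^bsub>SS\<^esub> y \<otimes>\<^bsub>SS\<^esub> x \<notin> Z_group" using proj_eq_iff[OF x(1) y(1)] ne x y by simp
  then obtain M where M: "M \<in> SU" "mv x (plane M) \<noteq> mv y (plane M)"
    using planes_separate[OF x(1) y(1)] by blast
  define F where "F x = fst x ** M ** transpose (snd x)" for x :: mat_pair
  have mvF: "mv a (plane M) = plane (F a)" for a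
    by (cases a) (simp add: F_def ct_cnj)
  have "F x \<noteq> F y" using M(2) unfolding mvF plane_eq_iff .
  from hausdorff[OF this] obtain U V
    where UV: "open U" "open V" "F x \<in> U" "F y \<in> V" "U \<inter> V = {}" by auto
  have cont: "continuous_map TS euclidean F"
    unfolding F_def by (simp add: continuous_on_fst continuous_on_snd) (intro continuous_intros)
  define Q where "Q W = proj_Z ` {a \<in> carrier SS. F a \<in> W}" for W
  have sat: "proj_Z a \<in> Q W \<longleftrightarrow> F a \<in> W" if "a \<in> carrier SS" for a W
  proof
    assume "proj_Z a \<in> Q W"
    then obtain b where b: "b \<in> carrier SS" "F b \<in> W" "proj_Z a = proj_Z b" by (auto simp: Q_def)
    have "plane (F a) = plane (F b)" using mv_cong[OF that b(1,3)] M by (simp flip: mvF)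
    then show "F a \<in> W" using b by simp
  qed (use that in \<open>auto simp: Q_def\<close>)
  have op: "openin TG (Q W)" if "open W" for W
    unfolding TG_def openin_quotient_topology
  proof
    show "Q W \<subseteq> proj_Z ` topspace TS" by (auto simp: Q_def)
    have "{a \<in> topspace TS. proj_Z a \<in> Q W} = {a \<in> topspace TS. F a \<in> W}" using sat by auto
    then show "openin TS {a \<in> topspace TS. proj_Z a \<in> Q W}"
      using openin_continuous_map_preimage[OF cont, of W] that by simp
  qed
  have "disjnt (Q U) (Q V)"
    unfolding disjnt_iff
  proof (intro allI notI, elim conjE)
    fix k assume k: "k \<in> Q U" "k \<in> Q V"
    then obtain a where "a \<in> carrier SS" "k = proj_Z a" by (auto simp: Q_def)
    then show False using sat k UV(5) by blast
  qed
  moreover have "g \<in> Q U" "h \<in> Q V" using sat x y UV by auto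
  ultimately show "\<exists>U V. openin TG U \<and> openin TG V \<and> g \<in> U \<and> h \<in> V \<and> disjnt U V"
    using op UV by blast
qed

lemma topological_group_GG: "topological_group GG TG"
  unfolding topological_group_def
proof (intro conjI)
  show "group GG" by (rule group_GG)
  show "topspace TG = carrier GG" by (rule topspace_TG)
  have cp: "continuous_map TS TG proj_Z" using quotient_map_proj by (rule quotient_imp_continuous_map)
  \<comment> \<open>The square of the projection is again a quotient map, being a continuous map from a compact space onto a Hausdorff space.\<close>
  let ?pp = "\<lambda>(x, y). (proj_Z x, proj_Z y)"
  have cpp: "continuous_map (prod_topology TS TS) (prod_topology TG TG) ?pp"
    unfolding continuous_map_prod_top using cp by blast
  have qpp: "quotient_map (prod_topology TS TS) (prod_topology TG TG) ?pp"
  proof (rule continuous_closed_imp_quotient_map[OF cpp])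
    show "closed_map (prod_topology TS TS) (prod_topology TG TG) ?pp"
    proof (rule T1_Spaces.continuous_imp_closed_map[OF cpp])
      show "compact_space (prod_topology TS TS)"
        unfolding compact_space_prod_topology using compact_TS by blast
      show "Hausdorff_space (prod_topology TG TG)"
        unfolding Hausdorff_space_prod_topology using Hausdorff_TG by blast
    qed
    show "?pp ` topspace (prod_topology TS TS) = topspace (prod_topology TG TG)"
      by (force simp: topspace_TG carrier_GG)
  qed
  have cm: "continuous_map (prod_topology TS TS) TS (\<lambda>(x, y). x \<otimes>\<^bsub>SS\<^esub> y)"
  proof -
    have "continuous_on ((SU \<times> SU) \<times> (SU \<times> SU))
        (\<lambda>p. (fst (fst p) ** fst (snd p), snd (fst p) ** snd (snd p)) :: mat_pair)"
      by (intro continuous_intros)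
    then have "continuous_map (top_of_set ((SU \<times> SU) \<times> (SU \<times> SU))) TS
        (\<lambda>p. (fst (fst p) ** fst (snd p), snd (fst p) ** snd (snd p)))"
      by (auto simp: continuous_map_in_subtopology)
    moreover have "prod_topology TS TS = top_of_set ((SU \<times> SU) \<times> (SU \<times> SU))"
      by simp
    ultimately have "continuous_map (prod_topology TS TS) TS
        (\<lambda>p. (fst (fst p) ** fst (snd p), snd (fst p) ** snd (snd p)))" by metis
    then show ?thesis by (rule continuous_map_eq) auto
  qed
  show "continuous_map (prod_topology TG TG) TG (\<lambda>(x, y). x \<otimes>\<^bsub>GG\<^esub> y)"
  proof (rule continuous_compose_quotient_map[OF qpp])
    have "continuous_map (prod_topology TS TS) TG (proj_Z \<circ> (\<lambda>(x, y). x \<otimes>\<^bsub>SS\<^esub> y))"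
      using cm cp by (rule continuous_map_compose)
    then show "continuous_map (prod_topology TS TS) TG ((\<lambda>(x, y). x \<otimes>\<^bsub>GG\<^esub> y) \<circ> ?pp)"
      by (rule continuous_map_eq) (auto simp: proj_mult simp del: SS_simps(2))
  qed
  show "continuous_map TG TG (\<lambda>x. inv\<^bsub>GG\<^esub> x)"
  proof (rule continuous_compose_quotient_map[OF quotient_map_proj])
    have "continuous_map TS TS (\<lambda>x. (ct (fst x), ct (snd x)))"
      by (simp add: continuous_map_in_subtopology) (intro conjI continuous_intros, auto)
    then have "continuous_map TS TG (proj_Z \<circ> (\<lambda>x. (ct (fst x), ct (snd x))))"
      using cp by (rule continuous_map_compose)
    then show "continuous_map TS TG ((\<lambda>x. inv\<^bsub>GG\<^esub> x) \<circ> proj_Z)"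
      by (rule continuous_map_eq) (auto simp: proj_inv)
  qed
qed

section \<open>The homogeneous geometry\<close>

definition flat_geometry :: "(mat_pair set, mat_pair set set, pdq) group_geometry" where
  "flat_geometry = \<lparr>grp = GG, top_grp = TG, cplx = flags vertices inc, type_fun = vtype, act = actG\<rparr>"

lemma flat_geometry_simps [simp]:
  "grp flat_geometry = GG" "top_grp flat_geometry = TG" "cplx flat_geometry = flags vertices inc"
  "type_fun flat_geometry = vtype" "act flat_geometry = actG"
  by (simp_all add: flat_geometry_def)

lemma GG_cases:
  assumes "g \<in> carrier GG" obtains x where "x \<in> carrier SS" "g = proj_Z x"
  using assms by (auto simp: carrier_GG)

lemma mv_inverse: "x \<in> carrier SS \<Longrightarrow> mv (inv\<^bsub>SS\<^esub> x) (mv x v) = v" "x \<in> carrier SS \<Longrightarrow> mv x (mv (inv\<^bsub>SS\<^esub> x) v) = v"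
  using group.l_inv[OF group_SS, of x] group.r_inv[OF group_SS, of x]
  by (simp_all only: mv_mult[symmetric] mv_one)

lemma actG_Bij: assumes "g \<in> carrier GG" shows "actG g \<in> Bij vertices"
proof -
  obtain x where x: "x \<in> carrier SS" "g = proj_Z x" using assms by (rule GG_cases)
  have ix: "inv\<^bsub>SS\<^esub> x \<in> carrier SS" using group.inv_closed[OF group_SS x(1)] .
  have "bij_betw (mv x) vertices vertices"
    by (rule bij_betwI[where g = "mv (inv\<^bsub>SS\<^esub> x)"]) (use x ix mv_vertices mv_inverse in auto)
  then have "bij_betw (actG g) vertices vertices"
    using actG_proj[OF x(1)] x(2) by (metis (no_types, lifting) bij_betw_cong)
  then show ?thesis by (simp add: Bij_def actG_def)
qed

lemma actG_hom: "actG \<in> hom GG (BijGroup vertices)"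
proof (rule homI)
  show "actG g \<in> carrier (BijGroup vertices)" if "g \<in> carrier GG" for g
    using actG_Bij[OF that] by (simp add: BijGroup_def)
  fix g h assume gh: "g \<in> carrier GG" "h \<in> carrier GG"
  obtain x y where x: "x \<in> carrier SS" "g = proj_Z x" and y: "y \<in> carrier SS" "h = proj_Z y"
    using gh GG_cases by metis
  have xy: "x \<otimes>\<^bsub>SS\<^esub> y \<in> carrier SS" using group_SS x y by (metis group.subgroup_self subgroup.m_closed)
  have "actG (g \<otimes>\<^bsub>GG\<^esub> h) v = compose vertices (actG g) (actG h) v" for v
  proof (cases "v \<in> vertices")
    case True
    then show ?thesis
      using x y xy mv_vertices(1)[OF y(1) True]
      by (simp add: proj_mult compose_eq actG_proj mv_mult del: SS_simps)
  qed (simp add: actG_def compose_def)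
  then show "actG (g \<otimes>\<^bsub>GG\<^esub> h) = actG g \<otimes>\<^bsub>BijGroup vertices\<^esub> actG h"
    using actG_Bij gh by (simp add: BijGroup_def fun_eq_iff)
qed

lemma group_action_GG: "group_action GG vertices actG"
  using actG_hom group_GG group_BijGroup
  by (simp add: group_action_def group_hom_def group_hom_axioms_def)

lemma image_flags:
  assumes x: "x \<in> carrier SS" and a: "\<alpha> \<in> flags vertices inc" shows "mv x ` \<alpha> \<in> flags vertices inc"
proof -
  have f: "finite \<alpha>" "\<alpha> \<subseteq> vertices" and i: "\<And>v w. v \<in> \<alpha> \<Longrightarrow> w \<in> \<alpha> \<Longrightarrow> v \<noteq> w \<Longrightarrow> inc v w"
    using a by (auto simp: flags_def)
  have "mv x ` \<alpha> \<subseteq> vertices" using f(2) mv_vertices(1)[OF x] by blast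
  moreover have "inc (mv x v) (mv x w)" if "v \<in> \<alpha>" "w \<in> \<alpha>" "mv x v \<noteq> mv x w" for v w
    using that by (intro mv_inc[OF x] i) auto
  ultimately show ?thesis using f(1) by (simp add: flags_def)
qed

lemma actG_image:
  assumes "x \<in> carrier SS" "\<alpha> \<subseteq> vertices" shows "actG (proj_Z x) ` \<alpha> = mv x ` \<alpha>"
  by (rule image_cong) (use assms actG_proj in auto)

lemma acts_GG: "acts_by_automorphisms flat_geometry"
  unfolding acts_by_automorphisms_def flat_geometry_simps Union_flags
proof (intro conjI ballI)
  show "group_action GG vertices actG" by (rule group_action_GG)
  fix g assume "g \<in> carrier GG"
  then obtain x where x: "x \<in> carrier SS" "g = proj_Z x" by (rule GG_cases)
  show "actG g ` \<alpha> \<in> flags vertices inc" if "\<alpha> \<in> flags vertices inc" for \<alpha>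
    using image_flags[OF x(1) that] actG_image[OF x(1) flags_carrier[OF that]] x(2) by simp
  show "vtype (actG g v) = vtype v" if "v \<in> vertices" for v
    using actG_proj[OF x(1) that] mv_vertices(2)[OF x(1) that] x(2) by simp
qed

lemma base_chamber: "range base \<in> chambers (flags vertices inc)"
proof -
  have "range base \<in> flags vertices inc"
    using inc_simps[of "mat 1" "e 1" "e 1" "e 3"] by (auto simp: flags_def pdq_UNIV)
  moreover have "vtype ` range base = UNIV" by (simp add: image_image)
  ultimately show ?thesis by (simp add: model.chambers_flags)
qed

lemma chamber_transitive:
  assumes c: "c \<in> chambers (flags vertices inc)" and d: "d \<in> chambers (flags vertices inc)"
  shows "\<exists>g\<in>carrier GG. actG g ` c = d"
proof -
  obtain x where x: "x \<in> carrier SS" "c = mv x ` range base" using c by (rule chamber_from_base)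
  obtain y where y: "y \<in> carrier SS" "d = mv y ` range base" using d by (rule chamber_from_base)
  have ix: "inv\<^bsub>SS\<^esub> x \<in> carrier SS" using group.inv_closed[OF group_SS x(1)] .
  have z: "y \<otimes>\<^bsub>SS\<^esub> inv\<^bsub>SS\<^esub> x \<in> carrier SS" using group_SS ix y by (metis group.subgroup_self subgroup.m_closed)
  have "c \<subseteq> vertices" using c by (auto simp: model.chambers_flags dest: flags_carrier)
  then have "actG (proj_Z (y \<otimes>\<^bsub>SS\<^esub> inv\<^bsub>SS\<^esub> x)) ` c = mv (y \<otimes>\<^bsub>SS\<^esub> inv\<^bsub>SS\<^esub> x) ` c" by (rule actG_image[OF z])
  also have "\<dots> = d" by (simp add: x(2) y(2) image_image mv_mult mv_inverse(1)[OF x(1)] del: SS_simps)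
  finally show ?thesis using proj_closed[OF z] by blast
qed

lemma stabilizer_pointwise:
  assumes g: "g \<in> carrier GG" and a: "\<alpha> \<in> flags vertices inc"
  shows "actG g ` \<alpha> = \<alpha> \<longleftrightarrow> (\<forall>v\<in>\<alpha>. actG g v = v)"
proof
  assume e: "actG g ` \<alpha> = \<alpha>"
  obtain x where x: "x \<in> carrier SS" "g = proj_Z x" using g by (rule GG_cases)
  show "\<forall>v\<in>\<alpha>. actG g v = v"
  proof
    fix v assume v: "v \<in> \<alpha>"
    then have vV: "v \<in> vertices" using flags_carrier[OF a] by auto
    have "vtype (actG g v) = vtype v"
      using actG_proj[OF x(1) vV] mv_vertices(2)[OF x(1) vV] x(2) by simp
    moreover have "actG g v \<in> \<alpha>" using e v by blast
    ultimately show "actG g v = v" using model.inj_flags[OF a] v by (simp add: inj_on_eq_iff)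
  qed
qed (simp add: image_def)

lemma simplex_stabilizer_flat:
  assumes a: "\<alpha> \<in> flags vertices inc"
  shows "simplex_stabilizer flat_geometry \<alpha> = {g \<in> carrier GG. \<forall>v\<in>\<alpha>. actG g v = v}"
  unfolding simplex_stabilizer_def stabilizer_def flat_geometry_simps
  by (rule Collect_cong, rule conj_cong[OF refl], rule stabilizer_pointwise[OF _ a])

lemma stabilizer_closed:
  assumes a: "\<alpha> \<in> flags vertices inc"
  shows "closedin TG (simplex_stabilizer flat_geometry \<alpha>)"
proof -
  have vert: "closedin TG {g \<in> carrier GG. actG g v = v}" if v: "v \<in> vertices" for v
  proof -
    obtain N where N: "v = {{N}}" using v by (auto simp: vertices_def plane_def line_def point_def)
    have eq: "{x \<in> topspace TS. proj_Z x \<in> {g \<in> carrier GG. actG g v = v}} = {x \<in> topspace TS. act2 x N \<in> {N}}"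
      using v proj_closed actG_proj[OF _ v] by (auto simp: mv_def N)
    have "continuous_map TS euclidean (\<lambda>x. act2 x N)"
      unfolding act2_def by (simp add: continuous_on_fst continuous_on_snd) (intro continuous_intros)
    then have "closedin TS {x \<in> topspace TS. act2 x N \<in> {N}}"
      by (rule closedin_continuous_map_preimage) simp
    then have "closedin TS {x \<in> topspace TS. proj_Z x \<in> {g \<in> carrier GG. actG g v = v}}"
      unfolding eq .
    then show ?thesis
      by (rule quotient_map_closedin[THEN iffD1, OF quotient_map_proj, THEN conjunct2, rule_format, THEN iffD1, rotated])
        (auto simp: topspace_TG)
  qed
  have eq: "simplex_stabilizer flat_geometry \<alpha> =
      \<Inter>(insert (topspace TG) ((\<lambda>v. {g \<in> carrier GG. actG g v = v}) ` \<alpha>))"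
    unfolding simplex_stabilizer_flat[OF a] topspace_TG by blast
  show ?thesis
    unfolding eq
  proof (rule closedin_Inter)
    fix S assume "S \<in> insert (topspace TG) ((\<lambda>v. {g \<in> carrier GG. actG g v = v}) ` \<alpha>)"
    then consider "S = topspace TG" | v where "v \<in> \<alpha>" "S = {g \<in> carrier GG. actG g v = v}" by blast
    then show "closedin TG S"
    proof cases
      case 1
      then show ?thesis by simp
    next
      case 2
      then show ?thesis using vert[of v] flags_carrier[OF a] by blast
    qed
  qed simp
qed

lemma cocompact_GG: "cocompact GG TG H"
proof -
  let ?f = "\<lambda>g. g <#\<^bsub>GG\<^esub> H"
  have q: "quotient_map TG (quotient_topology TG ?f) ?f" by (rule quotient_map_quotient_topology)
  have "compactin (quotient_topology TG ?f) (?f ` topspace TG)"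
    using compact_TG quotient_imp_continuous_map[OF q] unfolding compact_space_def by (rule image_compactin)
  then show ?thesis
    unfolding cocompact_def compact_space_def topspace_quotient_topology .
qed

theorem flat_homogeneous: "homogeneous_compact_geometry UNIV C3_matrix flat_geometry"
  unfolding homogeneous_compact_geometry_def flat_geometry_simps
proof (intro conjI ballI)
  show "locally_compact_group GG TG"
    unfolding locally_compact_group_def
    using topological_group_GG Hausdorff_TG compact_imp_locally_compact_space[OF compact_TG] by blast
  show "geometry_of_type UNIV C3_matrix (flags vertices inc) vtype" by (rule model_geometry)
  show "acts_by_automorphisms flat_geometry" by (rule acts_GG)
  show "\<exists>g\<in>carrier GG. actG g ` c = d"
    if "c \<in> chambers (flags vertices inc)" "d \<in> chambers (flags vertices inc)" for c d
    using that by (rule chamber_transitive)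
  show "closedin TG (simplex_stabilizer flat_geometry \<alpha>)" if "\<alpha> \<in> flags vertices inc" for \<alpha>
    using that by (rule stabilizer_closed)
  show "cocompact GG TG (simplex_stabilizer flat_geometry \<alpha>)" for \<alpha>
    by (rule cocompact_GG)
qed

lemma flat_faithful: "faithful_action GG vertices actG"
proof -
  have "inj_on actG (carrier GG)"
  proof (rule inj_onI)
    fix g h assume gh: "g \<in> carrier GG" "h \<in> carrier GG" "actG g = actG h"
    obtain x y where x: "x \<in> carrier SS" "g = proj_Z x" and y: "y \<in> carrier SS" "h = proj_Z y"
      using gh GG_cases by metis
    have "inv\<^bsub>SS\<^esub> y \<otimes>\<^bsub>SS\<^esub> x \<in> Z_group"
    proof (rule planes_separate[OF x(1) y(1)])
      fix M assume "M \<in> SU"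
      then have V: "plane M \<in> vertices" by simp
      from gh(3) have "actG g (plane M) = actG h (plane M)" by (rule fun_cong)
      then show "mv x (plane M) = mv y (plane M)"
        unfolding x(2) y(2) actG_proj[OF x(1) V] actG_proj[OF y(1) V] .
    qed
    then show "g = h" unfolding x(2) y(2) proj_eq_iff[OF x(1) y(1)] .
  qed
  then show ?thesis using group_action_GG by (simp add: faithful_action_def faithful_action_axioms_def)
qed

subsection \<open>Connected panels\<close>

lemma actG_vertices: "g \<in> carrier GG \<Longrightarrow> v \<in> vertices \<Longrightarrow> actG g v \<in> vertices"
  using actG_Bij[of g] by (auto simp: Bij_def dest: bij_betwE)

lemma topspace_vertex_topology: "topspace (vertex_topology flat_geometry) = vertices"
proof -
  have "openin (vertex_topology flat_geometry) vertices"
    unfolding openin_vertex_topology flat_geometry_simps Union_flags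
  proof (intro conjI ballI subset_refl)
    fix v assume v: "v \<in> vertices"
    have "{g \<in> topspace TG. actG g v \<in> vertices} = topspace TG"
      using actG_vertices[OF _ v] by (auto simp: topspace_TG)
    then show "openin TG {g \<in> topspace TG. actG g v \<in> vertices}" by simp
  qed
  from openin_subset[OF this] show ?thesis
    using openin_vertex_topology[THEN iffD1, OF openin_topspace, THEN conjunct1, of flat_geometry]
    unfolding flat_geometry_simps Union_flags by (rule equalityI[rotated])
qed

lemma continuous_orbit_map:
  assumes v: "v \<in> vertices"
  shows "continuous_map TS (vertex_topology flat_geometry) (\<lambda>x. mv x v)"
proof -
  have "continuous_map TG (vertex_topology flat_geometry) (\<lambda>g. actG g v)"
    unfolding continuous_map topspace_vertex_topology
    using v actG_vertices[OF _ v] by (simp add: openin_vertex_topology topspace_TG image_subset_iff)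
  then have "continuous_map TS (vertex_topology flat_geometry) ((\<lambda>g. actG g v) \<circ> proj_Z)"
    using quotient_imp_continuous_map[OF quotient_map_proj] by (rule continuous_map_compose[rotated])
  then show ?thesis
  proof (rule continuous_map_eq)
    fix x assume "x \<in> topspace TS"
    then have "x \<in> carrier SS" by simp
    then show "((\<lambda>g. actG g v) \<circ> proj_Z) x = mv x v" unfolding o_apply by (rule actG_proj[OF _ v])
  qed
qed

lemma connectedin_orbit:
  assumes "connected C" "C \<subseteq> carrier SS" "v \<in> vertices"
  shows "connectedin (vertex_topology flat_geometry) ((\<lambda>x. mv x v) ` C)"
  using assms by (intro connectedin_continuous_map_image[OF continuous_orbit_map])
    (auto simp: connectedin_subtopology)

text \<open>Copies of SU(2) whose orbits are the panels.\<close>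

definition Sv :: "complex^3 \<Rightarrow> (complex^3^3) set" where
  "Sv v = {s \<in> SU. s *v v = v}"

text \<open>SU(2) is the unit sphere of \<open>\<complex>\<^sup>2\<close>.\<close>

lemma connected_Sv:
  assumes v: "unit v" shows "connected (Sv v)"
proof -
  let ?S = "sphere (0 :: complex \<times> complex) 1"
  have "connected ?S" by (rule connected_sphere) simp
  have cont: "continuous_on ?S (\<lambda>p. b1 (fst p) (snd p))"
  proof -
    have "continuous_on ?S (\<lambda>p. b1 (fst p) (snd p) $ i $ j)" for i j
      using exhaust_3[of i] exhaust_3[of j]
      by (elim disjE; simp add: b1_def; intro continuous_intros)
    then have "continuous_on ?S (\<lambda>p. \<chi> i j. b1 (fst p) (snd p) $ i $ j)"
      by (intro continuous_on_vec_lambda)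
    then show ?thesis by (simp add: vec_lambda_eta)
  qed
  have sph: "p \<in> ?S \<longleftrightarrow> fst p * cnj (fst p) + snd p * cnj (snd p) = 1" for p
  proof -
    have "p \<in> ?S \<longleftrightarrow> (cmod (fst p))\<^sup>2 + (cmod (snd p))\<^sup>2 = 1"
      by (simp add: norm_prod_def)
    also have "\<dots> \<longleftrightarrow> complex_of_real ((cmod (fst p))\<^sup>2 + (cmod (snd p))\<^sup>2) = of_real 1"
      by (simp only: of_real_eq_iff)
    also have "\<dots> \<longleftrightarrow> fst p * cnj (fst p) + snd p * cnj (snd p) = 1"
      by (simp only: of_real_add complex_norm_square of_real_1)
    finally show ?thesis .
  qed
  have S1: "(\<lambda>p. b1 (fst p) (snd p)) ` ?S = Sg 1"
  proof
    show "(\<lambda>p. b1 (fst p) (snd p)) ` ?S \<subseteq> Sg 1" using sph b1_Sg by blast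
    show "Sg 1 \<subseteq> (\<lambda>p. b1 (fst p) (snd p)) ` ?S"
    proof
      fix X assume "X \<in> Sg 1"
      then obtain a b where ab: "X = b1 a b" "a * cnj a + b * cnj b = 1" by (rule Sg1_form)
      have "X = (\<lambda>p. b1 (fst p) (snd p)) (a, b)" using ab by simp
      moreover have "(a, b) \<in> ?S" unfolding sph using ab by simp
      ultimately show "X \<in> (\<lambda>p. b1 (fst p) (snd p)) ` ?S" by (rule image_eqI)
    qed
  qed
  have c1: "connected (Sg 1)"
    using connected_continuous_image[OF cont \<open>connected ?S\<close>] unfolding S1 .
  obtain y where y: "unit y" "herm y v = 0" by (rule unit_perp_exists)
  then have "herm v y = 0" using herm_zero_commute by blast
  then obtain X where X: "X \<in> SU" "X *v e 1 = v" "X *v e 2 = y" using SU_frame[OF v y(1)] by metis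
  have Xv: "ct X *v v = e 1" using SU_ct_simps(8)[OF X(1), of "e 1"] X(2) by simp
  have "(\<lambda>s. X ** s ** ct X) ` Sg 1 = Sv v"
  proof
    show "(\<lambda>s. X ** s ** ct X) ` Sg 1 \<subseteq> Sv v"
      using X Xv by (auto simp: Sg_def Sv_def mv_assoc)
    show "Sv v \<subseteq> (\<lambda>s. X ** s ** ct X) ` Sg 1"
    proof
      fix s assume s: "s \<in> Sv v"
      have "ct X ** s ** X \<in> Sg 1" using s X Xv by (auto simp: Sg_def Sv_def mv_assoc)
      moreover have "s = X ** (ct X ** s ** X) ** ct X" using X(1) by (simp flip: matrix_mul_assoc)
      ultimately show "s \<in> (\<lambda>s. X ** s ** ct X) ` Sg 1" by blast
    qed
  qed
  moreover have "connected ((\<lambda>s. X ** s ** ct X) ` Sg 1)"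
    by (intro connected_continuous_image continuous_intros c1)
  ultimately show ?thesis by simp
qed

lemma Sv_transitive:
  assumes "unit v" "unit w" "unit w'" "herm w v = 0" "herm w' v = 0"
  obtains s where "s \<in> Sv v" "s *v w = w'"
proof -
  have h: "herm v w = 0" "herm v w' = 0" using assms herm_zero_commute by blast+
  obtain X where X: "X \<in> SU" "X *v e 1 = v" "X *v e 2 = w" using SU_frame[OF assms(1,2) h(1)] by metis
  obtain Y where Y: "Y \<in> SU" "Y *v e 1 = v" "Y *v e 2 = w'" using SU_frame[OF assms(1,3) h(2)] by metis
  have "ct X *v v = e 1" "ct X *v w = e 2" using SU_ct_simps(8)[OF X(1)] X(2,3) by metis+
  then have "Y ** ct X \<in> Sv v" "(Y ** ct X) *v w = w'" using X(1) Y by (simp_all add: Sv_def mv_assoc)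
  then show ?thesis by (rule that)
qed

text \<open>Lines and points move under both factors, whereas the planes on a fixed line and
  point move under the first factor alone; hence the two forms of the orbit.\<close>

lemma connectedin_Sv_orbit:
  assumes "unit v" "M \<in> SU" "x \<in> vertices"
    and "P = (\<lambda>s. mv (M ** s ** ct M, mat_cnj s) x) ` Sv v \<or> P = (\<lambda>s. mv (M ** s ** ct M, mat 1) x) ` Sv v"
  shows "connectedin (vertex_topology flat_geometry) P"
proof -
  have S: "s \<in> SU" if "s \<in> Sv v" for s using that by (simp add: Sv_def)
  have "connected ((\<lambda>s. (M ** s ** ct M, mat_cnj s)) ` Sv v)" "connected ((\<lambda>s. (M ** s ** ct M, mat 1 :: complex^3^3)) ` Sv v)"
    using connected_Sv[OF assms(1)] by (intro connected_continuous_image continuous_intros; assumption)+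
  moreover have "(\<lambda>s. (M ** s ** ct M, mat_cnj s)) ` Sv v \<subseteq> carrier SS" "(\<lambda>s. (M ** s ** ct M, mat 1)) ` Sv v \<subseteq> carrier SS"
    using S assms(2) by auto
  ultimately have "connectedin (vertex_topology flat_geometry) ((\<lambda>x'. mv x' x) ` (\<lambda>s. (M ** s ** ct M, mat_cnj s)) ` Sv v)"
    "connectedin (vertex_topology flat_geometry) ((\<lambda>x'. mv x' x) ` (\<lambda>s. (M ** s ** ct M, mat 1)) ` Sv v)"
    using connectedin_orbit[OF _ _ assms(3)] by blast+
  note conn = this[unfolded image_image]
  from assms(4) show ?thesis
    by (rule disjE) (simp_all only: conn)
qed

lemma connected_planes:
  assumes uv: "unit u" "unit v" and w: "unit w" "herm v w = 0"
  shows "connectedin (vertex_topology flat_geometry) (residue vertices inc {line u v, point w})"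
proof -
  obtain M where M: "M \<in> SU" "M *v v = u" by (rule three_planes[OF uv])
  have "residue vertices inc {line u v, point w} = {z \<in> residue vertices inc {line u v}. inc (point w) z}"
    by (auto simp: residue_def)
  also have "\<dots> = {plane N | N. N \<in> SU \<and> N *v v = u}"
  proof -
    have "\<not> inc (point w) (point w')" for w' using inc_types[of "point w" "point w'"] by auto
    moreover have "inc (point w) (plane N)" if "N \<in> SU" for N by (rule inc_simps(6)[OF that uv w(1)])
    ultimately show ?thesis unfolding residue_line[OF uv] by blast
  qed
  also have "\<dots> = (\<lambda>s. mv (M ** s ** ct M, mat 1) (plane M)) ` Sv v"
  proof
    show "{plane N | N. N \<in> SU \<and> N *v v = u} \<subseteq> (\<lambda>s. mv (M ** s ** ct M, mat 1) (plane M)) ` Sv v"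
    proof clarify
      fix N assume N: "N \<in> SU" "u = N *v v"
      have "ct M ** N \<in> Sv v" using M N SU_ct_simps(8)[OF M(1), of v] by (simp add: Sv_def mv_assoc)
      moreover have "plane N = mv (M ** (ct M ** N) ** ct M, mat 1) (plane M)"
        using M(1) by (simp flip: matrix_mul_assoc)
      ultimately show "plane N \<in> (\<lambda>s. mv (M ** s ** ct M, mat 1) (plane M)) ` Sv v" by blast
    qed
    show "(\<lambda>s. mv (M ** s ** ct M, mat 1) (plane M)) ` Sv v \<subseteq> {plane N | N. N \<in> SU \<and> N *v v = u}"
    proof clarify
      fix s assume "s \<in> Sv v"
      then have "M ** s \<in> SU" "(M ** s) *v v = u" using M by (auto simp: Sv_def mv_assoc)
      moreover have "mv (M ** s ** ct M, mat 1) (plane M) = plane (M ** s)"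
        using M(1) by (simp flip: matrix_mul_assoc)
      ultimately show "\<exists>N. mv (M ** s ** ct M, mat 1) (plane M) = plane N \<and> N \<in> SU \<and> N *v v = u" by blast
    qed
  qed
  finally show ?thesis
    using connectedin_Sv_orbit[OF uv(2) M(1) vertices_simps(1)[OF M(1)]] by blast
qed

lemma connected_lines:
  assumes M: "M \<in> SU" and w: "unit w"
  shows "connectedin (vertex_topology flat_geometry) (residue vertices inc {plane M, point w})"
proof -
  obtain v0 where v0: "unit v0" "herm v0 w = 0" by (rule unit_perp_exists)
  have Mv: "unit (M *v v)" if "unit v" for v using that M by simp
  have "residue vertices inc {plane M, point w} = {line (M *v v) v | v. unit v \<and> herm v w = 0}"
  proof -
    have "residue vertices inc {plane M, point w} = {z \<in> residue vertices inc {plane M}. inc (point w) z}"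
      by (auto simp: residue_def)
    also have "\<dots> = {line (M *v v) v | v. unit v \<and> herm v w = 0}"
    proof -
      have "\<not> inc (point w) (point w')" for w' using inc_types[of "point w" "point w'"] by auto
      moreover have "inc (point w) (line (M *v v) v) \<longleftrightarrow> herm v w = 0" if "unit v" for v
        by (rule inc_simps(4)[OF M Mv[OF that] that w])
      ultimately show ?thesis unfolding residue_plane[OF M] by blast
    qed
    finally show ?thesis .
  qed
  also have "\<dots> = (\<lambda>s. mv (M ** s ** ct M, mat_cnj s) (line (M *v v0) v0)) ` Sv w"
  proof -
    have mvs: "mv (M ** s ** ct M, mat_cnj s) (line (M *v v0) v0) = line (M *v (s *v v0)) (s *v v0)" for s
      using M by (simp add: mv_assoc)
    show ?thesis
      unfolding mvs
    proof
      show "{line (M *v v) v |v. unit v \<and> herm v w = 0} \<subseteq> (\<lambda>s. line (M *v (s *v v0)) (s *v v0)) ` Sv w"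
      proof clarify
        fix v assume v: "unit v" "herm v w = 0"
        obtain s where "s \<in> Sv w" "s *v v0 = v" by (rule Sv_transitive[OF w v0(1) v(1) v0(2) v(2)])
        then show "line (M *v v) v \<in> (\<lambda>s. line (M *v (s *v v0)) (s *v v0)) ` Sv w" by blast
      qed
      show "(\<lambda>s. line (M *v (s *v v0)) (s *v v0)) ` Sv w \<subseteq> {line (M *v v) v |v. unit v \<and> herm v w = 0}"
      proof clarify
        fix s assume "s \<in> Sv w"
        then have s: "s \<in> SU" "s *v w = w" by (auto simp: Sv_def)
        have "herm (s *v v0) w = herm (s *v v0) (s *v w)" unfolding s(2) ..
        then have "unit (s *v v0)" "herm (s *v v0) w = 0" using s(1) v0 by simp_all
        then show "\<exists>v. line (M *v (s *v v0)) (s *v v0) = line (M *v v) v \<and> unit v \<and> herm v w = 0" by blast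
      qed
    qed
  qed
  finally show ?thesis
    using connectedin_Sv_orbit[OF w M vertices_simps(2)[OF Mv[OF v0(1)] v0(1)]] by blast
qed

lemma connected_points:
  assumes uv: "unit u" "unit v" and M: "M \<in> SU" "M *v v = u"
  shows "connectedin (vertex_topology flat_geometry) (residue vertices inc {plane M, line u v})"
proof -
  obtain w0 where w0: "unit w0" "herm w0 v = 0" by (rule unit_perp_exists)
  have "residue vertices inc {plane M, line u v} = {z \<in> residue vertices inc {line u v}. inc (plane M) z}"
    by (auto simp: residue_def)
  also have "\<dots> = {point w | w. unit w \<and> herm w v = 0}"
  proof -
    have "\<not> inc (plane M) (plane N)" if "N \<in> SU" for N using inc_types[of "plane M" "plane N"] M(1) that by auto
    moreover have "inc (plane M) (point w)" if "unit w" for w by (rule inc_simps(5)[OF M(1) uv that])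
    ultimately show ?thesis unfolding residue_line[OF uv] herm_zero_commute[of v] by blast
  qed
  also have "\<dots> = (\<lambda>s. mv (mat 1 ** s ** ct (mat 1), mat_cnj s) (point w0)) ` Sv v"
  proof -
    have mvs: "mv (mat 1 ** s ** ct (mat 1), mat_cnj s) (point w0) = point (s *v w0)" for s
      by simp
    show ?thesis
      unfolding mvs
    proof
      show "{point w |w. unit w \<and> herm w v = 0} \<subseteq> (\<lambda>s. point (s *v w0)) ` Sv v"
      proof clarify
        fix w assume w: "unit w" "herm w v = 0"
        obtain s where "s \<in> Sv v" "s *v w0 = w" by (rule Sv_transitive[OF uv(2) w0(1) w(1) w0(2) w(2)])
        then show "point w \<in> (\<lambda>s. point (s *v w0)) ` Sv v" by blast
      qed
      show "(\<lambda>s. point (s *v w0)) ` Sv v \<subseteq> {point w |w. unit w \<and> herm w v = 0}"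
      proof clarify
        fix s assume "s \<in> Sv v"
        then have s: "s \<in> SU" "s *v v = v" by (auto simp: Sv_def)
        have "herm (s *v w0) v = herm (s *v w0) (s *v v)" unfolding s(2) ..
        then have "unit (s *v w0)" "herm (s *v w0) v = 0" using s(1) w0 by simp_all
        then show "\<exists>w. point (s *v w0) = point w \<and> unit w \<and> herm w v = 0" by blast
      qed
    qed
  qed
  finally show ?thesis
    using connectedin_Sv_orbit[OF uv(2) one_SU vertices_simps(3)[OF w0(1)]] by blast
qed

lemma flat_connected_panels: "connected_panels UNIV flat_geometry"
  unfolding connected_panels_def flat_geometry_simps
proof (intro ballI impI)
  fix \<alpha> assume a: "\<alpha> \<in> flags vertices inc" "card \<alpha> + 1 = card (UNIV :: pdq set)"
  then have "card \<alpha> = 2" by (simp add: card_pdq)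
  then obtain x y where xy: "\<alpha> = {x, y}" "x \<noteq> y" by (auto simp: card_2_iff)
  have i: "inc x y" "inc y x" using a(1) xy by (auto simp: flags_def)
  have V: "x \<in> vertices" "y \<in> vertices" using flags_carrier[OF a(1)] xy by auto
  have eq: "\<Union>(link (flags vertices inc) \<alpha>) = residue vertices inc \<alpha>"
    using model.link_flags[OF a(1)] by simp
  have main: "connectedin (vertex_topology flat_geometry) (residue vertices inc {x, y})"
    if V: "x \<in> vertices" "y \<in> vertices" and i: "inc x y"
      and t: "(vtype x, vtype y) \<in> {(Tp, Td), (Td, Tq), (Tp, Tq)}" for x y
  proof -
    consider "vtype x = Tp" "vtype y = Td" | "vtype x = Td" "vtype y = Tq" | "vtype x = Tp" "vtype y = Tq"
      using t by blast
    then show ?thesis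
    proof cases
      case 1
      obtain M where M: "M \<in> SU" "x = plane M" using vertices_of_type(1)[OF V(1) 1(1)] by blast
      obtain u v where uv: "unit u" "unit v" "y = line u v" using vertices_of_type(2)[OF V(2) 1(2)] by blast
      have "M *v v = u" using i inc_simps(1)[OF M(1) uv(1,2,2)] M(2) uv(3) by simp
      then show ?thesis using connected_points[OF uv(1,2) M(1)] M(2) uv(3) by simp
    next
      case 2
      obtain u v where uv: "unit u" "unit v" "x = line u v" using vertices_of_type(2)[OF V(1) 2(1)] by blast
      obtain w where w: "unit w" "y = point w" using vertices_of_type(3)[OF V(2) 2(2)] by blast
      have "herm v w = 0" using i inc_simps(3)[OF one_SU uv(1,2) w(1)] w(2) uv(3) by simp
      then show ?thesis using connected_planes[OF uv(1,2) w(1)] w(2) uv(3) by simp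
    next
      case 3
      obtain M where M: "M \<in> SU" "x = plane M" using vertices_of_type(1)[OF V(1) 3(1)] by blast
      obtain w where w: "unit w" "y = point w" using vertices_of_type(3)[OF V(2) 3(2)] by blast
      show ?thesis using connected_lines[OF M(1) w(1)] M(2) w(2) by simp
    qed
  qed
  show "connectedin (vertex_topology flat_geometry) (\<Union>(link (flags vertices inc) \<alpha>))"
    unfolding eq unfolding xy(1)
  proof -
    from i(1) have "inc0 x y \<or> inc0 y x" by (simp add: inc_def)
    then show "connectedin (vertex_topology flat_geometry) (residue vertices inc {x, y})"
    proof
      assume "inc0 x y"
      then show ?thesis by (intro main[OF V i(1)] inc0_types)
    next
      assume "inc0 y x"
      then have "connectedin (vertex_topology flat_geometry) (residue vertices inc {y, x})"
        by (intro main[OF V(2,1) i(2)] inc0_types)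
      then show ?thesis by (simp only: insert_commute)
    qed
  qed
qed

theorem flat_compact: "compact_group_geometry UNIV C3_matrix flat_geometry"
  unfolding compact_group_geometry_def
  using flat_homogeneous flat_connected_panels compact_TG flat_faithful
  unfolding flat_geometry_simps Union_flags by blast

lemma G_vertex_stabilizer: "G_vertex i = {g \<in> carrier GG. actG g (base i) = base i}"
proof
  show "G_vertex i \<subseteq> {g \<in> carrier GG. actG g (base i) = base i}"
  proof
    fix g assume "g \<in> G_vertex i"
    then obtain x where x: "x \<in> carrier SS" "mv x (base i) = base i" "g = proj_Z x"
      unfolding G_vertex_def K_group_stabilizer by blast
    then show "g \<in> {g \<in> carrier GG. actG g (base i) = base i}"
      using actG_proj[OF x(1) base_vertices(1)] proj_closed[OF x(1)] by simp
  qed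
  show "{g \<in> carrier GG. actG g (base i) = base i} \<subseteq> G_vertex i"
  proof
    fix g assume g: "g \<in> {g \<in> carrier GG. actG g (base i) = base i}"
    then obtain x where x: "x \<in> carrier SS" "g = proj_Z x" using GG_cases[of g] by blast
    have "mv x (base i) = base i" using g actG_proj[OF x(1) base_vertices(1)] x(2) by simp
    then show "g \<in> G_vertex i" unfolding G_vertex_def K_group_stabilizer using x by blast
  qed
qed

theorem flat_belongs: "belongs_to UNIV flat_geometry complex_G"
proof -
  have mem: "(\<Inter>v\<in>J. G_vertex v) = simplex_stabilizer flat_geometry {v \<in> range base. vtype v \<in> J}"
    if J: "J \<noteq> {}" for J
  proof -
    have eq: "{v \<in> range base. vtype v \<in> J} = base ` J" by auto
    have "range base \<in> flags vertices inc" using base_chamber by (simp add: model.chambers_flags)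
    then have "base ` J \<in> flags vertices inc" by (rule flags_subset) blast
    then have "simplex_stabilizer flat_geometry (base ` J) = {g \<in> carrier GG. \<forall>v\<in>base ` J. actG g v = v}"
      by (rule simplex_stabilizer_flat)
    also have "\<dots> = (\<Inter>v\<in>J. G_vertex v)"
      unfolding G_vertex_stabilizer using J by blast
    finally show ?thesis unfolding eq ..
  qed
  have "continuous_complex_iso UNIV complex_G (stabilizer_complex flat_geometry (range base)) (\<lambda>J x. x)"
    unfolding continuous_complex_iso_def
  proof (intro conjI allI impI)
    fix J :: "pdq set" assume "J \<noteq> {} \<and> J \<subseteq> UNIV"
    then have m: "member (stabilizer_complex flat_geometry (range base)) J = member complex_G J"
      using mem[of J] by (simp add: stabilizer_complex_def complex_G_def)
    have a: "ambient (stabilizer_complex flat_geometry (range base)) = ambient complex_G"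
      "top_amb (stabilizer_complex flat_geometry (range base)) = top_amb complex_G"
      by (simp_all add: stabilizer_complex_def complex_G_def GG_def TG_def)
    show "(\<lambda>x. x) \<in> iso (ambient complex_G\<lparr>carrier := member complex_G J\<rparr>)
        (ambient (stabilizer_complex flat_geometry (range base))
          \<lparr>carrier := member (stabilizer_complex flat_geometry (range base)) J\<rparr>)"
      unfolding m a by (rule iso_set_refl)
    show "continuous_map (subtopology (top_amb complex_G) (member complex_G J))
        (subtopology (top_amb (stabilizer_complex flat_geometry (range base)))
          (member (stabilizer_complex flat_geometry (range base)) J)) (\<lambda>x. x)"
      unfolding m a by simp
  qed simp
  then show ?thesis unfolding belongs_to_def flat_geometry_simps using base_chamber by blast
qed

section \<open>Uniqueness\<close>

text \<open>The polynomial \<open>p\<close> is the determinant of \<open>B - l\<close>, expanded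
  in powers of \<open>l\<close>.\<close>

lemma SU_eigenvector:
  assumes B: "B \<in> SU" obtains X where "X \<in> SU" "ct X ** B ** X \<in> Ug 3"
proof -
  define p where "p = [:det B, - (B$1$1 * B$2$2 - B$1$2 * B$2$1 + B$1$1 * B$3$3 - B$1$3 * B$3$1 + B$2$2 * B$3$3 - B$2$3 * B$3$2),
     B$1$1 + B$2$2 + B$3$3, -1:]"
  obtain l where l: "poly p l = 0"
    using fundamental_theorem_of_algebra_alt[of p] by (auto simp: p_def)
  define A where "A = B - mat3 l 0 0 0 l 0 0 0 l"
  have "det A = 0"
    using l by (simp add: p_def A_def det_3 algebra_simps power2_eq_square)
  then have "\<not> invertible A" by (simp add: invertible_det_nz)
  then have "\<nexists>A'. A' ** A = mat 1" using invertible_left_inverse by blast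
  then obtain x where x: "A *v x = 0" "x \<noteq> 0" unfolding matrix_left_invertible_ker by blast
  have Bx: "B *v x = l *s x"
  proof -
    have "mat3 l 0 0 0 l 0 0 0 l *v x = l *s x"
      by (subst (1 2) vector3_eta[of x]) (simp only: mat3_mv vector3_scale mult_zero_left add_0 add_0_right)
    then show ?thesis using x(1) by (simp add: A_def matrix_vector_mult_diff_rdistrib)
  qed
  define w where "w = complex_of_real (inverse (norm x)) *s x"
  have w: "unit w"
    unfolding w_def using x(2)
    by (subst herm_scale(1), subst herm_scale(2), subst herm_self) (simp add: power2_eq_square field_simps)
  have Bw: "B *v w = l *s w" unfolding w_def mv_scale Bx by (simp add: vector_smult_assoc mult.commute)
  obtain y where y: "unit y" "herm y w = 0" by (rule unit_perp_exists)
  then have "herm w y = 0" using herm_zero_commute by blast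
  then obtain Y where Y: "Y \<in> SU" "Y *v e 1 = w" "Y *v e 2 = y" using SU_frame[OF w y(1)] by metis
  define X where "X = Y ** rot"
  have X: "X \<in> SU" "X *v e 3 = w" using Y by (simp_all add: X_def mv_assoc rot_e)
  have "(ct X ** B ** X) *v e 3 = l *s e 3"
    using SU_ct_simps(8)[OF X(1), of "e 3"] by (simp only: mv_assoc X(2) Bw mv_scale)
  then have "ct X ** B ** X \<in> Ug 3" using X(1) B by (auto simp: Ug_def)
  then show ?thesis using X(1) that by blast
qed

lemma SS_inv_one_mult: "x \<in> carrier SS \<Longrightarrow> inv\<^bsub>SS\<^esub> \<one>\<^bsub>SS\<^esub> \<otimes>\<^bsub>SS\<^esub> x = x"
  by (cases x) simp

text \<open>A homogeneous geometry with a chamber whose complex of stabilizers is identified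
  with the given one.\<close>

locale presented_geometry =
  fixes X :: "('g, 'v, pdq) group_geometry" and \<gamma> :: "'v set" and h :: "pdq set \<Rightarrow> mat_pair set \<Rightarrow> 'g"
  assumes hom_geo: "homogeneous_compact_geometry UNIV C3_matrix X"
    and chamber: "\<gamma> \<in> chambers (cplx X)"
    and iso: "continuous_complex_iso UNIV complex_G (stabilizer_complex X \<gamma>) h"
begin

abbreviation "H \<equiv> grp X"
abbreviation "T \<equiv> top_grp X"
abbreviation "\<Delta>\<^sub>X \<equiv> cplx X"

lemma geo: "geometry UNIV \<Delta>\<^sub>X (type_fun X)"
  using hom_geo unfolding homogeneous_compact_geometry_def geometry_of_type_def by metis

lemma top_group: "topological_group H T" and Hausdorff: "Hausdorff_space T"
  using hom_geo unfolding homogeneous_compact_geometry_def locally_compact_group_def by metis+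

lemma acts: "acts_by_automorphisms X"
  using hom_geo unfolding homogeneous_compact_geometry_def by metis

lemma act_group: "group_action H (\<Union>\<Delta>\<^sub>X) (act X)"
  using acts unfolding acts_by_automorphisms_def by metis

lemma group_H: "group H"
  using top_group unfolding topological_group_def by metis

lemma topspace_T: "topspace T = carrier H"
  using top_group unfolding topological_group_def by metis

lemma act_type: "g \<in> carrier H \<Longrightarrow> v \<in> \<Union>\<Delta>\<^sub>X \<Longrightarrow> type_fun X (act X g v) = type_fun X v"
  using acts unfolding acts_by_automorphisms_def by blast

lemma act_simplex: "g \<in> carrier H \<Longrightarrow> \<alpha> \<in> \<Delta>\<^sub>X \<Longrightarrow> act X g ` \<alpha> \<in> \<Delta>\<^sub>X"
  using acts unfolding acts_by_automorphisms_def by blast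

lemma act_vertex: "g \<in> carrier H \<Longrightarrow> v \<in> \<Union>\<Delta>\<^sub>X \<Longrightarrow> act X g v \<in> \<Union>\<Delta>\<^sub>X"
  using group_action.element_image[OF act_group] by blast

lemma act_mult: "g \<in> carrier H \<Longrightarrow> k \<in> carrier H \<Longrightarrow> v \<in> \<Union>\<Delta>\<^sub>X \<Longrightarrow> act X (g \<otimes>\<^bsub>H\<^esub> k) v = act X g (act X k v)"
  using group_action.composition_rule[OF act_group] by metis

lemma act_one: "v \<in> \<Union>\<Delta>\<^sub>X \<Longrightarrow> act X \<one>\<^bsub>H\<^esub> v = v"
  using group_action.id_eq_one[OF act_group] by (metis restrict_apply)

lemma act_inv: "g \<in> carrier H \<Longrightarrow> v \<in> \<Union>\<Delta>\<^sub>X \<Longrightarrow> act X (inv\<^bsub>H\<^esub> g) (act X g v) = v"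
  using act_mult[of "inv\<^bsub>H\<^esub> g" g v] act_one[of v] group.inv_closed[OF group_H] group.l_inv[OF group_H] by simp

lemma transitive: "c \<in> chambers \<Delta>\<^sub>X \<Longrightarrow> d \<in> chambers \<Delta>\<^sub>X \<Longrightarrow> \<exists>g\<in>carrier H. act X g ` c = d"
  using hom_geo unfolding homogeneous_compact_geometry_def by blast

lemma chamber_simplex: "c \<in> chambers \<Delta>\<^sub>X \<Longrightarrow> c \<in> \<Delta>\<^sub>X"
  by (simp add: chambers_def)

lemma chamber_types: assumes "c \<in> chambers \<Delta>\<^sub>X" shows "type_fun X ` c = UNIV" "inj_on (type_fun X) c"
proof -
  show inj: "inj_on (type_fun X) c"
    using geo chamber_simplex[OF assms] unfolding geometry_def by blast
  have "chamber_complex 3 \<Delta>\<^sub>X" using geo unfolding geometry_def card_pdq by metis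
  then have "card c = 3" using assms unfolding chamber_complex_def pure_of_rank_def by blast
  then have "card (type_fun X ` c) = card (UNIV :: pdq set)" using inj by (simp add: card_image card_pdq)
  moreover have "finite (UNIV :: pdq set)" by (simp add: pdq_UNIV)
  ultimately show "type_fun X ` c = UNIV" by (intro card_subset_eq) auto
qed

definition gv :: "pdq \<Rightarrow> 'v" where "gv i = (THE v. v \<in> \<gamma> \<and> type_fun X v = i)"

lemma gv: "gv i \<in> \<gamma>" "type_fun X (gv i) = i"
proof -
  obtain v where v: "v \<in> \<gamma>" "type_fun X v = i"
    using chamber_types(1)[OF chamber] UNIV_I[of i] by (metis imageE)
  have "gv i = v" unfolding gv_def
    by (rule the_equality) (use v chamber_types(2)[OF chamber] in \<open>auto dest: inj_onD\<close>)
  then show "gv i \<in> \<gamma>" "type_fun X (gv i) = i" using v by simp_all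
qed

lemma gv_type: "v \<in> \<gamma> \<Longrightarrow> gv (type_fun X v) = v"
  using inj_onD[OF chamber_types(2)[OF chamber] gv(2)[of "type_fun X v"] gv(1)] .

lemma range_gv: "range gv = \<gamma>"
proof
  show "range gv \<subseteq> \<gamma>" using gv(1) by blast
  show "\<gamma> \<subseteq> range gv" using gv_type by (metis rangeI subsetI)
qed

lemma gv_vertex: "gv i \<in> \<Union>\<Delta>\<^sub>X"
  using gv(1) chamber_simplex[OF chamber] by blast

definition stab :: "pdq \<Rightarrow> 'g set" where "stab i = {g \<in> carrier H. act X g (gv i) = gv i}"

lemma simplex_stab: "simplex_stabilizer X {v \<in> \<gamma>. type_fun X v \<in> J} = {g \<in> carrier H. \<forall>i\<in>J. act X g (gv i) = gv i}"
proof -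
  have eq: "{v \<in> \<gamma>. type_fun X v \<in> J} = gv ` J"
  proof
    show "{v \<in> \<gamma>. type_fun X v \<in> J} \<subseteq> gv ` J" using gv_type by (metis (mono_tags, lifting) imageI mem_Collect_eq subsetI)
    show "gv ` J \<subseteq> {v \<in> \<gamma>. type_fun X v \<in> J}" using gv by auto
  qed
  have "act X g ` gv ` J = gv ` J \<longleftrightarrow> (\<forall>i\<in>J. act X g (gv i) = gv i)" if g: "g \<in> carrier H" for g
  proof
    assume e: "act X g ` gv ` J = gv ` J"
    show "\<forall>i\<in>J. act X g (gv i) = gv i"
    proof
      fix i assume "i \<in> J"
      then obtain j where j: "act X g (gv i) = gv j" using e by blast
      have "type_fun X (act X g (gv i)) = i" using act_type[OF g gv_vertex] gv(2) by simp
      then show "act X g (gv i) = gv i" using j gv(2)[of j] by simp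
    qed
  next
    assume "\<forall>i\<in>J. act X g (gv i) = gv i"
    then show "act X g ` gv ` J = gv ` J" by (simp add: image_image)
  qed
  then show ?thesis unfolding simplex_stabilizer_def stabilizer_def eq by blast
qed

lemma member_G: "member complex_G J = (\<Inter>i\<in>J. G_vertex i)" "ambient complex_G = GG" "top_amb complex_G = TG"
  by (simp_all add: complex_G_def GG_def TG_def)

lemma member_X: "member (stabilizer_complex X \<gamma>) J = {g \<in> carrier H. \<forall>i\<in>J. act X g (gv i) = gv i}"
  "ambient (stabilizer_complex X \<gamma>) = H" "top_amb (stabilizer_complex X \<gamma>) = T"
  by (simp_all add: stabilizer_complex_def simplex_stab)

text \<open>The isomorphism on each of the three vertex groups, lifted to SU(3) x SU(3).\<close>

definition \<phi> :: "pdq \<Rightarrow> mat_pair \<Rightarrow> 'g" where "\<phi> i x = h {i} (proj_Z x)"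

lemma K_carrier: "x \<in> K_group i \<Longrightarrow> x \<in> carrier SS"
  unfolding K_group_stabilizer by blast

lemma G_vertex_proj: "x \<in> K_group i \<Longrightarrow> proj_Z x \<in> G_vertex i"
  unfolding G_vertex_def by blast

lemma h_iso: "h {i} \<in> iso (GG\<lparr>carrier := G_vertex i\<rparr>) (H\<lparr>carrier := stab i\<rparr>)"
proof -
  have "h {i} \<in> iso ((ambient complex_G)\<lparr>carrier := member complex_G {i}\<rparr>)
      ((ambient (stabilizer_complex X \<gamma>))\<lparr>carrier := member (stabilizer_complex X \<gamma>) {i}\<rparr>)"
    using iso unfolding continuous_complex_iso_def by blast
  then show ?thesis by (simp add: member_G member_X stab_def)
qed

lemma h_cont: "continuous_map (subtopology TG (G_vertex i)) (subtopology T (stab i)) (h {i})"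
proof -
  have "continuous_map (subtopology (top_amb complex_G) (member complex_G {i}))
     (subtopology (top_amb (stabilizer_complex X \<gamma>)) (member (stabilizer_complex X \<gamma>) {i})) (h {i})"
    using iso unfolding continuous_complex_iso_def by blast
  then show ?thesis by (simp add: member_G member_X stab_def)
qed

lemma h_restrict: "g \<in> G_vertex i \<Longrightarrow> g \<in> G_vertex j \<Longrightarrow> h {i} g = h {j} g"
proof -
  assume g: "g \<in> G_vertex i" "g \<in> G_vertex j"
  have c: "h J x = h J' x" if "J \<noteq> {}" "J \<subseteq> J'" "x \<in> member complex_G J'" for J J' x
    using iso that unfolding continuous_complex_iso_def by simp
  have "g \<in> member complex_G {i, j}" using g by (simp add: member_G)
  then have "h {i} g = h {i, j} g" "h {j} g = h {i, j} g" by (intro c; simp)+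
  then show "h {i} g = h {j} g" by (rule trans[OF _ sym])
qed

lemma \<phi>_compat: "x \<in> K_group i \<Longrightarrow> x \<in> K_group j \<Longrightarrow> \<phi> i x = \<phi> j x"
  unfolding \<phi>_def by (intro h_restrict G_vertex_proj)

lemma \<phi>_mult: assumes "x \<in> K_group i" "y \<in> K_group i" shows "\<phi> i (x \<otimes>\<^bsub>SS\<^esub> y) = \<phi> i x \<otimes>\<^bsub>H\<^esub> \<phi> i y"
proof -
  have "h {i} (proj_Z x \<otimes>\<^bsub>GG\<^esub> proj_Z y) = h {i} (proj_Z x) \<otimes>\<^bsub>H\<^esub> h {i} (proj_Z y)"
    using h_iso[of i] G_vertex_proj[OF assms(1)] G_vertex_proj[OF assms(2)] unfolding iso_def hom_def by simp
  then show ?thesis unfolding \<phi>_def proj_mult[OF K_carrier[OF assms(1)] K_carrier[OF assms(2)]] .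
qed

lemma \<phi>_image: "\<phi> i ` K_group i = stab i"
proof -
  have "h {i} ` G_vertex i = stab i" using h_iso[of i] unfolding iso_def bij_betw_def by simp
  then show ?thesis unfolding \<phi>_def G_vertex_def image_image .
qed

lemma \<phi>_closed: "x \<in> K_group i \<Longrightarrow> \<phi> i x \<in> carrier H"
  using \<phi>_image[of i] unfolding stab_def by blast

lemma K_one: "\<one>\<^bsub>SS\<^esub> \<in> K_group i"
  unfolding K_group_stabilizer mem_Collect_eq mv_one by simp

lemma \<phi>_one: "\<phi> i \<one>\<^bsub>SS\<^esub> = \<one>\<^bsub>H\<^esub>"
proof -
  interpret G: group H by (rule group_H)
  have "\<phi> i \<one>\<^bsub>SS\<^esub> \<otimes>\<^bsub>H\<^esub> \<phi> i \<one>\<^bsub>SS\<^esub> = \<phi> i \<one>\<^bsub>SS\<^esub>"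
    using \<phi>_mult[OF K_one K_one] by simp
  then show ?thesis using G.l_cancel_one' \<phi>_closed[OF K_one] by (metis G.l_cancel_one)
qed

lemma \<phi>_kernel: assumes x: "x \<in> K_group i" and 1: "\<phi> i x = \<one>\<^bsub>H\<^esub>" shows "x \<in> Z_group"
proof -
  have inj: "inj_on (h {i}) (G_vertex i)" using h_iso[of i] unfolding iso_def bij_betw_def by simp
  have "h {i} (proj_Z x) = h {i} (proj_Z \<one>\<^bsub>SS\<^esub>)" using 1 \<phi>_one[of i] unfolding \<phi>_def by simp
  then have "proj_Z x = proj_Z \<one>\<^bsub>SS\<^esub>" by (rule inj_onD[OF inj _ G_vertex_proj[OF x] G_vertex_proj[OF K_one]])
  moreover have oneS: "\<one>\<^bsub>SS\<^esub> \<in> carrier SS" by simp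
  ultimately have "inv\<^bsub>SS\<^esub> \<one>\<^bsub>SS\<^esub> \<otimes>\<^bsub>SS\<^esub> x \<in> Z_group" using proj_eq_iff[OF K_carrier[OF x] oneS] by blast
  moreover have "inv\<^bsub>SS\<^esub> \<one>\<^bsub>SS\<^esub> \<otimes>\<^bsub>SS\<^esub> x = x"
    by (rule SS_inv_one_mult[OF K_carrier[OF x]])
  ultimately show ?thesis by simp
qed

lemma \<phi>_cont: "continuous_map (subtopology TS (K_group i)) T (\<phi> i)"
proof -
  have "continuous_map (subtopology TS (K_group i)) (subtopology TG (G_vertex i)) proj_Z"
    unfolding continuous_map_in_subtopology
    using continuous_map_from_subtopology[OF quotient_imp_continuous_map[OF quotient_map_proj]] G_vertex_proj
    by (auto simp del: K_group.simps)
  then have "continuous_map (subtopology TS (K_group i)) (subtopology T (stab i)) (h {i} \<circ> proj_Z)"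
    using h_cont by (rule continuous_map_compose)
  then have "continuous_map (subtopology TS (K_group i)) T (h {i} \<circ> proj_Z)"
    by (rule continuous_map_into_fulltopology)
  then show ?thesis by (rule continuous_map_eq) (simp add: \<phi>_def)
qed

definition pX where "pX A = \<phi> Tp (A, mat_cnj A)"
definition nX where "nX Y = \<phi> Tq (Y, mat 1)"

lemma K_p: "A \<in> SU \<Longrightarrow> (A, mat_cnj A) \<in> K_group Tp"
  unfolding K_group_Tp by simp

lemma one_Ug: "mat 1 \<in> Ug i"
  using Sg_Ug[of "mat 1" i] by (simp add: Sg_def)

lemma K_q: "A \<in> SU \<Longrightarrow> (A, mat 1) \<in> K_group Tq"
  unfolding K_group_Tq by (simp add: one_Ug)

lemma Ug_cnj: "A \<in> Ug 3 \<Longrightarrow> mat_cnj A \<in> Ug 3"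
proof -
  assume A: "A \<in> Ug 3"
  then obtain c where "A \<in> SU" "A *v e 3 = c *s e 3" by (auto simp: Ug_def)
  then have "mat_cnj A *v e 3 = cnj c *s e 3" unfolding mv_e3 by simp
  with \<open>A \<in> SU\<close> show ?thesis by (auto simp: Ug_def)
qed

lemma K_pq: "A \<in> Ug 3 \<Longrightarrow> (A, mat_cnj A) \<in> K_group Tq"
  unfolding K_group_Tq using Ug_cnj Ug_SU by blast

lemma K_pd: "A \<in> Ug 1 \<Longrightarrow> (A, mat_cnj A) \<in> K_group Td"
proof -
  assume A: "A \<in> Ug 1"
  then obtain c where c: "A *v e 1 = c *s e 1" "cnj c * c = 1" by (rule Ug_phase)
  have "mat_cnj A *v e 1 = cnj c *s e 1" using c(1) unfolding mv_e1 by simp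
  then have "cnj (cnj c) * cnj c = 1 \<and> A *v e 1 = cnj (cnj c) *s e 1 \<and> mat_cnj A *v e 1 = cnj c *s e 1"
    using c by (simp add: mult.commute)
  then show ?thesis unfolding K_group_Td using Ug_SU[OF A] mat_cnj_SU by blast
qed

lemma K_qd: "Y \<in> Sg 1 \<Longrightarrow> (Y, mat 1) \<in> K_group Td"
  unfolding K_group_Td by (auto simp: Sg_def intro!: exI[of _ 1])

sublocale su3_amalgam H pX nX
proof -
  interpret G: group H by (rule group_H)
  have conj: "G.cj (\<phi> i x) (\<phi> i y) = \<phi> i z" if K: "x \<in> K_group i" "y \<in> K_group i" "z \<in> K_group i"
    and eq: "z \<otimes>\<^bsub>SS\<^esub> x = x \<otimes>\<^bsub>SS\<^esub> y" for i x y z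
  proof -
    have "\<phi> i z \<otimes>\<^bsub>H\<^esub> \<phi> i x = \<phi> i x \<otimes>\<^bsub>H\<^esub> \<phi> i y"
      using \<phi>_mult[OF K(3,1)] \<phi>_mult[OF K(1,2)] eq by simp
    then show ?thesis unfolding G.cj_def
      using \<phi>_closed[OF K(1)] \<phi>_closed[OF K(2)] \<phi>_closed[OF K(3)]
      by (metis G.inv_solve_right G.m_closed)
  qed
  show "su3_amalgam H pX nX"
  proof
    show "pX \<in> hom SU3_group H"
    proof (rule homI)
      fix A B assume "A \<in> carrier SU3_group" "B \<in> carrier SU3_group"
      then have "A \<in> SU" "B \<in> SU" by simp_all
      from \<phi>_mult[OF K_p[OF this(1)] K_p[OF this(2)]]
      show "pX (A \<otimes>\<^bsub>SU3_group\<^esub> B) = pX A \<otimes>\<^bsub>H\<^esub> pX B" by (simp add: pX_def mat_cnj_mult)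
    qed (simp add: pX_def \<phi>_closed[OF K_p])
    show "nX \<in> hom SU3_group H"
    proof (rule homI)
      fix A B assume "A \<in> carrier SU3_group" "B \<in> carrier SU3_group"
      then have "A \<in> SU" "B \<in> SU" by simp_all
      from \<phi>_mult[OF K_q[OF this(1)] K_q[OF this(2)]]
      show "nX (A \<otimes>\<^bsub>SU3_group\<^esub> B) = nX A \<otimes>\<^bsub>H\<^esub> nX B" by (simp add: nX_def)
    qed (simp add: nX_def \<phi>_closed[OF K_q])
    show "G.cj (pX X) (nX Y) = nX (X ** Y ** ct X)" if X: "X \<in> Ug 3" and Y: "Y \<in> SU" for X Y
    proof -
      have SU: "X \<in> SU" using X by (rule Ug_SU)
      have "pX X = \<phi> Tq (X, mat_cnj X)" unfolding pX_def by (rule \<phi>_compat[OF K_p[OF SU] K_pq[OF X]])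
      moreover have "G.cj (\<phi> Tq (X, mat_cnj X)) (\<phi> Tq (Y, mat 1)) = \<phi> Tq (X ** Y ** ct X, mat 1)"
        by (rule conj[OF K_pq[OF X] K_q[OF Y] K_q]) (use SU Y in simp_all)
      ultimately show ?thesis by (simp add: nX_def)
    qed
    show "G.cj (pX X) (nX Y) = nX (X ** Y ** ct X)" if X: "X \<in> Ug 1" and Y: "Y \<in> Sg 1" for X Y
    proof -
      have SU: "X \<in> SU" "Y \<in> SU" using X Y Ug_SU Sg_SU by blast+
      have c: "X ** Y ** ct X \<in> Sg 1" using X Y by (rule Ug_conj_Sg)
      have "pX X = \<phi> Td (X, mat_cnj X)" unfolding pX_def by (rule \<phi>_compat[OF K_p[OF SU(1)] K_pd[OF X]])
      moreover have "nX Y = \<phi> Td (Y, mat 1)" unfolding nX_def by (rule \<phi>_compat[OF K_q[OF SU(2)] K_qd[OF Y]])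
      moreover have "nX (X ** Y ** ct X) = \<phi> Td (X ** Y ** ct X, mat 1)"
        unfolding nX_def by (rule \<phi>_compat[OF K_q[OF Sg_SU[OF c]] K_qd[OF c]])
      moreover have "G.cj (\<phi> Td (X, mat_cnj X)) (\<phi> Td (Y, mat 1)) = \<phi> Td (X ** Y ** ct X, mat 1)"
        by (rule conj[OF K_pd[OF X] K_qd[OF Y] K_qd[OF c]]) (use SU in simp)
      ultimately show ?thesis by simp
    qed
  qed
qed

text \<open>The decomposition of \<open>(A, B)\<close> that defines \<open>Phi\<close> stays
  inside each of the three groups.\<close>

lemma Phi_\<phi>: assumes x: "x \<in> K_group i" shows "Phi x = \<phi> i x"
proof -
  obtain A B where AB: "x = (A, B)" "A \<in> SU" "B \<in> SU" using K_carrier[OF x] by auto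
  define b where "b = mat_cnj B"
  have b: "b \<in> SU" "B = mat_cnj b" using AB by (simp_all add: b_def)
  have Phi: "Phi x = nX (A ** ct b) \<otimes>\<^bsub>H\<^esub> pX b"
    by (simp add: Phi_def AB b_def ct_cnj)
  show ?thesis
  proof (cases i)
    case Tp
    then have "A = b" using x AB unfolding b_def by (simp only: K_group_Tp)
    then have "nX (A ** ct b) = \<one>\<^bsub>H\<^esub>" using b hn(3) by simp
    then show ?thesis using Phi b \<open>A = b\<close> Tp hp(1)[OF b(1)] by (simp add: pX_def AB)
  next
    case Tq
    then have "B \<in> Ug 3" using x AB by (simp only: K_group_Tq)
    then have bU: "b \<in> Ug 3" unfolding b_def by (rule Ug_cnj)
    have "pX b = \<phi> Tq (b, mat_cnj b)" unfolding pX_def by (rule \<phi>_compat[OF K_p[OF b(1)] K_pq[OF bU]])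
    then have "Phi x = \<phi> Tq ((A ** ct b, mat 1) \<otimes>\<^bsub>SS\<^esub> (b, mat_cnj b))"
      using \<phi>_mult[OF K_q K_pq[OF bU], of "A ** ct b"] AB b Phi by (simp add: nX_def)
    then show ?thesis using b Tq AB by simp
  next
    case Td
    have "(A, B) \<in> K_group Td" using x unfolding AB(1) Td .
    then obtain z where z: "cnj z * z = 1" "A *v e 1 = cnj z *s e 1" "B *v e 1 = z *s e 1"
      unfolding K_group_Td by blast
    have be: "b *v e 1 = cnj z *s e 1" using z(3) unfolding b_def mv_e1 by simp
    then have bU: "b \<in> Ug 1" using b(1) by (auto simp: Ug_def)
    have "e 1 = cnj z *s (ct b *v e 1)"
      using SU_ct_simps(8)[OF b(1), of "e 1"] unfolding be mv_scale ..
    then have "z *s e 1 = (z * cnj z) *s (ct b *v e 1)" by (metis vector_smult_assoc)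
    then have "ct b *v e 1 = z *s e 1" using z(1) by (simp add: mult.commute)
    then have S: "A ** ct b \<in> Sg 1"
      using AB b z by (simp add: Sg_def mv_assoc mv_scale vector_smult_assoc mult.commute)
    have "pX b = \<phi> Td (b, mat_cnj b)" unfolding pX_def by (rule \<phi>_compat[OF K_p[OF b(1)] K_pd[OF bU]])
    moreover have "nX (A ** ct b) = \<phi> Td (A ** ct b, mat 1)"
      unfolding nX_def by (rule \<phi>_compat[OF K_q[OF Sg_SU[OF S]] K_qd[OF S]])
    ultimately have "Phi x = \<phi> Td ((A ** ct b, mat 1) \<otimes>\<^bsub>SS\<^esub> (b, mat_cnj b))"
      using \<phi>_mult[OF K_qd[OF S] K_pd[OF bU]] Phi by simp
    then show ?thesis using b Td AB by simp
  qed
qed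

lemma Phi_closed: "x \<in> carrier SS \<Longrightarrow> Phi x \<in> carrier H"
  using Phi_hom unfolding hom_def by blast

lemma Phi_mult: "x \<in> carrier SS \<Longrightarrow> y \<in> carrier SS \<Longrightarrow> Phi (x \<otimes>\<^bsub>SS\<^esub> y) = Phi x \<otimes>\<^bsub>H\<^esub> Phi y"
  using hom_mult[OF Phi_hom] .

lemma Phi_group_hom: "group_hom SS H Phi"
  using Phi_hom group_SS group_H by (simp add: group_hom_def group_hom_axioms_def)

text \<open>Consecutive chambers of a gallery share a point or a plane.\<close>

lemma Phi_surj: "Phi ` carrier SS = carrier H"
proof
  interpret G: group H by (rule group_H)
  interpret P: group_hom SS H Phi by (rule Phi_group_hom)
  show "Phi ` carrier SS \<subseteq> carrier H" using Phi_closed by blast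
  let ?H0 = "Phi ` carrier SS"
  have H0: "subgroup ?H0 H" by (rule P.img_is_subgroup)
  have st: "stab i \<subseteq> ?H0" for i
  proof
    fix g assume "g \<in> stab i"
    then obtain x where x: "x \<in> K_group i" "g = \<phi> i x" unfolding \<phi>_image[symmetric] by (rule imageE)
    have "g = Phi x" using Phi_\<phi>[OF x(1)] x(2) by simp
    then show "g \<in> ?H0" using K_carrier[OF x(1)] by (rule image_eqI)
  qed
  have step: "b \<in> ?H0" if a: "a \<in> ?H0" and b: "b \<in> carrier H"
    and two: "2 \<le> card (act X a ` \<gamma> \<inter> act X b ` \<gamma>)" for a b
  proof -
    have aH: "a \<in> carrier H" using a Phi_closed by blast
    let ?S = "act X a ` \<gamma> \<inter> act X b ` \<gamma>"
    have g\<gamma>: "\<gamma> \<subseteq> \<Union>\<Delta>\<^sub>X" using chamber_simplex[OF chamber] by blast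
    \<comment> \<open>Two vertices of one chamber cannot both be lines.\<close>
    have "\<exists>v\<in>?S. type_fun X v \<noteq> Td"
    proof (rule ccontr)
      assume "\<not> ?thesis"
      moreover have "?S \<subseteq> act X a ` \<gamma>" by blast
      moreover have "inj_on (type_fun X) (act X a ` \<gamma>)"
        using act_simplex[OF aH chamber_simplex[OF chamber]] geo unfolding geometry_def by blast
      ultimately have "\<forall>v\<in>?S. \<forall>w\<in>?S. v = w" by (metis inj_onD subsetD)
      then have "card ?S \<le> 1" by (metis card_le_Suc0_iff_eq One_nat_def card.infinite le_numeral_extra(3) nat_le_linear zero_le_one)
      then show False using two by linarith
    qed
    then obtain v where v0: "type_fun X v \<noteq> Td" "v \<in> act X a ` range gv" "v \<in> act X b ` range gv"
      unfolding range_gv by blast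
    then obtain i j where v: "type_fun X v \<noteq> Td" "v = act X a (gv i)" "v = act X b (gv j)" by blast
    have "type_fun X v = i" unfolding v(2) act_type[OF aH gv_vertex] gv(2) ..
    moreover have "type_fun X v = j" unfolding v(3) act_type[OF b gv_vertex] gv(2) ..
    ultimately have ij: "j = i" "i \<noteq> Td" using v(1) by simp_all
    have ia: "inv\<^bsub>H\<^esub> a \<in> carrier H" using aH by simp
    have "act X (inv\<^bsub>H\<^esub> a \<otimes>\<^bsub>H\<^esub> b) (gv i) = act X (inv\<^bsub>H\<^esub> a) (act X a (gv i))"
      unfolding act_mult[OF ia b gv_vertex] using v(2,3) ij by simp
    also have "\<dots> = gv i" by (rule act_inv[OF aH gv_vertex])
    finally have "inv\<^bsub>H\<^esub> a \<otimes>\<^bsub>H\<^esub> b \<in> stab i" using ia b by (simp add: stab_def)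
    then have "inv\<^bsub>H\<^esub> a \<otimes>\<^bsub>H\<^esub> b \<in> ?H0" using st by blast
    then have "a \<otimes>\<^bsub>H\<^esub> (inv\<^bsub>H\<^esub> a \<otimes>\<^bsub>H\<^esub> b) \<in> ?H0" by (rule subgroup.m_closed[OF H0 a])
    then show ?thesis using group.inv_cancel(2)[OF group_H aH b] by simp
  qed
  show "carrier H \<subseteq> ?H0"
  proof
    fix g assume g: "g \<in> carrier H"
    have chg: "act X g ` \<gamma> \<in> chambers \<Delta>\<^sub>X" if g: "g \<in> carrier H" for g
    proof -
      have "chamber_complex 3 \<Delta>\<^sub>X" using geo unfolding geometry_def card_pdq by metis
      then have pure: "pure_of_rank 3 \<Delta>\<^sub>X" unfolding chamber_complex_def by blast
      obtain d where d: "d \<in> chambers \<Delta>\<^sub>X" "act X g ` \<gamma> \<subseteq> d"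
        using pure act_simplex[OF g chamber_simplex[OF chamber]] unfolding pure_of_rank_def by blast
      have fd: "finite d" and cd: "card d = 3" using pure d(1) unfolding pure_of_rank_def by (metis card.infinite zero_neq_numeral)+
      have "inj_on (act X g) \<gamma>"
        using act_inv[OF g] chamber_simplex[OF chamber] by (metis UnionI inj_on_inverseI)
      then have "card (act X g ` \<gamma>) = 3" using pure chamber unfolding pure_of_rank_def by (simp add: card_image)
      then have "act X g ` \<gamma> = d" using d(2) fd cd by (intro card_subset_eq) auto
      then show ?thesis using d(1) by simp
    qed
    have "chamber_complex 3 \<Delta>\<^sub>X" using geo unfolding geometry_def card_pdq by metis
    then obtain cs where cs: "gallery 3 \<Delta>\<^sub>X cs" "hd cs = \<gamma>" "last cs = act X g ` \<gamma>"
      using chamber chg[OF g] unfolding chamber_complex_def by blast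
    have cs': "cs \<noteq> []" "set cs \<subseteq> chambers \<Delta>\<^sub>X" "successively (\<lambda>c d. 3 \<le> card (c \<inter> d) + 1) cs"
      using cs(1) unfolding gallery_def by blast+
    have "\<forall>b\<in>carrier H. act X b ` \<gamma> = last cs \<longrightarrow> b \<in> ?H0"
      using cs' cs(2)
    proof (induction cs rule: rev_induct)
      case (snoc d ds)
      show ?case
      proof (cases "ds = []")
        case True
        then have "d = \<gamma>" using snoc.prems by simp
        have one: "\<one>\<^bsub>H\<^esub> \<in> ?H0" by (rule subgroup.one_closed[OF H0])
        have e1: "act X \<one>\<^bsub>H\<^esub> ` \<gamma> = \<gamma>"
        proof -
          have "act X \<one>\<^bsub>H\<^esub> ` \<gamma> = (\<lambda>v. v) ` \<gamma>"
            by (rule image_cong) (use act_one chamber_simplex[OF chamber] in auto)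
          then show ?thesis by simp
        qed
        have c3: "card \<gamma> = 3" using chamber \<open>chamber_complex 3 \<Delta>\<^sub>X\<close> unfolding chamber_complex_def pure_of_rank_def by blast
        show ?thesis using step[OF one] e1 c3 \<open>d = \<gamma>\<close> True by auto
      next
        case False
        have IH: "\<forall>b\<in>carrier H. act X b ` \<gamma> = last ds \<longrightarrow> b \<in> ?H0"
          using snoc False by (auto simp: successively_append_iff)
        have "last ds \<in> chambers \<Delta>\<^sub>X" using snoc.prems False by auto
        then obtain a where a: "a \<in> carrier H" "act X a ` \<gamma> = last ds" using transitive[OF chamber] by blast
        then have a0: "a \<in> ?H0" using IH by blast
        have two: "2 \<le> card (last ds \<inter> d)" using snoc.prems False by (simp add: successively_append_iff)
        show ?thesis
        proof (intro ballI impI)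
          fix b assume b: "b \<in> carrier H" "act X b ` \<gamma> = last (ds @ [d])"
          show "b \<in> ?H0" by (rule step[OF a0 b(1)]) (use two a(2) b(2) in simp)
        qed
      qed
    qed simp
    then show "g \<in> ?H0" using g cs(3) by blast
  qed
qed

text \<open>An eigenvector of \<open>B\<close> conjugates \<open>(A, B)\<close> into the
  stabilizer of the base point, on which \<open>Phi\<close> is known to be injective modulo
  \<open>Z\<close>.\<close>

lemma Phi_kernel:
  assumes x: "x \<in> carrier SS" shows "Phi x = \<one>\<^bsub>H\<^esub> \<longleftrightarrow> x \<in> Z_group"
proof
  interpret S: group SS by (rule group_SS)
  interpret G: group H by (rule group_H)
  interpret P: group_hom SS H Phi by (rule Phi_group_hom)
  assume 1: "Phi x = \<one>\<^bsub>H\<^esub>"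
  obtain A B where AB: "x = (A, B)" "A \<in> SU" "B \<in> SU" using x by auto
  obtain Y where Y: "Y \<in> SU" "ct Y ** B ** Y \<in> Ug 3" by (rule SU_eigenvector[OF AB(3)])
  define y where "y = (mat 1 :: complex^3^3, Y)"
  have y: "y \<in> carrier SS" using Y by (simp add: y_def)
  define z where "z = inv\<^bsub>SS\<^esub> y \<otimes>\<^bsub>SS\<^esub> x \<otimes>\<^bsub>SS\<^esub> y"
  have zc: "z \<in> carrier SS" using x y by (simp add: z_def del: SS_simps)
  have "z = (A, ct Y ** B ** Y)" using Y by (simp add: z_def y_def AB)
  then have zq: "z \<in> K_group Tq" using Y AB by (simp only: K_group_Tq)
  have "Phi z = inv\<^bsub>H\<^esub> (Phi y) \<otimes>\<^bsub>H\<^esub> Phi x \<otimes>\<^bsub>H\<^esub> Phi y"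
    using x y by (simp add: z_def del: SS_simps)
  also have "\<dots> = \<one>\<^bsub>H\<^esub>" using 1 Phi_closed[OF y] by simp
  finally have "\<phi> Tq z = \<one>\<^bsub>H\<^esub>" using Phi_\<phi>[OF zq] by simp
  then have zZ: "z \<in> Z_group" by (rule \<phi>_kernel[OF zq])
  have "x = y \<otimes>\<^bsub>SS\<^esub> z \<otimes>\<^bsub>SS\<^esub> inv\<^bsub>SS\<^esub> y"
    using x y by (simp add: z_def S.m_assoc del: SS_simps)
  then show "x \<in> Z_group" using normal.inv_op_closed2[OF Z_group_normal y zZ] by simp
next
  assume z: "x \<in> Z_group"
  have "proj_Z x = proj_Z \<one>\<^bsub>SS\<^esub>"
  proof -
    have oneS: "\<one>\<^bsub>SS\<^esub> \<in> carrier SS" by simp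
    have "inv\<^bsub>SS\<^esub> \<one>\<^bsub>SS\<^esub> \<otimes>\<^bsub>SS\<^esub> x = x"
      by (rule SS_inv_one_mult[OF x])
    then show ?thesis using proj_eq_iff[OF x oneS] z by simp
  qed
  moreover have xp: "x \<in> K_group Tp" using z unfolding Z_group_def by blast
  ultimately have "\<phi> Tp x = \<phi> Tp \<one>\<^bsub>SS\<^esub>" by (simp add: \<phi>_def)
  then show "Phi x = \<one>\<^bsub>H\<^esub>" using Phi_\<phi>[OF xp] \<phi>_one by simp
qed

lemma Phi_cont: "continuous_map TS T Phi"
proof -
  let ?a = "\<lambda>x :: mat_pair. (fst x ** transpose (snd x), mat 1 :: complex^3^3)"
  let ?b = "\<lambda>x :: mat_pair. (mat_cnj (snd x), snd x)"
  have "continuous_map TS (subtopology TS (K_group Tq)) ?a"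
  proof -
    have "continuous_map TS euclidean ?a" by simp (intro continuous_intros)
    moreover have "?a x \<in> carrier SS \<and> ?a x \<in> K_group Tq" if "x \<in> topspace TS" for x
    proof -
      have "fst x ** transpose (snd x) \<in> SU" using that by (auto simp flip: mat_cnj_ct)
      then show ?thesis using K_q by (simp del: K_group.simps)
    qed
    ultimately show ?thesis by (auto simp: continuous_map_in_subtopology simp del: K_group.simps)
  qed
  then have 1: "continuous_map TS T (\<phi> Tq \<circ> ?a)" using \<phi>_cont by (rule continuous_map_compose)
  have "continuous_map TS (subtopology TS (K_group Tp)) ?b"
  proof -
    have "continuous_map TS euclidean ?b" by simp (intro continuous_intros)
    moreover have "?b x \<in> carrier SS \<and> ?b x \<in> K_group Tp" if "x \<in> topspace TS" for x
      using that by (auto simp: K_group_Tp simp del: K_group.simps)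
    ultimately show ?thesis by (auto simp: continuous_map_in_subtopology simp del: K_group.simps)
  qed
  then have 2: "continuous_map TS T (\<phi> Tp \<circ> ?b)" using \<phi>_cont by (rule continuous_map_compose)
  have "continuous_map TS (prod_topology T T) (\<lambda>x. ((\<phi> Tq \<circ> ?a) x, (\<phi> Tp \<circ> ?b) x))"
    using 1 2 by (rule continuous_map_pairedI)
  moreover have "continuous_map (prod_topology T T) T (\<lambda>(x, y). x \<otimes>\<^bsub>H\<^esub> y)"
    using top_group unfolding topological_group_def by blast
  ultimately have "continuous_map TS T ((\<lambda>(x, y). x \<otimes>\<^bsub>H\<^esub> y) \<circ> (\<lambda>x. ((\<phi> Tq \<circ> ?a) x, (\<phi> Tp \<circ> ?b) x)))"
    by (rule continuous_map_compose)
  then show ?thesis by (rule continuous_map_eq) (simp add: Phi_def nX_def pX_def)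
qed

lemma Phi_eq_iff:
  assumes x: "x \<in> carrier SS" and y: "y \<in> carrier SS"
  shows "Phi x = Phi y \<longleftrightarrow> inv\<^bsub>SS\<^esub> y \<otimes>\<^bsub>SS\<^esub> x \<in> Z_group"
proof -
  interpret S: group SS by (rule group_SS)
  interpret G: group H by (rule group_H)
  interpret P: group_hom SS H Phi by (rule Phi_group_hom)
  have c: "inv\<^bsub>SS\<^esub> y \<otimes>\<^bsub>SS\<^esub> x \<in> carrier SS" by (rule S.m_closed[OF S.inv_closed[OF y] x])
  have "Phi (inv\<^bsub>SS\<^esub> y \<otimes>\<^bsub>SS\<^esub> x) = inv\<^bsub>H\<^esub> (Phi y) \<otimes>\<^bsub>H\<^esub> Phi x"
    using P.hom_mult[OF S.inv_closed[OF y] x] P.hom_inv[OF y] by (simp only:)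
  moreover have "inv\<^bsub>H\<^esub> (Phi y) \<otimes>\<^bsub>H\<^esub> Phi x = \<one>\<^bsub>H\<^esub> \<longleftrightarrow> Phi x = Phi y"
    using group.inv_cancel(2)[OF group_H Phi_closed[OF y] Phi_closed[OF x]] group.l_inv[OF group_H Phi_closed[OF y]] monoid.r_one[OF group.is_monoid[OF group_H] Phi_closed[OF y]]
    by metis
  ultimately show ?thesis using Phi_kernel[OF c] by (simp only:)
qed

lemma Phi_fixes:
  assumes x: "x \<in> carrier SS" shows "act X (Phi x) (gv i) = gv i \<longleftrightarrow> x \<in> K_group i"
proof
  assume "x \<in> K_group i"
  then have "Phi x \<in> stab i" using Phi_\<phi> \<phi>_image by blast
  then show "act X (Phi x) (gv i) = gv i" by (simp add: stab_def)
next
  interpret S: group SS by (rule group_SS)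
  assume "act X (Phi x) (gv i) = gv i"
  then have "Phi x \<in> stab i" using Phi_closed[OF x] by (simp add: stab_def)
  then obtain k where k: "k \<in> K_group i" "Phi x = \<phi> i k" unfolding \<phi>_image[symmetric] by (rule imageE)
  note kc = K_carrier[OF k(1)]
  have "Phi x = Phi k" using k Phi_\<phi>[OF k(1)] by (simp only:)
  then have z: "inv\<^bsub>SS\<^esub> k \<otimes>\<^bsub>SS\<^esub> x \<in> Z_group" using Phi_eq_iff[OF x kc] by (simp only:)
  have "x = k \<otimes>\<^bsub>SS\<^esub> (inv\<^bsub>SS\<^esub> k \<otimes>\<^bsub>SS\<^esub> x)" by (rule S.inv_cancel(2)[OF kc x, symmetric])
  then have "mv x (base i) = mv k (mv (inv\<^bsub>SS\<^esub> k \<otimes>\<^bsub>SS\<^esub> x) (base i))" by (metis mv_mult)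
  also have "mv (inv\<^bsub>SS\<^esub> k \<otimes>\<^bsub>SS\<^esub> x) (base i) = base i" by (rule Z_group_trivial[OF z base_vertices(1)])
  also have "mv k (base i) = base i" using k(1) unfolding K_group_stabilizer by blast
  finally show "x \<in> K_group i" using x unfolding K_group_stabilizer by blast
qed

text \<open>Every vertex has this form, and the pairs \<open>(x, i)\<close> that describe the
  same vertex are determined by the three given groups alone; so these coordinates can be
  compared between two geometries.\<close>

definition vtx :: "mat_pair \<Rightarrow> pdq \<Rightarrow> 'v" where "vtx x i = act X (Phi x) (gv i)"

lemma vtx_vertex: "x \<in> carrier SS \<Longrightarrow> vtx x i \<in> \<Union>\<Delta>\<^sub>X"
  unfolding vtx_def by (rule act_vertex[OF Phi_closed gv_vertex])

lemma vtx_type: "x \<in> carrier SS \<Longrightarrow> type_fun X (vtx x i) = i"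
  unfolding vtx_def using act_type[OF Phi_closed gv_vertex] gv(2) by simp

lemma vtx_mult: "x \<in> carrier SS \<Longrightarrow> y \<in> carrier SS \<Longrightarrow> act X (Phi x) (vtx y i) = vtx (x \<otimes>\<^bsub>SS\<^esub> y) i"
  unfolding vtx_def using act_mult[OF Phi_closed Phi_closed gv_vertex] Phi_mult by simp

lemma vtx_eq_iff:
  assumes x: "x \<in> carrier SS" and y: "y \<in> carrier SS"
  shows "vtx x i = vtx y j \<longleftrightarrow> i = j \<and> inv\<^bsub>SS\<^esub> y \<otimes>\<^bsub>SS\<^esub> x \<in> K_group i"
proof -
  interpret S: group SS by (rule group_SS)
  note iy = S.inv_closed[OF y]
  have c: "inv\<^bsub>SS\<^esub> y \<otimes>\<^bsub>SS\<^esub> x \<in> carrier SS" by (rule S.m_closed[OF iy x])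
  have a: "act X (Phi (inv\<^bsub>SS\<^esub> y)) (vtx x i) = act X (Phi (inv\<^bsub>SS\<^esub> y \<otimes>\<^bsub>SS\<^esub> x)) (gv i)"
    unfolding vtx_mult[OF iy x] unfolding vtx_def ..
  have b: "act X (Phi (inv\<^bsub>SS\<^esub> y)) (vtx y i) = gv i"
    unfolding vtx_mult[OF iy y] S.l_inv[OF y] unfolding vtx_def using Phi_fixes[of "\<one>\<^bsub>SS\<^esub>" i] K_one S.one_closed by blast
  have "vtx x i = vtx y i \<longleftrightarrow> act X (Phi (inv\<^bsub>SS\<^esub> y)) (vtx x i) = act X (Phi (inv\<^bsub>SS\<^esub> y)) (vtx y i)"
    using inj_onD[OF group_action.inj_prop[OF act_group Phi_closed[OF iy]]] vtx_vertex[OF x] vtx_vertex[OF y] by metis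
  then have "vtx x i = vtx y i \<longleftrightarrow> inv\<^bsub>SS\<^esub> y \<otimes>\<^bsub>SS\<^esub> x \<in> K_group i"
    unfolding a b Phi_fixes[OF c] .
  moreover have "vtx x i = vtx y j \<Longrightarrow> i = j" using vtx_type[OF x, of i] vtx_type[OF y, of j] by simp
  ultimately show ?thesis by blast
qed

lemma simplex_form:
  assumes "\<alpha> \<in> \<Delta>\<^sub>X" obtains x J where "x \<in> carrier SS" "\<alpha> = vtx x ` J"
proof -
  have "chamber_complex 3 \<Delta>\<^sub>X" using geo unfolding geometry_def card_pdq by metis
  then obtain c where c: "c \<in> chambers \<Delta>\<^sub>X" "\<alpha> \<subseteq> c"
    using assms unfolding chamber_complex_def pure_of_rank_def by blast
  obtain g where g: "g \<in> carrier H" "act X g ` \<gamma> = c" using transitive[OF chamber c(1)] by blast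
  obtain x where x: "x \<in> carrier SS" "g = Phi x" using g(1) unfolding Phi_surj[symmetric] by (rule imageE)
  have "range (vtx x) = act X (Phi x) ` range gv" unfolding vtx_def image_image ..
  then have "c = range (vtx x)" using g(2) x(2) unfolding range_gv by simp
  with c(2) have "\<alpha> \<subseteq> range (vtx x)" by simp
  then obtain J where "\<alpha> = vtx x ` J" by (rule subset_imageE)
  with x(1) show ?thesis by (rule that)
qed

lemma vtx_simplex: assumes "x \<in> carrier SS" shows "vtx x ` J \<in> \<Delta>\<^sub>X"
proof -
  have "range (vtx x) = act X (Phi x) ` range gv" unfolding vtx_def image_image ..
  then have "range (vtx x) \<in> \<Delta>\<^sub>X"
    unfolding range_gv using act_simplex[OF Phi_closed[OF assms] chamber_simplex[OF chamber]] by simp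
  moreover have "simplicial_complex \<Delta>\<^sub>X" using geo unfolding geometry_def chamber_complex_def by blast
  ultimately have "\<beta> \<in> \<Delta>\<^sub>X" if "\<beta> \<subseteq> range (vtx x)" for \<beta>
    using that unfolding simplicial_complex_def by simp
  then show ?thesis by (simp add: image_mono)
qed

lemma vertex_form:
  assumes "v \<in> \<Union>\<Delta>\<^sub>X" obtains x i where "x \<in> carrier SS" "v = vtx x i"
proof -
  obtain \<alpha> where \<alpha>: "\<alpha> \<in> \<Delta>\<^sub>X" "v \<in> \<alpha>" using assms by blast
  obtain x J where x: "x \<in> carrier SS" "\<alpha> = vtx x ` J" using \<alpha>(1) by (rule simplex_form)
  then obtain i where "v = vtx x i" using \<alpha>(2) by blast
  with x(1) show ?thesis by (rule that)
qed

text \<open>A continuous surjection from a compact space to a Hausdorff space is a quotient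
  map.\<close>

lemma Phi_quotient: "quotient_map TS T Phi"
proof (rule continuous_closed_imp_quotient_map[OF Phi_cont])
  show "closed_map TS T Phi" by (rule T1_Spaces.continuous_imp_closed_map[OF Phi_cont compact_TS Hausdorff])
  show "Phi ` topspace TS = topspace T" using Phi_surj topspace_T by simp
qed

end

text \<open>Both groups are the quotient of SU(3) x SU(3) by \<open>Z\<close>, and both vertex
  sets have the same coordinates.\<close>

theorem presented_geometries_isomorphic:
  assumes "presented_geometry X \<gamma> h" and "presented_geometry Y \<delta> k"
  shows "isomorphic_geometries X Y"
proof -
  interpret A: presented_geometry X \<gamma> h by fact
  interpret B: presented_geometry Y \<delta> k by fact
  interpret S: group SS by (rule group_SS)
  define F where "F g = B.Phi (SOME x. x \<in> carrier SS \<and> A.Phi x = g)" for g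
  have F: "F (A.Phi x) = B.Phi x" if x: "x \<in> carrier SS" for x
  proof -
    let ?y = "SOME y. y \<in> carrier SS \<and> A.Phi y = A.Phi x"
    have yy: "?y \<in> carrier SS \<and> A.Phi ?y = A.Phi x" by (rule someI[of _ x]) (rule conjI[OF x refl])
    note y = conjunct1[OF yy] conjunct2[OF yy]
    have "B.Phi ?y = B.Phi x" using y(2) A.Phi_eq_iff[OF y(1) x] B.Phi_eq_iff[OF y(1) x] by (simp only:)
    then show ?thesis by (simp only: F_def)
  qed
  define f where "f v = (let (x, i) = (SOME (x, i). x \<in> carrier SS \<and> A.vtx x i = v) in B.vtx x i)" for v
  have f: "f (A.vtx x i) = B.vtx x i" if x: "x \<in> carrier SS" for x i
  proof -
    let ?P = "\<lambda>(y, j). y \<in> carrier SS \<and> A.vtx y j = A.vtx x i"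
    obtain y j where yj: "(SOME p. ?P p) = (y, j)" by (rule prod.exhaust)
    have "?P (SOME p. ?P p)" by (rule someI[of ?P "(x, i)"]) (simp only: case_prod_conv x simp_thms)
    then have yy: "y \<in> carrier SS \<and> A.vtx y j = A.vtx x i" unfolding yj case_prod_conv .
    note y = conjunct1[OF yy] conjunct2[OF yy]
    have "B.vtx y j = B.vtx x i" using y(2) unfolding A.vtx_eq_iff[OF y(1) x] B.vtx_eq_iff[OF y(1) x] .
    then show ?thesis unfolding f_def yj by (simp only: Let_def case_prod_conv)
  qed
  have Fiso: "F \<in> iso (grp X) (grp Y)"
    unfolding iso_def
  proof (intro CollectI conjI)
    show "F \<in> hom (grp X) (grp Y)"
    proof (rule homI)
      fix a assume "a \<in> carrier (grp X)"
      then obtain x where x: "x \<in> carrier SS" "a = A.Phi x" unfolding A.Phi_surj[symmetric] by (rule imageE)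
      show "F a \<in> carrier (grp Y)" unfolding x(2) F[OF x(1)] by (rule B.Phi_closed[OF x(1)])
      fix b assume "b \<in> carrier (grp X)"
      then obtain y where y: "y \<in> carrier SS" "b = A.Phi y" unfolding A.Phi_surj[symmetric] by (rule imageE)
      show "F (a \<otimes>\<^bsub>grp X\<^esub> b) = F a \<otimes>\<^bsub>grp Y\<^esub> F b"
        unfolding x(2) y(2) A.Phi_mult[OF x(1) y(1), symmetric] F[OF x(1)] F[OF y(1)] F[OF S.m_closed[OF x(1) y(1)]]
        by (rule B.Phi_mult[OF x(1) y(1)])
    qed
    show "bij_betw F (carrier (grp X)) (carrier (grp Y))"
      unfolding bij_betw_def
    proof
      show "inj_on F (carrier (grp X))"
      proof (rule inj_onI)
        fix a b assume "a \<in> carrier (grp X)" "b \<in> carrier (grp X)" and eq: "F a = F b"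
        then obtain x y where x: "x \<in> carrier SS" "a = A.Phi x" and y: "y \<in> carrier SS" "b = A.Phi y"
          unfolding A.Phi_surj[symmetric] by blast
        from eq show "a = b"
          unfolding x(2) y(2) F[OF x(1)] F[OF y(1)] A.Phi_eq_iff[OF x(1) y(1)] B.Phi_eq_iff[OF x(1) y(1)] .
      qed
      have "F ` carrier (grp X) = B.Phi ` carrier SS"
        unfolding A.Phi_surj[symmetric] image_image by (rule image_cong[OF refl F])
      then show "F ` carrier (grp X) = carrier (grp Y)" using B.Phi_surj by (simp only:)
    qed
  qed
  have Fcont: "continuous_map (top_grp X) (top_grp Y) F"
  proof (rule continuous_compose_quotient_map[OF A.Phi_quotient])
    show "continuous_map TS (top_grp Y) (F \<circ> A.Phi)"
      by (rule continuous_map_eq[OF B.Phi_cont]) (use F in simp)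
  qed
  have bij: "bij_betw f (\<Union>(cplx X)) (\<Union>(cplx Y))"
    unfolding bij_betw_def
  proof
    show "inj_on f (\<Union>(cplx X))"
    proof (rule inj_onI)
      fix v w assume v: "v \<in> \<Union>(cplx X)" and w: "w \<in> \<Union>(cplx X)" and eq: "f v = f w"
      obtain x i where x: "x \<in> carrier SS" "v = A.vtx x i" using v by (rule A.vertex_form)
      obtain y j where y: "y \<in> carrier SS" "w = A.vtx y j" using w by (rule A.vertex_form)
      from eq show "v = w"
        unfolding x(2) y(2) f[OF x(1)] f[OF y(1)] A.vtx_eq_iff[OF x(1) y(1)] B.vtx_eq_iff[OF x(1) y(1)] .
    qed
    show "f ` \<Union>(cplx X) = \<Union>(cplx Y)"
    proof
      show "f ` \<Union>(cplx X) \<subseteq> \<Union>(cplx Y)"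
      proof (rule image_subsetI)
        fix v assume "v \<in> \<Union>(cplx X)"
        then obtain x i where x: "x \<in> carrier SS" "v = A.vtx x i" by (rule A.vertex_form)
        show "f v \<in> \<Union>(cplx Y)" unfolding x(2) f[OF x(1)] by (rule B.vtx_vertex[OF x(1)])
      qed
      show "\<Union>(cplx Y) \<subseteq> f ` \<Union>(cplx X)"
      proof
        fix w assume "w \<in> \<Union>(cplx Y)"
        then obtain x i where x: "x \<in> carrier SS" "w = B.vtx x i" by (rule B.vertex_form)
        have "w = f (A.vtx x i)" unfolding x(2) f[OF x(1)] ..
        then show "w \<in> f ` \<Union>(cplx X)" using A.vtx_vertex[OF x(1)] by (rule image_eqI)
      qed
    qed
  qed
  have simp_iff: "\<alpha> \<in> cplx X \<longleftrightarrow> f ` \<alpha> \<in> cplx Y" if a: "\<alpha> \<subseteq> \<Union>(cplx X)" for \<alpha>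
  proof
    have fJ: "f ` A.vtx x ` J = B.vtx x ` J" if "x \<in> carrier SS" for x J
      unfolding image_image by (rule image_cong[OF refl f[OF that]])
    show "f ` \<alpha> \<in> cplx Y" if q: "\<alpha> \<in> cplx X"
    proof -
      obtain x J where x: "x \<in> carrier SS" "\<alpha> = A.vtx x ` J" using q by (rule A.simplex_form)
      show ?thesis unfolding x(2) fJ[OF x(1)] by (rule B.vtx_simplex[OF x(1)])
    qed
    show "\<alpha> \<in> cplx X" if q: "f ` \<alpha> \<in> cplx Y"
    proof -
      obtain x J where x: "x \<in> carrier SS" "f ` \<alpha> = B.vtx x ` J" using q by (rule B.simplex_form)
      have eq: "f ` \<alpha> = f ` A.vtx x ` J" unfolding x(2) fJ[OF x(1)] ..
      have sub: "A.vtx x ` J \<subseteq> \<Union>(cplx X)" by (rule image_subsetI) (rule A.vtx_vertex[OF x(1)])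
      have "\<alpha> = A.vtx x ` J"
        by (rule inj_on_image_eq_iff[OF bij_betw_imp_inj_on[OF bij] a sub, THEN iffD1, OF eq])
      then show ?thesis using A.vtx_simplex[OF x(1)] by (simp only:)
    qed
  qed
  have type_eq: "type_fun Y (f v) = type_fun X v" if v: "v \<in> \<Union>(cplx X)" for v
  proof -
    obtain x i where x: "x \<in> carrier SS" "v = A.vtx x i" using v by (rule A.vertex_form)
    show ?thesis unfolding x(2) f[OF x(1)] A.vtx_type[OF x(1)] B.vtx_type[OF x(1)] ..
  qed
  have equi: "f (act X g v) = act Y (F g) (f v)" if g: "g \<in> carrier (grp X)" and v: "v \<in> \<Union>(cplx X)" for g v
  proof -
    obtain x i where x: "x \<in> carrier SS" "v = A.vtx x i" using v by (rule A.vertex_form)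
    obtain y where y: "y \<in> carrier SS" "g = A.Phi y" using g unfolding A.Phi_surj[symmetric] by (rule imageE)
    show ?thesis
      unfolding x(2) y(2) F[OF y(1)] f[OF x(1)] A.vtx_mult[OF y(1) x(1)] B.vtx_mult[OF y(1) x(1)]
      by (rule f[OF S.m_closed[OF y(1) x(1)]])
  qed
  show ?thesis
    unfolding isomorphic_geometries_def
    by (intro exI[of _ F] exI[of _ f] conjI allI impI ballI Fiso Fcont bij simp_iff type_eq equi)
qed

lemma presented_of_belongs:
  assumes "compact_group_geometry UNIV C3_matrix X" "belongs_to UNIV X complex_G"
  obtains \<gamma> h where "presented_geometry X \<gamma> h"
proof -
  obtain \<gamma> h where "\<gamma> \<in> chambers (cplx X)" "continuous_complex_iso UNIV complex_G (stabilizer_complex X \<gamma>) h"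
    using assms(2) unfolding belongs_to_def by blast
  moreover have "homogeneous_compact_geometry UNIV C3_matrix X"
    using assms(1) unfolding compact_group_geometry_def by (rule conjunct1)
  ultimately show ?thesis by (intro that presented_geometry.intro)
qed

theorem theorem3p18:
  shows "(\<exists>X :: (mat_pair set, mat_pair set set, pdq) group_geometry.
            compact_group_geometry UNIV C3_matrix X \<and> belongs_to UNIV X complex_G)
       \<and> (\<forall>(X :: ('g, 'v, pdq) group_geometry) (Y :: ('h, 'w, pdq) group_geometry).
            compact_group_geometry UNIV C3_matrix X \<and> belongs_to UNIV X complex_G \<and>
            compact_group_geometry UNIV C3_matrix Y \<and> belongs_to UNIV Y complex_G \<longrightarrow>
            isomorphic_geometries X Y)"
proof (intro conjI allI impI)
  show "\<exists>X :: (mat_pair set, mat_pair set set, pdq) group_geometry.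
      compact_group_geometry UNIV C3_matrix X \<and> belongs_to UNIV X complex_G"
    using flat_compact flat_belongs by (intro exI[of _ flat_geometry] conjI)
  fix X :: "('g, 'v, pdq) group_geometry" and Y :: "('h, 'w, pdq) group_geometry"
  assume a: "compact_group_geometry UNIV C3_matrix X \<and> belongs_to UNIV X complex_G \<and>
            compact_group_geometry UNIV C3_matrix Y \<and> belongs_to UNIV Y complex_G"
  obtain \<gamma> h where X: "presented_geometry X \<gamma> h"
    by (rule presented_of_belongs[of X]) (use a in simp_all)
  obtain \<delta> k where Y: "presented_geometry Y \<delta> k"
    by (rule presented_of_belongs[of Y]) (use a in simp_all)
  show "isomorphic_geometries X Y" using X Y by (rule presented_geometries_isomorphic)
qed

end
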